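(* Let $\mathcal X_7$ be the smooth projective model over $\mathbb F_7$ of $$y^2=6x^6+x^5+6x^4+x^3+6x^2+x+1 .$$ With the notation of the context, the degrees $s=1$ and $s=4$ satisfy $$G_1\wedge A_1=G_4\wedge A_4=D_\infty,\qquad G_1\vee A_1=G_4\vee A_4=\mathrm{Ram}+4D_\infty,\qquad t(1)=t(4)=0,$$ while $\varepsilon(G_1,A_1)=0$ and $\varepsilon(G_4,A_4)=1$. Hence the excess is a function neither of the pair $(G_s\wedge A_s,\,G_s\vee A_s)$ nor of the class $[K-G_s\wedge A_s]\in\operatorname{Pic}^0(\mathcal X_7)$, both of which the two degrees present identically.
   Context: The curve $\mathcal X_7$ has genus $2$ and $14$ affine $\mathbb F_7$-rational points (two over each $a\in\mathbb F_7$). $D$ is the sum of these $14$ points; $\mathrm{Ram}$ is the reduced divisor of the six geometric points over the roots of the sextic; $D_\infty$ is the reduced divisor of the two geometric points over $x=\infty$. For $1\le s\le4$ put $G_s=sD_\infty$, $K=\operatorname{div}(-dx/(x^7-x))=\mathrm{Ram}-D+5D_\infty$, $A_s=D-G_s+K=\mathrm{Ram}+(5-s)D_\infty$, and $t(s)=\deg(G_s\vee A_s-D)=2-2\min\{s,5-s\}$. $\wedge,\vee$ denote the coefficientwise minimum and maximum of divisors. $L(G)=\{h\in\mathbb F_7(\mathcal X_7)^*:\operatorname{div}(h)+G\ge0\}\cup\{0\}$, and the excess of a pair $(G,A)$ is $$\varepsilon(G,A)=\dim_{\mathbb F_7}\frac{(L(G)+L(A))\cap L(G\vee A-D)}{L(G-D)+L(A-D)}.$$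 *)

theory Defs
  imports
    "Berlekamp_Zassenhaus.Finite_Field"
    "HOL-Computational_Algebra.Polynomial_Factorial"
begin

section \<open>The field with seven elements\<close>

typedef seven = "{..<7::nat}"
  by (rule exI[of _ 0]) simp

lemma CARD_seven: "CARD(seven) = 7"
  by (simp add: type_definition.card[OF type_definition_seven])

instance seven :: finite
  by standard (simp add: type_definition.univ[OF type_definition_seven])

instance seven :: prime_card
  by standard (simp add: CARD_seven)

type_synonym F7 = "seven mod_ring"

lemma F7_six_nonsquare:
  fixes c :: F7
  shows "c * c \<noteq> 6"
proof
  assume "c * c = 6"
  define k where "k = to_int_mod_ring c"
  have "k \<in> {0..<7}"
    using range_to_int_mod_ring[where 'a = seven] by (auto simp: CARD_seven k_def)
  moreover have "(6 :: F7) = of_int_mod_ring 6"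
    by (metis of_int_numeral of_int_of_int_mod_ring)
  then have "to_int_mod_ring (6 :: F7) = 6"
    using to_int_mod_ring_of_int_mod_ring[of 6, where 'a = seven] by (simp only: CARD_seven)
  then have "k * k mod 7 = 6"
    using \<open>c * c = 6\<close> to_int_mod_ring_mult[of c c] by (simp add: CARD_seven k_def)
  moreover have "k = 0 \<or> k = 1 \<or> k = 2 \<or> k = 3 \<or> k = 4 \<or> k = 5 \<or> k = 6"
    using calculation(1) by auto
  ultimately show False
    by auto
qed

lemma F7_six_nonzero: "(6 :: F7) \<noteq> 0"
  using F7_six_nonsquare[of 0] by auto

section \<open>The function field\<close>

definition sextic :: "F7 poly" where
  "sextic = [:1, 1, 6, 1, 6, 1, 6:]"

lemma degree_sextic: "degree sextic = 6" and lead_coeff_sextic: "lead_coeff sextic = 6"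
  using F7_six_nonzero by (simp_all add: sextic_def)

lemma sextic_nonzero: "sextic \<noteq> 0"
  using degree_sextic by auto

definition norm_form :: "F7 poly \<Rightarrow> F7 poly \<Rightarrow> F7 poly" where
  "norm_form p q = p * p - sextic * (q * q)"

definition pole_deg :: "F7 poly \<Rightarrow> F7 poly \<Rightarrow> nat" where
  "pole_deg p q = max (degree p) (if q = 0 then 0 else degree q + 3)"

lemma norm_form_degree:
  assumes "p \<noteq> 0 \<or> q \<noteq> 0"
  shows "norm_form p q \<noteq> 0" "degree (norm_form p q) = 2 * pole_deg p q"
proof -
  have "norm_form p q \<noteq> 0 \<and> degree (norm_form p q) = 2 * pole_deg p q"
  proof (cases "q = 0")
    case True
    then show ?thesis
      using assms by (simp add: norm_form_def pole_deg_def degree_mult_eq)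
  next
    case q: False
    have dq: "degree (sextic * (q * q)) = 2 * (degree q + 3)"
      using q sextic_nonzero by (simp add: degree_mult_eq degree_sextic)
    have nq: "sextic * (q * q) \<noteq> 0"
      using q sextic_nonzero by simp
    show ?thesis
    proof (cases "p = 0")
      case True
      then show ?thesis
        using dq nq q by (simp add: norm_form_def pole_deg_def)
    next
      case p: False
      have dp: "degree (p * p) = 2 * degree p"
        using p by (simp add: degree_mult_eq)
      consider "degree p < degree q + 3" | "degree p > degree q + 3" | "degree p = degree q + 3"
        by linarith
      then show ?thesis
      proof cases
        case 1
        then have "degree (norm_form p q) = 2 * (degree q + 3)"
          using degree_add_eq_right[of "p * p" "- (sextic * (q * q))"] dp dq
          by (simp add: norm_form_def)
        then show ?thesis
          using 1 q by (auto simp: pole_deg_def)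
      next
        case 2
        then have "degree (norm_form p q) = 2 * degree p"
          using degree_add_eq_left[of "- (sextic * (q * q))" "p * p"] dp dq
          by (simp add: norm_form_def)
        then show ?thesis
          using 2 q by (auto simp: pole_deg_def)
      next
        case 3
        let ?n = "2 * degree p"
        have "coeff (p * p) ?n = lead_coeff p * lead_coeff p"
          using dp lead_coeff_mult[of p p] by simp
        moreover have "coeff (sextic * (q * q)) ?n = 6 * (lead_coeff q * lead_coeff q)"
          using dq 3 lead_coeff_mult[of sextic "q * q"] lead_coeff_mult[of q q] lead_coeff_sextic
          by simp
        moreover have "lead_coeff p * lead_coeff p \<noteq> 6 * (lead_coeff q * lead_coeff q)"
        proof
          assume "lead_coeff p * lead_coeff p = 6 * (lead_coeff q * lead_coeff q)"
          then have "(lead_coeff p / lead_coeff q) * (lead_coeff p / lead_coeff q) = 6"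
            using q by (simp add: field_simps)
          then show False
            using F7_six_nonsquare by blast
        qed
        ultimately have c: "coeff (norm_form p q) ?n \<noteq> 0"
          by (simp add: norm_form_def)
        then have "?n \<le> degree (norm_form p q)"
          by (rule le_degree)
        moreover have "degree (norm_form p q) \<le> ?n"
          unfolding norm_form_def by (rule degree_diff_le) (use dp dq 3 in auto)
        ultimately show ?thesis
          using c 3 q by (auto simp: pole_deg_def)
      qed
    qed
  qed
  then show "norm_form p q \<noteq> 0" "degree (norm_form p q) = 2 * pole_deg p q"
    by auto
qed

text \<open>\<open>FF a b\<close> stands for \<open>a + b y\<close> with \<open>a, b\<close> rational functions in \<open>x\<close> and
  \<open>y\<^sup>2 = sextic(x)\<close>.\<close>

datatype funfield = FF (part_1: "F7 poly fract") (part_y: "F7 poly fract")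

lemma common_denominator:
  fixes a b :: "F7 poly fract"
  obtains p q r where "a = Fract p r" "b = Fract q r" "r \<noteq> 0"
proof -
  obtain p s where a: "a = Fract p s" "s \<noteq> 0"
    by (cases a) auto
  obtain q t where b: "b = Fract q t" "t \<noteq> 0"
    by (cases b) auto
  have "a = Fract (p * t) (s * t)" "b = Fract (q * s) (s * t)"
    using a b by (simp_all add: eq_fract algebra_simps)
  moreover have "s * t \<noteq> 0"
    using a b by simp
  ultimately show ?thesis
    using that by blast
qed

definition ff_norm :: "funfield \<Rightarrow> F7 poly fract" where
  "ff_norm h = part_1 h * part_1 h - to_fract sextic * (part_y h * part_y h)"

lemma ff_norm_Fract:
  assumes "r \<noteq> 0"
  shows "ff_norm (FF (Fract p r) (Fract q r)) = Fract (norm_form p q) (r * r)"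
  using assms by (simp add: ff_norm_def norm_form_def to_fract_def eq_fract algebra_simps)

instantiation funfield :: field
begin

definition "0 = FF 0 0"
definition "1 = FF 1 0"
definition "g + h = FF (part_1 g + part_1 h) (part_y g + part_y h)"
definition "- g = FF (- part_1 g) (- part_y g)"
definition "g - h = FF (part_1 g - part_1 h) (part_y g - part_y h)"
definition "g * h =
  FF (part_1 g * part_1 h + to_fract sextic * (part_y g * part_y h))
     (part_1 g * part_y h + part_y g * part_1 h)"
definition "inverse h = FF (part_1 h / ff_norm h) (- part_y h / ff_norm h)"
definition "g div h = g * inverse (h :: funfield)"

lemma ff_norm_nonzero:
  assumes "h \<noteq> 0"
  shows "ff_norm h \<noteq> 0"
proof -
  obtain p q r where h: "part_1 h = Fract p r" "part_y h = Fract q r" and r: "r \<noteq> 0"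
    by (rule common_denominator)
  then have h': "h = FF (Fract p r) (Fract q r)"
    by (cases h) simp
  then have "p \<noteq> 0 \<or> q \<noteq> 0"
    using assms r by (auto simp: zero_funfield_def fract_collapse)
  then have "norm_form p q \<noteq> 0"
    by (rule norm_form_degree)
  then show ?thesis
    using r by (simp add: h' ff_norm_Fract Zero_fract_def eq_fract)
qed

instance
proof
  fix a b c :: funfield
  note defs = zero_funfield_def one_funfield_def plus_funfield_def uminus_funfield_def
    minus_funfield_def times_funfield_def
  show "a * b * c = a * (b * c)" "a * b = b * a" "1 * a = a" "a + b + c = a + (b + c)"
    "a + b = b + a" "0 + a = a" "- a + a = 0" "a - b = a + - b" "(a + b) * c = a * c + b * c"
    "(0 :: funfield) \<noteq> 1"
    by (simp_all add: defs algebra_simps)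
  show "a div b = a * inverse b"
    by (rule divide_funfield_def)
  show "inverse (0 :: funfield) = 0"
    by (simp add: inverse_funfield_def zero_funfield_def)
  assume "a \<noteq> 0"
  then have n: "ff_norm a \<noteq> 0"
    by (rule ff_norm_nonzero)
  have "part_1 a * part_1 a - to_fract sextic * (part_y a * part_y a) = ff_norm a"
    by (simp add: ff_norm_def)
  then show "inverse a * a = 1"
    using n by (simp add: inverse_funfield_def one_funfield_def times_funfield_def field_simps)
qed

end

definition of_poly :: "F7 poly \<Rightarrow> funfield" where
  "of_poly p = FF (to_fract p) 0"

definition fun_x :: funfield where
  "fun_x = of_poly [:0, 1:]"

definition fun_y :: funfield where
  "fun_y = FF 0 1"

lemma of_poly_0 [simp]: "of_poly 0 = 0"
  and of_poly_1 [simp]: "of_poly 1 = 1"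
  and of_poly_add [simp]: "of_poly (p + q) = of_poly p + of_poly q"
  and of_poly_mult [simp]: "of_poly (p * q) = of_poly p * of_poly q"
  by (simp_all add: of_poly_def zero_funfield_def one_funfield_def plus_funfield_def
      times_funfield_def)

lemma of_poly_power [simp]: "of_poly (p ^ n) = of_poly p ^ n"
  by (induction n) simp_all

lemma of_poly_numeral [simp]: "of_poly (numeral n) = numeral n"
  by (induction n) (simp_all only: numeral.simps of_poly_1 of_poly_add)

lemma fun_y_square: "fun_y ^ 2 = of_poly sextic"
  by (simp add: fun_y_def of_poly_def times_funfield_def power2_eq_square)

lemma curve_equation:
  "fun_y ^ 2 = 6 * fun_x ^ 6 + fun_x ^ 5 + 6 * fun_x ^ 4 + fun_x ^ 3 + 6 * fun_x ^ 2 + fun_x + 1"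
proof -
  let ?X = "[:0, 1:] :: F7 poly"
  have "sextic = 6 * ?X ^ 6 + ?X ^ 5 + 6 * ?X ^ 4 + ?X ^ 3 + 6 * ?X ^ 2 + ?X + 1"
    by (simp add: sextic_def eval_nat_numeral numeral_poly one_pCons)
  then have "fun_y ^ 2 = of_poly (6 * ?X ^ 6 + ?X ^ 5 + 6 * ?X ^ 4 + ?X ^ 3 + 6 * ?X ^ 2 + ?X + 1)"
    by (simp only: fun_y_square)
  then show ?thesis
    by (simp only: of_poly_add of_poly_mult of_poly_power of_poly_numeral of_poly_1 fun_x_def)
qed

section \<open>Places\<close>

text \<open>The closed points of the smooth projective model correspond to the normalised discrete
  valuations of the function field that are trivial on the constants.  Since valuations are total
  functions here, the value at \<open>0\<close> is fixed (arbitrarily, to \<open>0\<close>), so that each closed point is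
  counted once.\<close>

definition discrete_valuation :: "(funfield \<Rightarrow> int) \<Rightarrow> bool" where
  "discrete_valuation v \<longleftrightarrow>
     v 0 = 0 \<and>
     (\<forall>g h. g \<noteq> 0 \<longrightarrow> h \<noteq> 0 \<longrightarrow> v (g * h) = v g + v h) \<and>
     (\<forall>g h. g \<noteq> 0 \<longrightarrow> h \<noteq> 0 \<longrightarrow> g + h \<noteq> 0 \<longrightarrow> min (v g) (v h) \<le> v (g + h)) \<and>
     (\<forall>c. c \<noteq> 0 \<longrightarrow> v (of_poly [:c:]) = 0) \<and>
     (\<exists>t. v t = 1)"

text \<open>The next lemmas construct the valuation at infinity; they serve only to show that the type
  of places is inhabited.\<close>

lemma FF_representation:
  obtains p q r where "h = FF (Fract p r) (Fract q r)" "r \<noteq> 0"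
  using common_denominator[of "part_1 h" "part_y h"] by (metis funfield.collapse)

lemma FF_eq_0_iff:
  "r \<noteq> 0 \<Longrightarrow> FF (Fract p r) (Fract q r) = 0 \<longleftrightarrow> p = 0 \<and> q = 0"
  by (simp add: zero_funfield_def Zero_fract_def eq_fract)

definition val_inf :: "funfield \<Rightarrow> int" where
  "val_inf h = (if h = 0 then 0 else
     (SOME n. \<exists>p q r. h = FF (Fract p r) (Fract q r) \<and> r \<noteq> 0 \<and>
        n = int (degree r) - int (pole_deg p q)))"

lemma val_inf_FF:
  assumes "r \<noteq> 0" "p \<noteq> 0 \<or> q \<noteq> 0"
  shows "val_inf (FF (Fract p r) (Fract q r)) = int (degree r) - int (pole_deg p q)"
proof -
  have "n = int (degree r) - int (pole_deg p q)"
    if n: "FF (Fract p r) (Fract q r) = FF (Fract p' r') (Fract q' r')" "r' \<noteq> 0"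
      "n = int (degree r') - int (pole_deg p' q')" for n p' q' r'
  proof -
    have pq': "p' \<noteq> 0 \<or> q' \<noteq> 0"
      using FF_eq_0_iff[OF assms(1), of p q] FF_eq_0_iff[OF n(2), of p' q'] n(1) assms(2) by auto
    have e: "p * r' = p' * r" "q * r' = q' * r"
      using n assms by (simp_all add: eq_fract)
    have "norm_form p q * (r' * r') = (p * r') * (p * r') - sextic * ((q * r') * (q * r'))"
      by (simp add: norm_form_def algebra_simps)
    also have "\<dots> = norm_form p' q' * (r * r)"
      by (simp add: norm_form_def e algebra_simps)
    finally have "degree (norm_form p q * (r' * r')) = degree (norm_form p' q' * (r * r))"
      by simp
    then have "pole_deg p q + degree r' = pole_deg p' q' + degree r"
      using norm_form_degree[OF assms(2)] norm_form_degree[OF pq'] assms(1) n(2)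
      by (simp add: degree_mult_eq)
    then show ?thesis
      using n(3) by simp
  qed
  then have "(SOME n. \<exists>p' q' r'. FF (Fract p r) (Fract q r) = FF (Fract p' r') (Fract q' r') \<and>
      r' \<noteq> 0 \<and> n = int (degree r') - int (pole_deg p' q')) = int (degree r) - int (pole_deg p q)"
    using assms(1) by (intro some_equality) blast+
  moreover have "FF (Fract p r) (Fract q r) \<noteq> 0"
    using assms FF_eq_0_iff by blast
  ultimately show ?thesis
    by (simp only: val_inf_def if_False)
qed

lemma pole_deg_mult:
  assumes "p \<noteq> 0 \<or> q \<noteq> 0" "p' \<noteq> 0 \<or> q' \<noteq> 0"
  shows "p * p' + sextic * (q * q') \<noteq> 0 \<or> p * q' + q * p' \<noteq> 0"
    and "pole_deg (p * p' + sextic * (q * q')) (p * q' + q * p') = pole_deg p q + pole_deg p' q'"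
proof -
  have eq: "norm_form (p * p' + sextic * (q * q')) (p * q' + q * p') =
      norm_form p q * norm_form p' q'"
    by (simp add: norm_form_def algebra_simps)
  have nz: "norm_form p q * norm_form p' q' \<noteq> 0"
    using norm_form_degree assms by simp
  show *: "p * p' + sextic * (q * q') \<noteq> 0 \<or> p * q' + q * p' \<noteq> 0"
    using nz eq by (auto simp: norm_form_def)
  have "degree (norm_form p q * norm_form p' q') = 2 * pole_deg p q + 2 * pole_deg p' q'"
    using norm_form_degree assms by (simp add: degree_mult_eq)
  then show "pole_deg (p * p' + sextic * (q * q')) (p * q' + q * p') =
      pole_deg p q + pole_deg p' q'"
    using norm_form_degree(2)[OF *] eq by simp
qed

lemma pole_deg_add: "pole_deg (p + p') (q + q') \<le> max (pole_deg p q) (pole_deg p' q')"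
  using degree_add_le_max[of p p'] degree_add_le_max[of q q'] by (auto simp: pole_deg_def)

lemma val_inf_mult:
  assumes "g \<noteq> 0" "h \<noteq> 0"
  shows "val_inf (g * h) = val_inf g + val_inf h"
proof -
  obtain p q r where g: "g = FF (Fract p r) (Fract q r)" and r: "r \<noteq> 0"
    by (rule FF_representation)
  obtain p' q' r' where h: "h = FF (Fract p' r') (Fract q' r')" and r': "r' \<noteq> 0"
    by (rule FF_representation)
  have pq: "p \<noteq> 0 \<or> q \<noteq> 0" "p' \<noteq> 0 \<or> q' \<noteq> 0"
    using assms g h r r' FF_eq_0_iff by auto
  have "g * h = FF (Fract (p * p' + sextic * (q * q')) (r * r')) (Fract (p * q' + q * p') (r * r'))"
    using r r' by (simp add: g h times_funfield_def to_fract_def eq_fract algebra_simps)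
  then show ?thesis
    using val_inf_FF[of "r * r'", OF _ pole_deg_mult(1)[OF pq]] val_inf_FF[OF r pq(1)]
      val_inf_FF[OF r' pq(2)] pole_deg_mult(2)[OF pq] r r' g h
    by (simp add: degree_mult_eq)
qed

lemma val_inf_add:
  assumes "g \<noteq> 0" "h \<noteq> 0" "g + h \<noteq> 0"
  shows "min (val_inf g) (val_inf h) \<le> val_inf (g + h)"
proof -
  obtain p q r where g: "g = FF (Fract p r) (Fract q r)" and r: "r \<noteq> 0"
    by (rule FF_representation)
  obtain p' q' r' where h: "h = FF (Fract p' r') (Fract q' r')" and r': "r' \<noteq> 0"
    by (rule FF_representation)
  define s where "s = r * r'"
  have s: "s \<noteq> 0"
    using r r' by (simp add: s_def)
  have g': "g = FF (Fract (p * r') s) (Fract (q * r') s)"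
    and h': "h = FF (Fract (p' * r) s) (Fract (q' * r) s)"
    using r r' by (simp_all add: g h s_def eq_fract)
  have gh: "g + h = FF (Fract (p * r' + p' * r) s) (Fract (q * r' + q' * r) s)"
    using s by (simp add: g' h' plus_funfield_def eq_fract algebra_simps)
  have "p * r' \<noteq> 0 \<or> q * r' \<noteq> 0" "p' * r \<noteq> 0 \<or> q' * r \<noteq> 0"
    "p * r' + p' * r \<noteq> 0 \<or> q * r' + q' * r \<noteq> 0"
    using assms FF_eq_0_iff[OF s] unfolding gh unfolding g' h' by blast+
  then have "val_inf g = int (degree s) - int (pole_deg (p * r') (q * r'))"
    "val_inf h = int (degree s) - int (pole_deg (p' * r) (q' * r))"
    "val_inf (g + h) = int (degree s) - int (pole_deg (p * r' + p' * r) (q * r' + q' * r))"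
    using val_inf_FF[OF s] unfolding gh unfolding g' h' by blast+
  then show ?thesis
    using pole_deg_add[of "p * r'" "p' * r" "q * r'" "q' * r"] by linarith
qed

lemma discrete_valuation_val_inf: "discrete_valuation val_inf"
proof -
  have "val_inf (of_poly [:c:]) = 0" if "c \<noteq> 0" for c
    using val_inf_FF[of 1 "[:c:]" 0] that
    by (simp add: of_poly_def to_fract_def pole_deg_def Zero_fract_def)
  moreover have "val_inf (FF (Fract 1 [:0, 1:]) (Fract 0 [:0, 1:])) = 1"
    by (subst val_inf_FF) (simp_all add: pole_deg_def)
  moreover have "val_inf 0 = 0"
    by (simp add: val_inf_def)
  ultimately show ?thesis
    using val_inf_mult val_inf_add unfolding discrete_valuation_def by blast
qed

typedef place = "{v. discrete_valuation v}"
  morphisms ord_at Place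
  using discrete_valuation_val_inf by blast

section \<open>Divisors, differentials and Riemann--Roch spaces\<close>

text \<open>\<open>V / W\<close> is measured by representatives in \<open>V\<close> of an \<open>F7\<close>-basis of the quotient.\<close>

definition basis_modulo :: "funfield set \<Rightarrow> funfield set \<Rightarrow> funfield set \<Rightarrow> bool" where
  "basis_modulo V W B \<longleftrightarrow>
     finite B \<and> B \<subseteq> V \<and>
     (\<forall>h\<in>V. \<exists>!c :: funfield \<Rightarrow> F7.
        (\<forall>b. b \<notin> B \<longrightarrow> c b = 0) \<and> h - (\<Sum>b\<in>B. of_poly [:c b:] * b) \<in> W)"

definition quotient_dim :: "funfield set \<Rightarrow> funfield set \<Rightarrow> nat" where
  "quotient_dim V W = (THE n. \<exists>B. basis_modulo V W B \<and> card B = n)"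

text \<open>The degree of the residue field over \<open>F7\<close>, i.e. the number of geometric points lying over
  the place.\<close>

definition place_degree :: "place \<Rightarrow> nat" where
  "place_degree P =
     quotient_dim {h. h = 0 \<or> 0 \<le> ord_at P h} {h. h = 0 \<or> 0 < ord_at P h}"

text \<open>A divisor is a finitely supported element of this type; a Galois-stable divisor of geometric
  points is recorded by its coefficient at each place.  The lattice operations \<open>inf\<close> and \<open>sup\<close>
  of functions are the coefficientwise minimum and maximum.\<close>

type_synonym divisor = "place \<Rightarrow> int"

definition divisors :: "divisor set" where
  "divisors = {E. finite {P. E P \<noteq> 0}}"

definition div_degree :: "divisor \<Rightarrow> int" where
  "div_degree E = (\<Sum>P | E P \<noteq> 0. E P * int (place_degree P))"

definition principal :: "funfield \<Rightarrow> divisor" where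
  "principal h = (\<lambda>P. ord_at P h)"

definition RR_space :: "divisor \<Rightarrow> funfield set" where
  "RR_space E = {h. h \<noteq> 0 \<and> (\<forall>P. 0 \<le> principal h P + E P)} \<union> {0}"

definition lin_equiv :: "(divisor \<times> divisor) set" where
  "lin_equiv =
     {(E, E'). E \<in> divisors \<and> E' \<in> divisors \<and> (\<exists>h. h \<noteq> 0 \<and> (\<lambda>P. E P - E' P) = principal h)}"

definition divisor_class :: "divisor \<Rightarrow> divisor set" where
  "divisor_class E = lin_equiv `` {E}"

definition Pic0 :: "divisor set set" where
  "Pic0 = {E \<in> divisors. div_degree E = 0} // lin_equiv"

definition derivation :: "(funfield \<Rightarrow> funfield) \<Rightarrow> bool" where
  "derivation d \<longleftrightarrow>
     (\<forall>g h. d (g + h) = d g + d h) \<and> (\<forall>g h. d (g * h) = g * d h + h * d g) \<and>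
     (\<forall>c. d (of_poly [:c:]) = 0)"

text \<open>The function \<open>dh / dx\<close>; the derivation is unique because \<open>funfield\<close> is separable over
  \<open>F7(x)\<close>.\<close>

definition d_dx :: "funfield \<Rightarrow> funfield" where
  "d_dx = (THE d. derivation d \<and> d fun_x = 1)"

text \<open>The divisor of the differential \<open>g dx\<close>: with a local uniformiser \<open>t\<close> at \<open>P\<close> one has
  \<open>g dx = (g / (dt / dx)) dt\<close>.\<close>

definition div_differential :: "funfield \<Rightarrow> divisor" where
  "div_differential g = (\<lambda>P. ord_at P (g / d_dx (SOME t. ord_at P t = 1)))"

section \<open>The divisors of the code family\<close>

text \<open>\<open>D_inf\<close>, \<open>Ram\<close> and \<open>D_div\<close> are the reduced divisors of the points over \<open>x = \<infinity>\<close>, of the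
  points over the roots of the sextic, and of the affine rational points, respectively; the
  rational points are the places of degree one.\<close>

definition D_inf :: divisor where
  "D_inf P = (if ord_at P fun_x < 0 then 1 else 0)"

definition Ram :: divisor where
  "Ram P = (if 0 < ord_at P (of_poly sextic) then 1 else 0)"

definition D_div :: divisor where
  "D_div P = (if 0 \<le> ord_at P fun_x \<and> place_degree P = 1 then 1 else 0)"

definition G_div :: "nat \<Rightarrow> divisor" where
  "G_div s = (\<lambda>P. int s * D_inf P)"

definition K_div :: divisor where
  "K_div = div_differential (- 1 / (fun_x ^ 7 - fun_x))"

definition A_div :: "nat \<Rightarrow> divisor" where
  "A_div s = (\<lambda>P. D_div P - G_div s P + K_div P)"

definition t_deg :: "nat \<Rightarrow> int" where
  "t_deg s = div_degree (\<lambda>P. sup (G_div s) (A_div s) P - D_div P)"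

definition excess :: "divisor \<Rightarrow> divisor \<Rightarrow> nat" where
  "excess G A =
     quotient_dim
       ({g + a | g a. g \<in> RR_space G \<and> a \<in> RR_space A} \<inter> RR_space (\<lambda>P. sup G A P - D_div P))
       {g + a | g a. g \<in> RR_space (\<lambda>P. G P - D_div P) \<and> a \<in> RR_space (\<lambda>P. A P - D_div P)}"

definition meet_class :: "nat \<Rightarrow> divisor set" where
  "meet_class s = divisor_class (\<lambda>P. K_div P - inf (G_div s) (A_div s) P)"

end

theory Submission
  imports Defs
begin

text \<open>
  Put \<open>u = x + 1\<close>.  The sextic is \<open>2 - u^6\<close>, so \<open>x^7 - x = u^7 - u = u (1 - y^2)\<close>, and the function
  \<open>h = (x^7 - x) / y = u / y - u y\<close> carries the whole statement.  Its divisor is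
  \<open>D - Ram - 4 D_inf\<close>: the numerator vanishes simply at the 14 affine rational points and has pole
  order 7 at infinity, and \<open>y\<close> has divisor \<open>Ram - 3 D_inf\<close>.  The differential \<open>dx / y\<close> has
  divisor \<open>D_inf\<close>, so \<open>K - D_inf = - div h = Ram + 4 D_inf - D\<close>.  For both degrees the meet is
  \<open>D_inf\<close> and the join minus \<open>D\<close> is this same principal divisor; its Riemann--Roch space is the line
  spanned by \<open>h\<close> (\<open>RR_space_residual\<close>).

  The two degrees differ in how the join is reached.  For \<open>s = 1\<close> one has \<open>G \<le> A\<close>, so
  numerator and denominator of the excess are both \<open>L(A - D)\<close> (\<open>excess_le_eq_0\<close>).  For \<open>s = 4\<close> the
  splitting \<open>h = u / y - u y\<close> puts \<open>h\<close> into \<open>L(Ram + D_inf) + L(4 D_inf)\<close>, while \<open>L(G - D)\<close> and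
  \<open>L(A - D)\<close> are subspaces of the line of \<open>h\<close> that miss \<open>h\<close>: the first allows no pole at the
  ramification places, the second only a simple pole at infinity (\<open>excess_4\<close>).

  Since a place is an arbitrary normalised valuation, all places must be classified before divisors can
  be computed.  A valuation with a pole at \<open>x\<close> is determined by degrees (\<open>pole_imp_val_inf\<close>).
  Any other valuation has a centre, a prime ideal of \<open>F7[x, y]\<close>; every element of such a prime is a
  multiple of one parameter up to factors outside the prime, and this determines the valuation and
  conversely constructs one for every prime that contains an irreducible polynomial
  (\<open>local_parameter\<close>).  The constructions give the
  existence and the degrees of the places in the support of \<open>Ram + 4 D_inf - D\<close>, hence its degree
  \<open>6 + 8 - 14 = 0\<close>, and they supply enough places to show that a function without poles is constant
  (\<open>no_poles_imp_constant\<close>), which is the fact behind \<open>RR_space_residual\<close>.  The divisor of a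
  differential comes from a derivation that, after multiplication by one function, maps the valuation
  ring into itself and some uniformiser to a unit (\<open>v_d_dx_uniformizer\<close>).
\<close>

section \<open>Arithmetic of the sextic\<close>

lemma F7_seven: "(7 :: F7) = 0"
  using of_nat_CHAR[where 'a = F7] by (simp add: CARD_seven)

text \<open>Normalises the coefficients that arise when polynomials over \<open>F7\<close> are expanded.  The
hypothesis keeps the rewriting from looping on numerals that are already reduced.\<close>

lemma F7_numeral_reduce:
  assumes "7 \<le> (numeral n :: int)"
  shows "(numeral n :: F7) = of_int (numeral n mod 7)"
proof -
  have "(numeral n :: F7) = of_int (7 * (numeral n div 7) + numeral n mod 7)"
    by (simp only: mult_div_mod_eq of_int_numeral)
  also have "\<dots> = of_int (numeral n mod 7)"
    by (simp only: of_int_add of_int_mult of_int_numeral F7_seven) simp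
  finally show ?thesis .
qed

lemma F7_two_nonzero: "(2 :: F7) \<noteq> 0"
proof
  assume "(2 :: F7) = 0"
  moreover have "(7 :: F7) = 2 * 3 + 1" by simp
  ultimately show False
    using F7_seven by (metis mult_zero_left add_0 zero_neq_one)
qed

lemma F7_power7: "(c :: F7) ^ 7 = c"
  using finite_field_power_card_eq_same[of c] by (simp add: CARD_seven)

lemma F7_power6: "(c :: F7) \<noteq> 0 \<Longrightarrow> c ^ 6 = 1"
  using F7_power7[of c] by (simp add: eval_nat_numeral)

text \<open>In the coordinate \<open>x + 1\<close> the curve is \<open>y^2 = 2 - u^6\<close>, from which all its arithmetic
over \<open>F7\<close> can be read off.\<close>

lemma sextic_shifted: "sextic = [:2:] - [:1, 1:] ^ 6"
  by (simp add: sextic_def eval_nat_numeral) (simp add: F7_numeral_reduce)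

lemma sextic_factors: "sextic = - (([:1, 1:] ^ 3 - [:3:]) * ([:1, 1:] ^ 3 - [:- 3:]))"
  unfolding sextic_shifted
  by (simp add: eval_nat_numeral) (simp add: F7_numeral_reduce)

lemma sextic_separable: "sextic + [:1, 1:] * pderiv sextic = [:2:]"
  unfolding sextic_def
  by (simp add: pderiv_pCons) (simp add: F7_numeral_reduce)

text \<open>With \<open>u = x + 1\<close> this is \<open>u^7 - u = u (1 - (2 - u^6))\<close>, the identity that later splits
\<open>(x^7 - x) / y\<close> into two functions with few poles.\<close>

lemma artin_schreier_sextic: "[:0, 1:] ^ 7 - [:0, 1:] = [:1, 1:] * (1 - sextic)"
  unfolding sextic_def
  by (simp add: eval_nat_numeral one_pCons) (simp add: F7_numeral_reduce)

lemma poly_sextic: "poly sextic a = 2 - (a + 1) ^ 6"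
  by (simp add: sextic_shifted add.commute)

text \<open>Sixth powers in \<open>F7\<close> are \<open>0\<close> or \<open>1\<close>, so the values of the sextic are \<open>2 = 3^2\<close> and
\<open>1\<close>: over every \<open>a\<close> lie two rational points.\<close>

lemma poly_sextic_square:
  obtains b where "b \<noteq> 0" "poly sextic a = b ^ 2"
proof (cases "a + 1 = 0")
  case True
  then have "poly sextic a = 3 ^ 2"
    by (simp add: poly_sextic F7_numeral_reduce)
  moreover have "(3 :: F7) \<noteq> 0"
  proof
    assume "(3 :: F7) = 0"
    moreover have "(6 :: F7) = 3 * 2" by simp
    ultimately show False
      using F7_six_nonzero by (metis mult_zero_left)
  qed
  ultimately show ?thesis
    using that by blast
next
  case False
  then have "poly sextic a = 1 ^ 2"
    using F7_power6[of "a + 1"] by (simp add: poly_sextic)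
  then show ?thesis
    using that[of 1] by simp
qed

lemma card_square_roots_sextic: "card {b. b ^ 2 = poly sextic a} = 2"
proof -
  obtain b where b: "b \<noteq> 0" "poly sextic a = b ^ 2"
    by (rule poly_sextic_square)
  have "{c. c ^ 2 = poly sextic a} = {b, - b}"
    by (auto simp: b power2_eq_iff)
  moreover have "b \<noteq> - b"
  proof
    assume "b = - b"
    then have "2 * b = 0"
      by (simp add: eq_neg_iff_add_eq_0)
    then show False
      using b F7_two_nonzero by simp
  qed
  ultimately show ?thesis
    by simp
qed

lemma cubic_irreducible:
  fixes p :: "F7 poly"
  assumes "degree p = 3" "\<And>a. poly p a \<noteq> 0"
  shows "irreducible p"
proof (rule irreducibleI)
  show "p \<noteq> 0"
    using assms by auto
  show "\<not> is_unit p"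
    using assms(1) by (metis is_unit_iff_degree degree_0 zero_neq_numeral)
  fix q r assume pqr: "p = q * r"
  then have nz: "q \<noteq> 0" "r \<noteq> 0" and deg: "degree q + degree r = 3"
    using \<open>p \<noteq> 0\<close> assms(1) degree_mult_eq[of q r] by auto
  have no1: "degree s \<noteq> 1" if "s dvd p" for s
  proof
    assume "degree s = 1"
    then obtain a b where "s = [:b, a:]" "a \<noteq> 0"
      by (metis degree1_coeffs)
    then have "poly s (- b / a) = 0"
      by simp
    then show False
      using that assms(2)[of "- b / a"] by (metis dvdE mult_zero_left poly_mult)
  qed
  have "degree q \<noteq> 1" "degree r \<noteq> 1"
    using no1 pqr by auto
  then have "degree q = 0 \<or> degree r = 0"
    using deg by linarith
  then show "is_unit q \<or> is_unit r"
    using nz is_unit_iff_degree by blast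
qed

lemma degree_shifted_cube: "degree ([:1, 1:] ^ 3 - [:c:] :: F7 poly) = 3"
  by (simp add: eval_nat_numeral)

text \<open>A root would make \<open>2 = c^2\<close> a sixth power in \<open>F7\<close>.\<close>

lemma shifted_cube_irreducible:
  assumes "c ^ 2 = (2 :: F7)"
  shows "irreducible ([:1, 1:] ^ 3 - [:c:])"
proof (rule cubic_irreducible)
  fix a :: F7
  show "poly ([:1, 1:] ^ 3 - [:c:]) a \<noteq> 0"
  proof
    assume "poly ([:1, 1:] ^ 3 - [:c:]) a = 0"
    then have "(1 + a) ^ 3 = c"
      by simp
    then have "(1 + a) ^ 6 = 2"
      using assms power_mult[of "1 + a" 3 2] by simp
    moreover have "(1 + a) ^ 6 = 0 \<or> (1 + a) ^ 6 = 1"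
      using F7_power6[of "1 + a"] by fastforce
    ultimately show False
      using F7_two_nonzero by (metis add_cancel_right_right one_add_one zero_neq_one)
  qed
qed (rule degree_shifted_cube)

text \<open>Separability without the structure theory of finite fields: among the powers \<open>x^(7^i)\<close> two are
congruent modulo \<open>p\<close>, and the Frobenius map turns this into \<open>p dvd x^(7^n) - x\<close> with \<open>n > 0\<close>,
a polynomial whose derivative is \<open>-1\<close>.\<close>

lemma irreducible_not_dvd_pderiv:
  fixes p :: "F7 poly"
  assumes p: "irreducible p"
  shows "\<not> p dvd pderiv p"
proof
  assume dvd: "p dvd pderiv p"
  have prime: "prime_elem p"
    using p field_poly_irreducible_imp_prime by blast
  let ?X = "[:0, 1:] :: F7 poly"
  have pn: "p \<noteq> 0"
    using p by auto
  have "finite {q :: F7 poly. q = 0 \<or> degree q < degree p}"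
  proof -
    have "{q :: F7 poly. q = 0 \<or> degree q < degree p} \<subseteq> Poly ` {xs. set xs \<subseteq> UNIV \<and> length xs \<le> degree p}"
    proof
      fix q :: "F7 poly" assume "q \<in> {q. q = 0 \<or> degree q < degree p}"
      then have "q = Poly (coeffs q)" "length (coeffs q) \<le> degree p"
        by (cases "q = 0"; simp add: length_coeffs_degree)+
      then show "q \<in> Poly ` {xs. set xs \<subseteq> UNIV \<and> length xs \<le> degree p}"
        by blast
    qed
    then show ?thesis
      by (rule finite_subset) (intro finite_imageI finite_lists_length_le finite)
  qed
  moreover have "range (\<lambda>i. ?X ^ (7 ^ i) mod p) \<subseteq> {q. q = 0 \<or> degree q < degree p}"
    using degree_mod_less[OF pn] by (intro image_subsetI) simp
  ultimately have "finite (range (\<lambda>i. ?X ^ (7 ^ i) mod p))"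
    by (rule finite_subset[rotated])
  then have "\<not> inj (\<lambda>i::nat. ?X ^ (7 ^ i) mod p)"
    using range_inj_infinite by blast
  then obtain i k where ik: "i < k" "?X ^ (7 ^ i) mod p = ?X ^ (7 ^ k) mod p"
    unfolding inj_def by (metis linorder_neqE_nat)
  define n where "n = k - i"
  have n: "n > 0" "7 ^ k = (7 :: nat) ^ n * 7 ^ i"
    using ik(1) by (simp_all add: n_def flip: power_add)
  let ?t = "?X ^ (7 ^ n) - ?X"
  \<comment> \<open>The congruence of the two powers says that \<open>?t\<close>, raised to a power of 7, vanishes modulo \<open>p\<close>.\<close>
  have "(?t + ?X) ^ (7 ^ i) = ?t ^ (7 ^ i) + ?X ^ (7 ^ i)"
    by (rule freshmans_dream') (simp_all add: CARD_seven)
  then have "?t ^ (7 ^ i) = ?X ^ (7 ^ k) - ?X ^ (7 ^ i)"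
    by (simp add: n power_mult)
  moreover have "p dvd ?X ^ (7 ^ k) - ?X ^ (7 ^ i)"
    using ik(2)[symmetric] by (simp only: mod_eq_dvd_iff)
  ultimately have "p dvd ?t"
    using prime prime_elem_dvd_power by metis
  then obtain s where s: "?t = p * s" ..
  have "(of_nat (7 ^ n) :: F7) = 0"
    using n(1) by (simp add: F7_seven)
  then have "pderiv (?X ^ (7 ^ n)) = 0"
    by (simp only: pderiv_power smult_0_left mult_zero_left)
  moreover have "pderiv ?X = 1"
    by (simp add: pderiv_pCons one_pCons)
  ultimately have "pderiv ?t = - 1"
    by (simp only: pderiv_diff diff_0)
  moreover have "p dvd pderiv ?t"
    using dvd unfolding s pderiv_mult by (intro dvd_add) auto
  ultimately have "is_unit p"
    by simp
  then show False
    using p by (auto simp: irreducible_def)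
qed

section \<open>Dimensions of quotients by counting\<close>

lemma of_poly_minus [simp]: "of_poly (- p) = - of_poly p"
  by (metis add.inverse_unique add.right_inverse of_poly_0 of_poly_add)

lemma of_poly_diff [simp]: "of_poly (p - q) = of_poly p - of_poly q"
  by (metis add_uminus_conv_diff of_poly_add of_poly_minus)

lemma of_poly_eq_0_iff [simp]: "of_poly p = 0 \<longleftrightarrow> p = 0"
  by (simp add: of_poly_def zero_funfield_def)

lemma of_poly_eq_iff [simp]: "of_poly p = of_poly q \<longleftrightarrow> p = q"
  by (simp add: of_poly_def)

lemma of_poly_1_const [simp]: "of_poly [:1:] = 1"
  by (metis of_poly_1 one_pCons)

text \<open>The scalars act through the constant polynomials, since the function field is not declared as a
vector space over \<open>F7\<close>.\<close>

definition F7_subspace :: "funfield set \<Rightarrow> bool" where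
  "F7_subspace V \<longleftrightarrow> 0 \<in> V \<and> (\<forall>g\<in>V. \<forall>h\<in>V. g + h \<in> V) \<and> (\<forall>c. \<forall>h\<in>V. of_poly [:c:] * h \<in> V)"

definition comb :: "funfield set \<Rightarrow> (funfield \<Rightarrow> F7) \<Rightarrow> funfield" where
  "comb B c = (\<Sum>b\<in>B. of_poly [:c b:] * b)"

definition coeff_funs :: "funfield set \<Rightarrow> (funfield \<Rightarrow> F7) set" where
  "coeff_funs B = {c. \<forall>b. b \<notin> B \<longrightarrow> c b = 0}"

definition transversal :: "funfield set \<Rightarrow> funfield set \<Rightarrow> funfield set \<Rightarrow> bool" where
  "transversal V W T \<longleftrightarrow> finite T \<and> T \<subseteq> V \<and> (\<forall>h\<in>V. \<exists>!s. s \<in> T \<and> h - s \<in> W)"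

lemma F7_subspaceD:
  assumes "F7_subspace V"
  shows "0 \<in> V" "g \<in> V \<Longrightarrow> h \<in> V \<Longrightarrow> g + h \<in> V" "h \<in> V \<Longrightarrow> of_poly [:c:] * h \<in> V"
    "h \<in> V \<Longrightarrow> - h \<in> V" "g \<in> V \<Longrightarrow> h \<in> V \<Longrightarrow> g - h \<in> V"
proof -
  show *: "0 \<in> V" "g \<in> V \<Longrightarrow> h \<in> V \<Longrightarrow> g + h \<in> V" "h \<in> V \<Longrightarrow> of_poly [:c:] * h \<in> V" for g h c
    using assms by (auto simp: F7_subspace_def)
  have "of_poly [:- 1:] * h = - h" for h
    using of_poly_minus[of "[:1:]"] by simp
  then show m: "h \<in> V \<Longrightarrow> - h \<in> V" for h
    using *(3)[of h "- 1"] by simp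
  show "g \<in> V \<Longrightarrow> h \<in> V \<Longrightarrow> g - h \<in> V"
    using *(2)[of g "- h"] m[of h] by simp
qed

lemma comb_in_subspace:
  assumes "F7_subspace V" "B \<subseteq> V"
  shows "comb B c \<in> V"
proof (cases "finite B")
  case True
  then show ?thesis
    using assms(2) unfolding comb_def
    by (induction B) (auto intro: F7_subspaceD[OF assms(1)])
qed (simp add: comb_def F7_subspaceD[OF assms(1)])

lemma comb_linear:
  "comb B (\<lambda>b. e b - k * c b) = comb B e - of_poly [:k:] * comb B c"
proof -
  have "of_poly [:e b - k * c b:] * b = of_poly [:e b:] * b - of_poly [:k:] * (of_poly [:c b:] * b)" for b
  proof -
    have "[:e b - k * c b:] = [:e b:] - [:k:] * [:c b:]"
      by simp
    then show ?thesis
      by (simp only: of_poly_diff of_poly_mult left_diff_distrib mult.assoc)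
  qed
  then show ?thesis
    by (simp add: comb_def sum_subtractf sum_distrib_left)
qed

lemma basis_modulo_alt:
  "basis_modulo V W B \<longleftrightarrow> finite B \<and> B \<subseteq> V \<and> (\<forall>h\<in>V. \<exists>!c. c \<in> coeff_funs B \<and> h - comb B c \<in> W)"
  by (simp add: basis_modulo_def coeff_funs_def comb_def)

lemma coeff_funs_card:
  assumes "finite B"
  shows "finite (coeff_funs B)" "card (coeff_funs B) = 7 ^ card B"
proof -
  have bij: "bij_betw (\<lambda>c. restrict c B) (coeff_funs B) (B \<rightarrow>\<^sub>E UNIV)"
  proof (rule bij_betw_byWitness[where f' = "\<lambda>c b. if b \<in> B then c b else 0"])
    show "\<forall>c\<in>coeff_funs B. (\<lambda>b. if b \<in> B then restrict c B b else 0) = c"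
      by (auto simp: coeff_funs_def)
    show "\<forall>c\<in>B \<rightarrow>\<^sub>E UNIV. restrict (\<lambda>b. if b \<in> B then c b else 0) B = c"
      by (auto simp: PiE_def extensional_def restrict_def)
  qed (auto simp: coeff_funs_def)
  show "card (coeff_funs B) = 7 ^ card B"
    using bij_betw_same_card[OF bij] assms by (simp add: card_funcsetE CARD_seven)
  show "finite (coeff_funs B)"
    using bij_betw_finite[OF bij] assms by (simp add: finite_PiE)
qed

text \<open>Dimension can be read off by counting because \<open>F7\<close> is finite: a basis with \<open>n\<close> elements
yields exactly \<open>7^n\<close> cosets.  This replaces the exchange argument for quotients of
infinite-dimensional spaces.\<close>

lemma basis_modulo_transversal:
  assumes V: "F7_subspace V" and W: "F7_subspace W" and B: "basis_modulo V W B"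
  shows "transversal V W (comb B ` coeff_funs B)" "card (comb B ` coeff_funs B) = 7 ^ card B"
proof -
  have fin: "finite B" and sub: "B \<subseteq> V"
    and ex1: "\<And>h. h \<in> V \<Longrightarrow> \<exists>!c. c \<in> coeff_funs B \<and> h - comb B c \<in> W"
    using B by (auto simp: basis_modulo_alt)
  have "inj_on (comb B) (coeff_funs B)"
  proof (rule inj_onI)
    fix c d assume cd: "c \<in> coeff_funs B" "d \<in> coeff_funs B" "comb B c = comb B d"
    then have "comb B c - comb B c \<in> W" "comb B c - comb B d \<in> W"
      using F7_subspaceD(1)[OF W] by auto
    then show "c = d"
      using ex1[OF comb_in_subspace[OF V sub, of c]] cd by blast
  qed
  then show "card (comb B ` coeff_funs B) = 7 ^ card B"
    by (simp add: card_image coeff_funs_card[OF fin])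
  show "transversal V W (comb B ` coeff_funs B)"
    unfolding transversal_def
    using coeff_funs_card[OF fin] comb_in_subspace[OF V sub] ex1 by (auto; metis)
qed

lemma transversal_card_le:
  assumes V: "F7_subspace V" and W: "F7_subspace W"
    and S: "transversal V W S" and T: "transversal V W T"
  shows "card S \<le> card T"
proof -
  define f where "f s = (THE t. t \<in> T \<and> s - t \<in> W)" for s
  have f: "f s \<in> T" "s - f s \<in> W" if "s \<in> S" for s
  proof -
    have "\<exists>!t. t \<in> T \<and> s - t \<in> W"
      using that S T unfolding transversal_def by blast
    then have "f s \<in> T \<and> s - f s \<in> W"
      unfolding f_def by (rule theI')
    then show "f s \<in> T" "s - f s \<in> W"
      by auto
  qed
  have "inj_on f S"
  proof (rule inj_onI)
    fix s s' assume s: "s \<in> S" "s' \<in> S" "f s = f s'"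
    have "s - s' = (s - f s) - (s' - f s')"
      using s(3) by simp
    then have "s - s' \<in> W"
      using F7_subspaceD(5)[OF W f(2)[OF s(1)] f(2)[OF s(2)]] by simp
    moreover have "s - s \<in> W" "s \<in> V"
      using F7_subspaceD(1)[OF W] S s(1) by (auto simp: transversal_def)
    ultimately show "s = s'"
      using S s unfolding transversal_def by blast
  qed
  moreover have "f ` S \<subseteq> T"
    using f by auto
  ultimately show ?thesis
    using T by (auto simp: transversal_def intro: card_inj_on_le)
qed

lemma quotient_dim_basis:
  assumes "F7_subspace V" "F7_subspace W" "basis_modulo V W B"
  shows "quotient_dim V W = card B"
  unfolding quotient_dim_def
proof (rule the_equality)
  show "\<exists>B'. basis_modulo V W B' \<and> card B' = card B"
    using assms(3) by blast
  fix n assume "\<exists>B'. basis_modulo V W B' \<and> card B' = n"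
  then obtain B' where B': "basis_modulo V W B'" "card B' = n"
    by blast
  note T = basis_modulo_transversal[OF assms] basis_modulo_transversal[OF assms(1,2) B'(1)]
  have "(7 :: nat) ^ card B' = 7 ^ card B"
    using transversal_card_le[OF assms(1,2) T(1) T(3)] transversal_card_le[OF assms(1,2) T(3) T(1)] T
    by simp
  then show "n = card B"
    using B'(2) by simp
qed

text \<open>A finite set of coset representatives spans, and a spanning set of least size is independent: a
relation modulo \<open>W\<close> with a nonzero coefficient at \<open>b0\<close> allows \<open>b0\<close> to be dropped.\<close>

lemma basis_modulo_exists:
  assumes V: "F7_subspace V" and W: "F7_subspace W"
    and T: "finite T" "T \<subseteq> V" "\<And>h. h \<in> V \<Longrightarrow> \<exists>s\<in>T. h - s \<in> W"
  obtains B where "basis_modulo V W B"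
proof -
  define spans where
    "spans B \<longleftrightarrow> finite B \<and> B \<subseteq> V \<and> (\<forall>h\<in>V. \<exists>c\<in>coeff_funs B. h - comb B c \<in> W)" for B
  have "spans T"
    unfolding spans_def
  proof (intro conjI ballI)
    fix h assume "h \<in> V"
    then obtain s where s: "s \<in> T" "h - s \<in> W"
      using T(3) by blast
    let ?c = "\<lambda>b. if b = s then 1 else 0 :: F7"
    have "comb T ?c = (\<Sum>b\<in>T. if b = s then s else 0)"
      unfolding comb_def by (rule sum.cong) auto
    then have "comb T ?c = s"
      using s(1) T(1) by (simp add: sum.delta)
    moreover have "?c \<in> coeff_funs T"
      using s(1) by (auto simp: coeff_funs_def)
    ultimately show "\<exists>c\<in>coeff_funs T. h - comb T c \<in> W"
      using s(2) by metis
  qed (use T in auto)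
  then obtain B where B: "spans B" and min: "\<And>B'. spans B' \<Longrightarrow> card B \<le> card B'"
    using ex_has_least_nat[of spans T card] by blast
  have fin: "finite B" and sub: "B \<subseteq> V"
    using B by (auto simp: spans_def)
  have "c = d" if h: "h \<in> V" and c: "c \<in> coeff_funs B" "h - comb B c \<in> W"
    and d: "d \<in> coeff_funs B" "h - comb B d \<in> W" for h c d
  proof (rule ccontr)
    assume "c \<noteq> d"
    then obtain b0 where b0: "c b0 \<noteq> d b0"
      by blast
    then have b0B: "b0 \<in> B"
      using c d by (metis (mono_tags, lifting) coeff_funs_def mem_Collect_eq)
    define e where "e b = c b - 1 * d b" for b
    have e0: "e b0 \<noteq> 0" and eB: "\<And>b. b \<notin> B \<Longrightarrow> e b = 0"
      using b0 c d by (auto simp: e_def coeff_funs_def)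
    have "comb B e = (h - comb B d) - (h - comb B c)"
      unfolding e_def by (subst comb_linear) simp
    then have eW: "comb B e \<in> W"
      using F7_subspaceD(5)[OF W d(2) c(2)] by simp
    have "spans (B - {b0})"
      unfolding spans_def
    proof (intro conjI ballI)
      fix g assume "g \<in> V"
      then obtain a where a: "a \<in> coeff_funs B" "g - comb B a \<in> W"
        using B by (auto simp: spans_def)
      define k where "k = a b0 / e b0"
      define a' where "a' b = a b - k * e b" for b
      have a'0: "a' b0 = 0"
        using e0 by (simp add: a'_def k_def)
      have "comb B a' = comb B a - of_poly [:k:] * comb B e"
        unfolding a'_def by (rule comb_linear)
      moreover have "comb B a' = comb (B - {b0}) a'"
        unfolding comb_def using fin b0B a'0 by (simp add: sum.remove)
      ultimately have "g - comb (B - {b0}) a' = (g - comb B a) + of_poly [:k:] * comb B e"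
        by simp
      then have "g - comb (B - {b0}) a' \<in> W"
        using F7_subspaceD(2)[OF W a(2) F7_subspaceD(3)[OF W eW]] by (simp only:)
      moreover have "a' \<in> coeff_funs (B - {b0})"
        using a(1) eB a'0 by (auto simp: coeff_funs_def a'_def)
      ultimately show "\<exists>c\<in>coeff_funs (B - {b0}). g - comb (B - {b0}) c \<in> W"
        by blast
    qed (use fin sub in auto)
    then have "card B \<le> card (B - {b0})"
      by (rule min)
    moreover have "card B > 0"
      using fin b0B card_gt_0_iff by blast
    ultimately show False
      using fin b0B by simp
  qed
  then have "basis_modulo V W B"
    using B unfolding basis_modulo_alt spans_def by blast
  then show ?thesis
    by (rule that)
qed

lemma quotient_dim_transversal:
  assumes "F7_subspace V" "F7_subspace W" "transversal V W T" "card T = 7 ^ n"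
  shows "quotient_dim V W = n"
proof -
  have "finite T" "T \<subseteq> V" "\<And>h. h \<in> V \<Longrightarrow> \<exists>s\<in>T. h - s \<in> W"
    using assms(3) unfolding transversal_def by blast+
  then obtain B where B: "basis_modulo V W B"
    using basis_modulo_exists[OF assms(1,2)] by metis
  note T = basis_modulo_transversal[OF assms(1,2) B]
  have "(7 :: nat) ^ card B = 7 ^ n"
    using transversal_card_le[OF assms(1,2) T(1) assms(3)]
      transversal_card_le[OF assms(1,2) assms(3) T(1)] T(2) assms(4) by simp
  then show ?thesis
    using quotient_dim_basis[OF assms(1,2) B] by simp
qed

section \<open>The coordinate ring\<close>

text \<open>The elements of the affine coordinate ring \<open>F7[x, y]\<close> in normal form.\<close>

definition curve_fun :: "F7 poly \<Rightarrow> F7 poly \<Rightarrow> funfield" where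
  "curve_fun p q = of_poly p + of_poly q * fun_y"

definition coord_ring :: "funfield set" where
  "coord_ring = {curve_fun p q | p q. True}"

lemma curve_fun_FF: "curve_fun p q = FF (to_fract p) (to_fract q)"
  by (simp add: curve_fun_def of_poly_def fun_y_def plus_funfield_def times_funfield_def)

lemma curve_fun_eq_0_iff [simp]: "curve_fun p q = 0 \<longleftrightarrow> p = 0 \<and> q = 0"
  by (simp add: curve_fun_FF zero_funfield_def)

lemma curve_fun_0_right [simp]: "curve_fun p 0 = of_poly p"
  by (simp add: curve_fun_def)

lemma curve_fun_add: "curve_fun p q + curve_fun p' q' = curve_fun (p + p') (q + q')"
  by (simp add: curve_fun_def algebra_simps)

lemma curve_fun_mult:
  "curve_fun p q * curve_fun p' q' = curve_fun (p * p' + sextic * (q * q')) (p * q' + q * p')"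
proof -
  have y: "fun_y * (fun_y * h) = of_poly sextic * h" for h
    using fun_y_square by (simp add: power2_eq_square flip: mult.assoc)
  have "fun_y * fun_y = of_poly sextic"
    using fun_y_square by (simp add: power2_eq_square)
  then show ?thesis
    by (simp add: curve_fun_def algebra_simps y)
qed

lemma curve_fun_norm: "curve_fun p q * curve_fun p (- q) = of_poly (norm_form p q)"
  by (simp add: curve_fun_mult norm_form_def algebra_simps flip: curve_fun_0_right)

lemma fun_y_nonzero [simp]: "fun_y \<noteq> 0"
  using fun_y_square sextic_nonzero by (metis of_poly_eq_0_iff zero_power2)

lemma fun_x_nonzero [simp]: "fun_x \<noteq> 0"
  by (simp add: fun_x_def)

lemma funfield_fraction:
  obtains p q r where "r \<noteq> 0" "h = curve_fun p q / of_poly r"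
proof -
  obtain p q r where h: "h = FF (Fract p r) (Fract q r)" and r: "r \<noteq> 0"
    by (rule FF_representation)
  have "h * of_poly r = curve_fun p q"
    using r by (simp add: h of_poly_def times_funfield_def curve_fun_FF to_fract_def eq_fract)
  then show ?thesis
    using that[of r p q] r by (simp add: field_simps)
qed

lemma curve_fun_divide_FF:
  assumes "r \<noteq> 0"
  shows "curve_fun p q / of_poly r = FF (Fract p r) (Fract q r)"
proof -
  have "FF (Fract p r) (Fract q r) * of_poly r = curve_fun p q"
    using assms by (simp add: of_poly_def times_funfield_def curve_fun_FF to_fract_def eq_fract)
  then show ?thesis
    using assms by (simp add: field_simps)
qed

lemma of_poly_pCons: "of_poly (pCons a p) = of_poly [:a:] + fun_x * of_poly p"
proof -
  have "pCons a p = [:a:] + [:0, 1:] * p"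
    by simp
  then show ?thesis
    by (simp only: of_poly_add of_poly_mult fun_x_def)
qed

lemma of_poly_in_coord_ring [simp]: "of_poly p \<in> coord_ring"
  unfolding coord_ring_def by (metis (mono_tags, lifting) curve_fun_0_right mem_Collect_eq)

lemma curve_fun_in_coord_ring [simp]: "curve_fun p q \<in> coord_ring"
  by (auto simp: coord_ring_def)

lemma fun_y_in_coord_ring [simp]: "fun_y \<in> coord_ring"
  using curve_fun_in_coord_ring[of 0 1] by (simp add: curve_fun_def del: curve_fun_in_coord_ring)

lemma one_in_coord_ring [simp]: "1 \<in> coord_ring"
  using of_poly_in_coord_ring[of 1] by simp

lemma coord_ring_add [simp]: "r \<in> coord_ring \<Longrightarrow> s \<in> coord_ring \<Longrightarrow> r + s \<in> coord_ring"
  by (auto simp: coord_ring_def) (metis curve_fun_add)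

lemma coord_ring_mult [simp]: "r \<in> coord_ring \<Longrightarrow> s \<in> coord_ring \<Longrightarrow> r * s \<in> coord_ring"
  by (auto simp: coord_ring_def) (metis curve_fun_mult)

lemma coord_ring_power [simp]: "r \<in> coord_ring \<Longrightarrow> r ^ n \<in> coord_ring"
  by (induction n) auto

lemma coord_ring_fraction:
  obtains r s where "r \<in> coord_ring" "s \<in> coord_ring" "s \<noteq> 0" "h = r / s"
  by (metis funfield_fraction curve_fun_in_coord_ring of_poly_in_coord_ring of_poly_eq_0_iff)

section \<open>Discrete valuations\<close>

text \<open>Zero is put into every level by hand because the valuations take the value \<open>0\<close> there; with
this the levels are the powers of the maximal ideal, negative ones included, and are closed under
addition.\<close>

definition val_ge :: "(funfield \<Rightarrow> int) \<Rightarrow> int \<Rightarrow> funfield set" where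
  "val_ge v n = {h. h = 0 \<or> n \<le> v h}"

locale valuation =
  fixes v :: "funfield \<Rightarrow> int"
  assumes valuation: "discrete_valuation v"
begin

lemma v_0 [simp]: "v 0 = 0"
  and v_mult: "g \<noteq> 0 \<Longrightarrow> h \<noteq> 0 \<Longrightarrow> v (g * h) = v g + v h"
  and v_add: "g \<noteq> 0 \<Longrightarrow> h \<noteq> 0 \<Longrightarrow> g + h \<noteq> 0 \<Longrightarrow> min (v g) (v h) \<le> v (g + h)"
  and v_const: "c \<noteq> 0 \<Longrightarrow> v (of_poly [:c:]) = 0"
  and v_uniformizer: "\<exists>t. v t = 1"
  using valuation unfolding discrete_valuation_def by blast+

lemma v_1 [simp]: "v 1 = 0"
  using v_const[of 1] by simp

lemma v_minus [simp]: "v (- h) = v h"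
proof (cases "h = 0")
  case False
  have "- h = of_poly [:- 1:] * h"
    using of_poly_minus[of "[:1:]"] by simp
  then show ?thesis
    using False v_mult[of "of_poly [:- 1:]" h] v_const[of "- 1"] by simp
qed simp

lemma v_inverse [simp]: "v (inverse h) = - v h"
proof (cases "h = 0")
  case False
  then have "v h + v (inverse h) = 0"
    using v_mult[of h "inverse h"] by simp
  then show ?thesis
    by simp
qed simp

lemma v_divide: "g \<noteq> 0 \<Longrightarrow> h \<noteq> 0 \<Longrightarrow> v (g / h) = v g - v h"
  using v_mult[of g "inverse h"] by (simp add: field_class.field_divide_inverse)

lemma v_power: "v (h ^ n) = int n * v h"
proof (cases "h = 0")
  case False
  then show ?thesis
    by (induction n) (simp_all add: v_mult algebra_simps)
qed (cases n; simp)

lemma v_powi: "v (h powi k) = k * v h"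
  by (simp add: power_int_def v_power)

lemma val_ge_iff: "h \<noteq> 0 \<Longrightarrow> h \<in> val_ge v n \<longleftrightarrow> n \<le> v h"
  by (simp add: val_ge_def)

lemma val_ge_0 [simp]: "0 \<in> val_ge v n"
  by (simp add: val_ge_def)

lemma val_ge_add: "g \<in> val_ge v n \<Longrightarrow> h \<in> val_ge v n \<Longrightarrow> g + h \<in> val_ge v n"
  using v_add[of g h] by (force simp: val_ge_def)

lemma val_ge_minus: "h \<in> val_ge v n \<Longrightarrow> - h \<in> val_ge v n"
  by (auto simp: val_ge_def)

lemma val_ge_diff: "g \<in> val_ge v n \<Longrightarrow> h \<in> val_ge v n \<Longrightarrow> g - h \<in> val_ge v n"
  using val_ge_add[of g n "- h"] val_ge_minus by simp

lemma val_ge_mult: "g \<in> val_ge v a \<Longrightarrow> h \<in> val_ge v b \<Longrightarrow> g * h \<in> val_ge v (a + b)"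
  by (cases "g = 0 \<or> h = 0") (auto simp: val_ge_def v_mult)

lemma val_ge_mult0:
  "g \<in> val_ge v 0 \<Longrightarrow> h \<in> val_ge v n \<Longrightarrow> g * h \<in> val_ge v n"
  "g \<in> val_ge v n \<Longrightarrow> h \<in> val_ge v 0 \<Longrightarrow> g * h \<in> val_ge v n"
  using val_ge_mult[of g 0 h n] val_ge_mult[of g n h 0] by simp_all

lemma val_ge_mono: "h \<in> val_ge v n \<Longrightarrow> k \<le> n \<Longrightarrow> h \<in> val_ge v k"
  by (auto simp: val_ge_def)

lemma val_ge_const [simp]: "n \<le> 0 \<Longrightarrow> of_poly [:c:] \<in> val_ge v n"
  by (cases "c = 0") (auto simp: val_ge_def v_const)

lemma val_ge_subspace: "F7_subspace (val_ge v n)"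
  unfolding F7_subspace_def using val_ge_add val_ge_mult0(1) val_ge_const by auto

lemma v_eq_0_iff:
  assumes "h \<in> val_ge v 0"
  shows "h \<notin> val_ge v 1 \<longleftrightarrow> h \<noteq> 0 \<and> v h = 0"
  using assms by (auto simp: val_ge_def)

lemma v_add_strict:
  assumes "g \<noteq> 0" "h \<noteq> 0" "v g < v h"
  shows "g + h \<noteq> 0" "v (g + h) = v g"
proof -
  show nz: "g + h \<noteq> 0"
    using assms v_minus[of g] by (metis add_eq_0_iff less_irrefl)
  have "v g \<le> v (g + h)"
    using v_add[OF assms(1,2) nz] assms(3) by simp
  moreover have "min (v (g + h)) (v (- h)) \<le> v g"
    using v_add[of "g + h" "- h"] nz assms(1,2) by simp
  ultimately show "v (g + h) = v g"
    using assms(3) by simp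
qed

lemma val_ge_prod:
  "g \<in> val_ge v 0 \<Longrightarrow> h \<in> val_ge v 0 \<Longrightarrow> g * h \<in> val_ge v 1 \<Longrightarrow> g \<in> val_ge v 1 \<or> h \<in> val_ge v 1"
  by (cases "g = 0 \<or> h = 0") (auto simp: val_ge_def v_mult)

end

lemma valuation_ord_at: "valuation (ord_at P)"
  using ord_at[of P] by unfold_locales simp

section \<open>The place at infinity\<close>

context valuation
begin

context
  assumes pole: "v fun_x < 0"
begin

lemma v_of_poly_pole: "p \<noteq> 0 \<Longrightarrow> v (of_poly p) = int (degree p) * v fun_x"
proof (induction p)
  case (pCons a p)
  show ?case
  proof (cases "p = 0")
    case True
    then show ?thesis
      using pCons.hyps v_const[of a] by simp
  next
    case False
    then have *: "v (fun_x * of_poly p) = int (degree (pCons a p)) * v fun_x"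
      using pCons.IH v_mult[of fun_x "of_poly p"] by (simp add: algebra_simps)
    show ?thesis
    proof (cases "a = 0")
      case True
      then have "of_poly (pCons a p) = fun_x * of_poly p"
        by (simp add: of_poly_pCons[of 0 p])
      then show ?thesis
        using * by (simp only:)
    next
      case a: False
      have "v (fun_x * of_poly p) < v (of_poly [:a:])"
        using * pole False v_const[OF a] by (simp add: mult_pos_neg)
      then have "v (fun_x * of_poly p + of_poly [:a:]) = v (fun_x * of_poly p)"
        using False a by (intro v_add_strict) auto
      then show ?thesis
        using * by (simp add: of_poly_pCons[of a p] add.commute)
    qed
  qed
qed simp

lemma v_fun_y_pole: "v fun_y = 3 * v fun_x"
proof -
  have "2 * v fun_y = v (fun_y ^ 2)"
    by (simp add: v_power)
  also have "\<dots> = 6 * v fun_x"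
    by (simp add: fun_y_square v_of_poly_pole sextic_nonzero degree_sextic)
  finally show ?thesis
    by simp
qed

text \<open>One inequality is the ultrametric bound; \<open>v_curve_fun_pole\<close> obtains equality because the norm,
the product with the conjugate, has exactly twice this valuation.\<close>

lemma curve_fun_val_ge_pole: "curve_fun p q \<in> val_ge v (int (pole_deg p q) * v fun_x)"
  unfolding curve_fun_def
proof (rule val_ge_add)
  have mono: "int b * v fun_x \<le> int a * v fun_x" if "a \<le> b" for a b
    using that pole by (simp add: mult_right_mono_neg)
  show "of_poly p \<in> val_ge v (int (pole_deg p q) * v fun_x)"
    by (cases "p = 0") (auto simp: val_ge_iff v_of_poly_pole pole_deg_def intro!: mono)
  show "of_poly q * fun_y \<in> val_ge v (int (pole_deg p q) * v fun_x)"
  proof (cases "q = 0")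
    case False
    then have "v (of_poly q * fun_y) = int (degree q + 3) * v fun_x"
      by (simp add: v_mult v_of_poly_pole v_fun_y_pole algebra_simps)
    then show ?thesis
      using False mono[of "degree q + 3" "pole_deg p q"] by (simp add: val_ge_iff pole_deg_def)
  qed simp
qed

lemma v_curve_fun_pole:
  assumes "p \<noteq> 0 \<or> q \<noteq> 0"
  shows "v (curve_fun p q) = int (pole_deg p q) * v fun_x"
proof -
  have nz: "curve_fun p q \<noteq> 0" "curve_fun p (- q) \<noteq> 0"
    using assms by auto
  have "v (curve_fun p q) + v (curve_fun p (- q)) = 2 * int (pole_deg p q) * v fun_x"
    using v_mult[OF nz] norm_form_degree[OF assms] by (simp add: curve_fun_norm v_of_poly_pole)
  moreover have "int (pole_deg p q) * v fun_x \<le> v (curve_fun p q)"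
    using curve_fun_val_ge_pole[of p q] val_ge_iff[OF nz(1)] by simp
  moreover have "pole_deg p (- q) = pole_deg p q"
    by (simp add: pole_deg_def)
  then have "int (pole_deg p q) * v fun_x \<le> v (curve_fun p (- q))"
    using curve_fun_val_ge_pole[of p "- q"] val_ge_iff[OF nz(2)] by simp
  ultimately show ?thesis
    by linarith
qed

text \<open>By degrees, \<open>v\<close> is a positive multiple of \<open>val_inf\<close>; since it takes the value \<open>1\<close>, the
factor is \<open>1\<close>.\<close>

lemma pole_imp_val_inf: "v = val_inf"
proof -
  have *: "v h = - v fun_x * val_inf h" for h
  proof (cases "h = 0")
    case True
    then show ?thesis
      by (simp add: val_inf_def)
  next
    case False
    obtain p q r where r: "r \<noteq> 0" and h: "h = curve_fun p q / of_poly r"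
      by (rule funfield_fraction)
    have pq: "p \<noteq> 0 \<or> q \<noteq> 0"
      using False h by auto
    have "v h = int (pole_deg p q) * v fun_x - int (degree r) * v fun_x"
      using r pq by (simp add: h v_divide v_curve_fun_pole v_of_poly_pole)
    moreover have "val_inf h = int (degree r) - int (pole_deg p q)"
      using val_inf_FF[OF r pq] r by (simp add: h curve_fun_divide_FF)
    ultimately show ?thesis
      by (simp only:) (simp add: algebra_simps)
  qed
  obtain t where "v t = 1"
    using v_uniformizer by blast
  then have "- v fun_x dvd 1"
    using * by (metis dvd_triv_left)
  then have "v fun_x = - 1"
    using pole by (simp add: zdvd1_eq)
  then have "v h = val_inf h" for h
    using *[of h] by simp
  then show ?thesis ..
qed

end

end

definition P_inf :: place where
  "P_inf = Place val_inf"

lemma ord_at_P_inf: "ord_at P_inf = val_inf"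
  by (simp add: P_inf_def Place_inverse discrete_valuation_val_inf)

interpretation val_inf: valuation val_inf
  by unfold_locales (rule discrete_valuation_val_inf)

lemma val_inf_fun_x: "val_inf fun_x = - 1"
  using val_inf_FF[of 1 "[:0, 1:]" 0] by (simp add: fun_x_def of_poly_def to_fract_def pole_deg_def Zero_fract_def)

lemma ord_at_fun_x_neg_iff: "ord_at P fun_x < 0 \<longleftrightarrow> P = P_inf"
proof
  assume "ord_at P fun_x < 0"
  then have "ord_at P = ord_at P_inf"
    using valuation.pole_imp_val_inf[OF valuation_ord_at] by (simp add: ord_at_P_inf)
  then show "P = P_inf"
    by (simp add: ord_at_inject)
qed (simp add: ord_at_P_inf val_inf_fun_x)

lemma D_inf_eq: "D_inf P = (if P = P_inf then 1 else 0)"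
  by (simp add: D_inf_def ord_at_fun_x_neg_iff)

lemma val_inf_of_poly: "p \<noteq> 0 \<Longrightarrow> val_inf (of_poly p) = - int (degree p)"
  using val_inf.v_of_poly_pole by (simp add: val_inf_fun_x)

lemma val_inf_curve_fun: "p \<noteq> 0 \<or> q \<noteq> 0 \<Longrightarrow> val_inf (curve_fun p q) = - int (pole_deg p q)"
  using val_inf.v_curve_fun_pole by (simp add: val_inf_fun_x)

lemma val_inf_fun_y: "val_inf fun_y = - 3"
  using val_inf.v_fun_y_pole by (simp add: val_inf_fun_x)

text \<open>A unit at infinity whose square reduces to the nonsquare \<open>6\<close>, hence a generator of the
quadratic residue field there.\<close>

definition w_inf :: funfield where
  "w_inf = fun_y / fun_x ^ 3"

text \<open>The constants \<open>a\<close> and \<open>b\<close> cancel the leading coefficients of the numerator.\<close>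

lemma residue_at_infinity:
  assumes h: "h \<in> val_ge val_inf 0"
  obtains a b where "h - (of_poly [:a:] + of_poly [:b:] * w_inf) \<in> val_ge val_inf 1"
proof -
  obtain p q r where r: "r \<noteq> 0" and hpq: "h = curve_fun p q / of_poly r"
    by (rule funfield_fraction)
  \<comment> \<open>Integrality bounds the degrees of \<open>p\<close> and \<open>x^3 q\<close> by \<open>d\<close>, so \<open>a\<close> and \<open>b\<close> may be taken as
    the coefficients at \<open>x^d\<close>.\<close>
  define d where "d = degree r"
  have deg: "degree p \<le> d" "q \<noteq> 0 \<Longrightarrow> degree q + 3 \<le> d"
  proof -
    have "pole_deg p q \<le> d"
    proof (cases "p \<noteq> 0 \<or> q \<noteq> 0")
      case True
      then have "val_inf h = int d - int (pole_deg p q)"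
        using r by (simp add: hpq val_inf.v_divide val_inf_curve_fun val_inf_of_poly d_def)
      moreover have "h \<noteq> 0"
        using True r by (simp add: hpq)
      ultimately show ?thesis
        using h by (simp add: val_inf.val_ge_iff)
    qed (simp add: pole_deg_def)
    then show "degree p \<le> d" "q \<noteq> 0 \<Longrightarrow> degree q + 3 \<le> d"
      by (auto simp: pole_deg_def)
  qed
  define a where "a = coeff p d / coeff r d"
  define b where "b = coeff ([:0, 1:] ^ 3 * q) d / coeff r d"
  have cr: "coeff r d \<noteq> 0"
    using r by (simp add: d_def)
  let ?X3 = "[:0, 1:] ^ 3 :: F7 poly"
  define p' where "p' = p - [:a:] * r"
  define q' where "q' = ?X3 * q - [:b:] * r"
  have degX: "degree ?X3 = 3"
    by (simp add: degree_power_eq)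
  have dp: "p' = 0 \<or> degree p' < d"
  proof -
    have "degree p' \<le> d"
      unfolding p'_def using deg(1) by (intro degree_diff_le) (auto simp: d_def)
    moreover have "coeff p' d = 0"
      using cr by (simp add: p'_def a_def)
    ultimately show ?thesis
      by (metis eq_zero_or_degree_less)
  qed
  have dq: "q' = 0 \<or> degree q' < d"
  proof -
    have "degree (?X3 * q) \<le> d"
      using deg(2) by (cases "q = 0") (simp_all add: degree_mult_eq degX)
    then have "degree q' \<le> d"
      unfolding q'_def by (intro degree_diff_le) (auto simp: d_def)
    moreover have "coeff q' d = 0"
      using cr by (simp add: q'_def b_def)
    ultimately show ?thesis
      by (metis eq_zero_or_degree_less)
  qed
  have "h - (of_poly [:a:] + of_poly [:b:] * w_inf) = curve_fun (?X3 * p') q' / of_poly (?X3 * r)"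
    using r by (simp add: hpq w_inf_def p'_def q'_def curve_fun_def fun_x_def field_simps
        del: mult_pCons_left mult_pCons_right)
  moreover have "curve_fun (?X3 * p') q' / of_poly (?X3 * r) \<in> val_ge val_inf 1"
  proof (cases "p' = 0 \<and> q' = 0")
    case False
    then have "val_inf (curve_fun (?X3 * p') q' / of_poly (?X3 * r)) = int (d + 3) - int (pole_deg (?X3 * p') q')"
      using r by (simp add: val_inf.v_divide val_inf_curve_fun val_inf_of_poly d_def degree_mult_eq degX
          del: of_poly_mult)
    moreover have "pole_deg (?X3 * p') q' < d + 3"
      using dp dq False by (cases "p' = 0") (auto simp: pole_deg_def degree_mult_eq degX)
    ultimately show ?thesis
      by (simp add: val_ge_def)
  qed simp
  ultimately show ?thesis
    using that[of a b] by (simp only:)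
qed

lemma residue_at_infinity_unique:
  assumes "of_poly [:a:] + of_poly [:b:] * w_inf \<in> val_ge val_inf 1"
  shows "a = 0 \<and> b = 0"
proof (rule ccontr)
  assume ab: "\<not> (a = 0 \<and> b = 0)"
  let ?X3 = "[:0, 1:] ^ 3 :: F7 poly"
  have degX: "degree ?X3 = 3"
    by (simp add: degree_power_eq)
  have eq: "of_poly [:a:] + of_poly [:b:] * w_inf = curve_fun ([:a:] * ?X3) [:b:] / of_poly ?X3"
    by (simp add: w_inf_def curve_fun_def fun_x_def field_simps del: mult_pCons_left)
  have "degree ([:a:] * ?X3) = (if a = 0 then 0 else 3)"
    using degX by (auto simp: degree_mult_eq simp del: mult_pCons_left)
  then have "pole_deg ([:a:] * ?X3) [:b:] = 3"
    using ab by (auto simp: pole_deg_def simp del: mult_pCons_left)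
  moreover have "[:a:] * ?X3 \<noteq> 0 \<or> [:b:] \<noteq> 0"
    using ab by (simp del: mult_pCons_left)
  ultimately have "val_inf (of_poly [:a:] + of_poly [:b:] * w_inf) = 0"
    "of_poly [:a:] + of_poly [:b:] * w_inf \<noteq> 0"
    unfolding eq by (simp_all add: val_inf.v_divide val_inf_curve_fun val_inf_of_poly degX
          del: of_poly_power mult_pCons_left)
  then show False
    using assms by (simp add: val_ge_def)
qed

lemma w_inf_val_ge: "w_inf \<in> val_ge val_inf 0"
  by (simp add: w_inf_def val_inf.val_ge_iff val_inf.v_divide val_inf_fun_y val_inf.v_power val_inf_fun_x)

lemma place_degree_alt: "place_degree P = quotient_dim (val_ge (ord_at P) 0) (val_ge (ord_at P) 1)"
proof -
  have "(0 < n) = (1 \<le> n)" for n :: int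
    by auto
  then show ?thesis
    by (simp add: place_degree_def val_ge_def)
qed

lemma place_degree_P_inf: "place_degree P_inf = 2"
proof -
  define f where "f ab = of_poly [:fst ab:] + of_poly [:snd ab:] * w_inf" for ab
  have fdiff: "f ab - f cd = f (fst ab - fst cd, snd ab - snd cd)" for ab cd
  proof -
    have "[:fst ab - fst cd:] = [:fst ab:] - [:fst cd:]" "[:snd ab - snd cd:] = [:snd ab:] - [:snd cd:]"
      by simp_all
    then show ?thesis
      by (simp only: f_def fst_conv snd_conv of_poly_diff) (simp add: algebra_simps)
  qed
  have uniq: "ab = cd" if "f ab - f cd \<in> val_ge val_inf 1" for ab cd
    using that residue_at_infinity_unique[of "fst ab - fst cd" "snd ab - snd cd"]
    by (simp add: fdiff) (simp add: f_def prod_eq_iff)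
  have "inj f"
    using uniq by (metis diff_self injI val_inf.val_ge_0)
  then have "card (range f) = CARD(F7 \<times> F7)"
    by (simp add: card_image)
  then have "card (range f) = 7 ^ 2"
    by (simp add: CARD_seven)
  moreover have "transversal (val_ge val_inf 0) (val_ge val_inf 1) (range f)"
    unfolding transversal_def
  proof (intro conjI ballI)
    show "range f \<subseteq> val_ge val_inf 0"
      by (auto simp: f_def intro!: val_inf.val_ge_add val_inf.val_ge_mult0 w_inf_val_ge)
    fix h assume "h \<in> val_ge val_inf 0"
    then obtain a b where "h - f (a, b) \<in> val_ge val_inf 1"
      using residue_at_infinity unfolding f_def by (metis fst_conv snd_conv)
    moreover have "f ab = f cd" if "h - f ab \<in> val_ge val_inf 1" "h - f cd \<in> val_ge val_inf 1" for ab cd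
      using val_inf.val_ge_diff[OF that(2,1)] uniq[of ab cd] by simp
    ultimately show "\<exists>!s. s \<in> range f \<and> h - s \<in> val_ge val_inf 1"
      by (intro ex1I[of _ "f (a, b)"]) auto
  qed simp
  ultimately show ?thesis
    using quotient_dim_transversal[OF val_inf.val_ge_subspace val_inf.val_ge_subspace]
    by (simp add: place_degree_alt ord_at_P_inf)
qed

section \<open>Primes of the coordinate ring and their valuations\<close>

lemma irreducible_bezout:
  fixes p q :: "F7 poly"
  assumes "irreducible p" "\<not> p dvd q"
  obtains a b where "a * p + b * q = 1"
proof -
  have "coprime p q"
    using assms field_poly_irreducible_imp_prime prime_elem_imp_coprime by blast
  then have "fst (bezout_coefficients p q) * p + snd (bezout_coefficients p q) * q = 1"
    by (simp add: bezout_coefficients_fst_snd)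
  then show ?thesis
    by (rule that)
qed

lemma irreducible_dvd_mult_iff:
  fixes p q r :: "F7 poly"
  shows "irreducible p \<Longrightarrow> p dvd q * r \<longleftrightarrow> p dvd q \<or> p dvd r"
  using field_poly_irreducible_imp_prime prime_elem_dvd_mult_iff by blast

lemma irreducible_decompose:
  fixes p q :: "F7 poly"
  assumes "irreducible p" "q \<noteq> 0"
  obtains k n where "q = p ^ k * n" "\<not> p dvd n"
  using assms multiplicity_decompose'[of q p] by (metis irreducible_def)

lemma of_poly_2 [simp]: "of_poly [:2:] = 2"
  by (metis numeral_poly of_poly_numeral)

lemma curve_fun_conj_add: "curve_fun p q + curve_fun p (- q) = of_poly [:2:] * of_poly p"
  and curve_fun_conj_diff: "curve_fun p q - curve_fun p (- q) = of_poly [:2:] * of_poly q * fun_y"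
  by (simp_all add: curve_fun_def)

locale prime_ideal =
  fixes m :: "funfield set"
  assumes sub: "m \<subseteq> coord_ring"
    and zero: "0 \<in> m" and one: "1 \<notin> m"
    and add: "r \<in> m \<Longrightarrow> s \<in> m \<Longrightarrow> r + s \<in> m"
    and absorb: "r \<in> coord_ring \<Longrightarrow> s \<in> m \<Longrightarrow> r * s \<in> m"
    and prime: "r \<in> coord_ring \<Longrightarrow> s \<in> coord_ring \<Longrightarrow> r * s \<in> m \<Longrightarrow> r \<in> m \<or> s \<in> m"
begin

lemma diff: "r \<in> m \<Longrightarrow> s \<in> m \<Longrightarrow> r - s \<in> m"
  using add[of r "of_poly [:- 1:] * s"] absorb[of "of_poly [:- 1:]" s] of_poly_minus[of "[:1:]"] by simp

lemma const_notin: "c \<noteq> 0 \<Longrightarrow> of_poly [:c:] \<notin> m"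
proof
  assume "c \<noteq> 0" "of_poly [:c:] \<in> m"
  then have "of_poly ([:1 / c:] * [:c:]) \<in> m"
    using absorb[OF of_poly_in_coord_ring, of "of_poly [:c:]" "[:1 / c:]"] by (simp only: of_poly_mult)
  then show False
    using one \<open>c \<noteq> 0\<close> by simp
qed

lemma unit_mult: "r \<in> coord_ring - m \<Longrightarrow> s \<in> coord_ring - m \<Longrightarrow> r * s \<in> coord_ring - m"
  using prime by auto

lemma unit_nonzero: "r \<in> coord_ring - m \<Longrightarrow> r \<noteq> 0"
  using zero by auto

lemma fun_y_mem_iff: "fun_y \<in> m \<longleftrightarrow> of_poly sextic \<in> m"
  using absorb[of fun_y fun_y] prime[of fun_y fun_y] fun_y_square by (auto simp: power2_eq_square)

end

locale prime_over = prime_ideal +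
  fixes p :: "F7 poly"
  assumes irred: "irreducible p" and over: "of_poly p \<in> m"
begin

lemma of_poly_mem_iff: "of_poly q \<in> m \<longleftrightarrow> p dvd q"
proof
  assume "p dvd q"
  then obtain s where "q = s * p"
    by (metis dvdE mult.commute)
  then show "of_poly q \<in> m"
    using absorb over by simp
next
  assume q: "of_poly q \<in> m"
  show "p dvd q"
  proof (rule ccontr)
    assume "\<not> p dvd q"
    then obtain a b where "a * p + b * q = 1"
      using irreducible_bezout irred by blast
    then have "of_poly a * of_poly p + of_poly b * of_poly q = 1"
      by (metis of_poly_1 of_poly_add of_poly_mult)
    moreover have "of_poly a * of_poly p + of_poly b * of_poly q \<in> m"
      using absorb over q add by simp
    ultimately show False
      using one by simp
  qed
qed

text \<open>The residue ring of a prime over an irreducible polynomial is a field.  If the conjugate of \<open>s\<close>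
lies outside the prime, the norm of \<open>s\<close> is invertible modulo \<open>p\<close>; otherwise \<open>s\<close> is
congruent to its trace, which is then a polynomial invertible modulo \<open>p\<close>.\<close>

lemma inverse_mod:
  assumes s: "s \<in> coord_ring - m"
  obtains s' where "s' \<in> coord_ring" "s * s' - 1 \<in> m"
proof -
  obtain a b where sab: "s = curve_fun a b"
    using s by (auto simp: coord_ring_def)
  define s1 where "s1 = curve_fun a (- b)"
  show ?thesis
  proof (cases "s1 \<in> m")
    case False
    define N where "N = norm_form a b"
    have ss1: "s * s1 = of_poly N"
      by (simp add: sab s1_def curve_fun_norm N_def)
    then have "of_poly N \<notin> m"
      using unit_mult[OF s, of s1] False by (simp add: s1_def)
    then obtain u w where "u * p + w * N = 1"
      using irreducible_bezout irred of_poly_mem_iff by blast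
    then have "of_poly u * of_poly p + of_poly w * of_poly N = 1"
      by (metis of_poly_1 of_poly_add of_poly_mult)
    moreover have "N' * W - 1 = 0 - U * P" if "U * P + W * N' = 1" for N' W U P :: funfield
      by (subst that[symmetric]) (simp add: algebra_simps)
    ultimately have "of_poly N * of_poly w - 1 = 0 - of_poly u * of_poly p"
      by blast
    then have "s * (s1 * of_poly w) - 1 = 0 - of_poly u * of_poly p"
      unfolding ss1[symmetric] mult.assoc .
    also have "\<dots> \<in> m"
      using absorb[OF of_poly_in_coord_ring over] diff zero by blast
    finally show ?thesis
      using that[of "s1 * of_poly w"] by (simp add: s1_def)
  next
    case True
    have eq: "s = of_poly ([:2:] * a) - s1"
      unfolding of_poly_mult curve_fun_conj_add[of a b, symmetric] by (simp add: sab s1_def)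
    have "of_poly ([:2:] * a) \<notin> m"
    proof
      assume "of_poly ([:2:] * a) \<in> m"
      from diff[OF this True] show False
        using s unfolding eq[symmetric] by blast
    qed
    then obtain u w where "u * p + w * ([:2:] * a) = 1"
      using irreducible_bezout irred of_poly_mem_iff by blast
    then have "of_poly u * of_poly p + of_poly w * of_poly ([:2:] * a) = 1"
      by (metis of_poly_1 of_poly_add of_poly_mult)
    moreover have "(A - s1) * W - 1 = 0 - (U * P + W * s1)" if "U * P + W * A = 1" for A W U P
      by (subst that[symmetric]) (simp add: algebra_simps)
    ultimately have "s * of_poly w - 1 = 0 - (of_poly u * of_poly p + of_poly w * s1)"
      unfolding eq by blast
    also have "\<dots> \<in> m"
      using absorb[OF of_poly_in_coord_ring over] absorb[OF of_poly_in_coord_ring True] add diff zero by blast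
    finally show ?thesis
      using that[of "of_poly w"] by simp
  qed
qed

end

text \<open>The two last assumptions say that the localisation of the coordinate ring at \<open>m\<close> has maximal
ideal generated by \<open>t\<close> and that no nonzero element is divisible by all powers of \<open>t\<close>.  So
the localisation is a discrete valuation ring, and these conditions are stated without fractions
because that is how they are verified.\<close>

locale local_parameter = prime_ideal +
  fixes t :: funfield
  assumes param: "t \<in> m" and param_nonzero: "t \<noteq> 0"
    and param_divides: "r \<in> m \<Longrightarrow> \<exists>s\<in>coord_ring - m. \<exists>r'\<in>coord_ring. r * s = t * r'"
    and param_bounded: "r \<in> coord_ring \<Longrightarrow> r \<noteq> 0 \<Longrightarrow>
      \<exists>r'\<in>coord_ring. \<exists>k::nat. \<exists>n\<in>coord_ring - m. r * r' = t ^ k * n"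
begin

text \<open>Dividing by \<open>t\<close> as often as possible; the bound on the exponent comes from the multiple of
\<open>r\<close> that is a power of \<open>t\<close> times a unit.\<close>

lemma ring_representation:
  assumes r: "r \<in> coord_ring" "r \<noteq> 0"
  shows "\<exists>k::nat. \<exists>u\<in>coord_ring - m. \<exists>s\<in>coord_ring - m. r * s = t ^ k * u"
proof -
  define Q where "Q k \<longleftrightarrow> (\<exists>s\<in>coord_ring - m. \<exists>r'\<in>coord_ring. r * s = t ^ k * r')" for k
  obtain r0 l n where r0: "r0 \<in> coord_ring" "n \<in> coord_ring - m" "r * r0 = t ^ l * n"
    using param_bounded[OF r] by blast
  have bound: "k \<le> l" if "Q k" for k
  proof (rule ccontr)
    assume "\<not> k \<le> l"
    then obtain j where j: "k = l + Suc j"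
      by (metis add_Suc_right less_imp_Suc_add not_le)
    obtain s r' where s: "s \<in> coord_ring - m" "r' \<in> coord_ring" "r * s = t ^ k * r'"
      using \<open>Q k\<close> by (auto simp: Q_def)
    have "t ^ l * (n * s) = (r * r0) * s"
      using r0 by simp
    also have "\<dots> = (r * s) * r0"
      by (simp only: mult_ac)
    also have "\<dots> = t ^ l * ((t ^ j * r' * r0) * t)"
      by (simp add: s j power_add mult_ac)
    finally have "n * s = (t ^ j * r' * r0) * t"
      using param_nonzero by simp
    also have "\<dots> \<in> m"
      using param s(2) r0(1) sub by (intro absorb) auto
    finally show False
      using unit_mult[OF r0(2) s(1)] by simp
  qed
  have "Q 0"
    unfolding Q_def by (rule bexI[of _ 1]) (use one r in auto)
  then have "Q (GREATEST k. Q k)"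
    using bound GreatestI_nat[of Q] by blast
  then obtain s r' where s: "s \<in> coord_ring - m" "r' \<in> coord_ring" "r * s = t ^ (GREATEST k. Q k) * r'"
    by (auto simp: Q_def)
  have "r' \<notin> m"
  proof
    assume "r' \<in> m"
    then obtain s' r'' where s': "s' \<in> coord_ring - m" "r'' \<in> coord_ring" "r' * s' = t * r''"
      using param_divides by blast
    have "r * (s * s') = (r * s) * s'"
      by (simp only: mult.assoc)
    also have "\<dots> = t ^ (GREATEST k. Q k) * (r' * s')"
      by (simp only: s(3) mult.assoc)
    finally have "r * (s * s') = t ^ (GREATEST k. Q k) * (r' * s')" .
    then have "r * (s * s') = t ^ Suc (GREATEST k. Q k) * r''"
      using s'(3) by (simp add: mult_ac)
    then have "Q (Suc (GREATEST k. Q k))"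
      unfolding Q_def using unit_mult[OF s(1) s'(1)] s'(2) by blast
    then have "Suc (GREATEST k. Q k) \<le> (GREATEST k. Q k)"
      using bound Greatest_le_nat[of Q] by blast
    then show False
      by simp
  qed
  then show ?thesis
    using s by blast
qed

lemma representation:
  assumes "h \<noteq> 0"
  obtains k u s where "u \<in> coord_ring - m" "s \<in> coord_ring - m" "h = t powi k * (u / s)"
proof -
  obtain r r' where h: "r \<in> coord_ring" "r' \<in> coord_ring" "r' \<noteq> 0" "h = r / r'"
    by (rule coord_ring_fraction)
  have "r \<noteq> 0"
    using h assms by auto
  then obtain k u s where r: "u \<in> coord_ring - m" "s \<in> coord_ring - m" "r * s = t ^ k * u"
    using ring_representation h by blast
  obtain k' u' s' where r': "u' \<in> coord_ring - m" "s' \<in> coord_ring - m" "r' * s' = t ^ k' * u'"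
    using ring_representation h by blast
  note nz = unit_nonzero[OF r(1)] unit_nonzero[OF r(2)] unit_nonzero[OF r'(1)] unit_nonzero[OF r'(2)]
  have e: "r = t ^ k * u / s" "r' = t ^ k' * u' / s'"
    using r r' nz by (simp_all add: field_simps)
  have "h = t powi (int k - int k') * ((u * s') / (s * u'))"
    using nz param_nonzero h(4) unfolding e by (simp add: power_int_diff mult_ac)
  then show ?thesis
    using that[OF unit_mult[OF r(1) r'(2)] unit_mult[OF r(2) r'(1)]] by blast
qed

lemma param_power_unit:
  assumes u: "u \<in> coord_ring - m" "s \<in> coord_ring - m" and eq: "t powi k * (u / s) = u' / s'"
    and u': "u' \<in> coord_ring" "s' \<in> coord_ring - m"
  shows "0 \<le> k" "u' \<notin> m \<Longrightarrow> k = 0"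
proof -
  note nz = unit_nonzero[OF u(1)] unit_nonzero[OF u(2)] unit_nonzero[OF u'(2)]
  show k0: "0 \<le> k"
  proof (rule ccontr)
    assume "\<not> 0 \<le> k"
    then obtain j where j: "- k = int (Suc j)"
      by (metis Suc_pred' nat_0_le neg_0_le_iff_le not_le zero_less_nat_eq neg_0_less_iff_less order_less_imp_le)
    have "u / s = t powi (- k) * (u' / s')"
      unfolding eq[symmetric] using param_nonzero by (simp add: power_int_minus flip: mult.assoc)
    then have "u * s' = (t ^ j * u' * s) * t"
      using nz by (simp add: j field_simps del: of_nat_Suc)
    also have "\<dots> \<in> m"
      using param u u' sub by (intro absorb) auto
    finally show False
      using unit_mult[OF u(1) u'(2)] by simp
  qed
  assume u'm: "u' \<notin> m"
  show "k = 0"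
  proof (rule ccontr)
    assume "k \<noteq> 0"
    then obtain j where j: "k = int (Suc j)"
      using k0 by (metis nonneg_int_cases not0_implies_Suc of_nat_0)
    have "u' * s = (t ^ j * u * s') * t"
      using eq nz by (simp add: j field_simps del: of_nat_Suc)
    also have "\<dots> \<in> m"
      using param u u' sub by (intro absorb) auto
    finally show False
      using unit_mult[of u' s] u u' u'm by simp
  qed
qed

definition val :: "funfield \<Rightarrow> int" where
  "val h = (if h = 0 then 0 else
     (THE k. \<exists>u\<in>coord_ring - m. \<exists>s\<in>coord_ring - m. h = t powi k * (u / s)))"

lemma val_eqI:
  assumes u: "u \<in> coord_ring - m" "s \<in> coord_ring - m" and h: "h = t powi k * (u / s)"
  shows "val h = k"
proof -
  have "h \<noteq> 0"
    using unit_nonzero u h param_nonzero by simp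
  moreover have "(THE k. \<exists>u\<in>coord_ring - m. \<exists>s\<in>coord_ring - m. h = t powi k * (u / s)) = k"
  proof (rule the_equality)
    show "\<exists>u\<in>coord_ring - m. \<exists>s\<in>coord_ring - m. h = t powi k * (u / s)"
      using u h by blast
    fix l assume "\<exists>u\<in>coord_ring - m. \<exists>s\<in>coord_ring - m. h = t powi l * (u / s)"
    then obtain u' s' where u': "u' \<in> coord_ring - m" "s' \<in> coord_ring - m" "h = t powi l * (u' / s')"
      by blast
    have "t powi (l - k) * (u' / s') = (t powi l * (u' / s')) / t powi k"
      using param_nonzero by (simp add: power_int_diff)
    also have "\<dots> = u / s"
      unfolding u'(3)[symmetric] h using param_nonzero by simp
    finally have "t powi (l - k) * (u' / s') = u / s" .
    then show "l = k"
      using param_power_unit(2)[OF u'(1,2), of "l - k" u s] u by auto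
  qed
  ultimately show ?thesis
    by (simp only: val_def if_False)
qed

lemma val_nonneg_iff:
  assumes "h \<noteq> 0"
  shows "0 \<le> val h \<longleftrightarrow> (\<exists>r\<in>coord_ring. \<exists>s\<in>coord_ring - m. h = r / s)"
proof -
  obtain k u s where h: "u \<in> coord_ring - m" "s \<in> coord_ring - m" "h = t powi k * (u / s)"
    using representation[OF assms] .
  have k: "val h = k"
    by (rule val_eqI[OF h])
  show ?thesis
  proof
    assume "0 \<le> val h"
    then have "h = t ^ nat k * u / s"
      using h k by (simp add: power_int_def)
    moreover have "t ^ nat k * u \<in> coord_ring"
      using h param sub by auto
    ultimately show "\<exists>r\<in>coord_ring. \<exists>s\<in>coord_ring - m. h = r / s"
      using h(2) by blast
  next
    assume "\<exists>r\<in>coord_ring. \<exists>s\<in>coord_ring - m. h = r / s"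
    then show "0 \<le> val h"
      using param_power_unit(1)[OF h(1,2)] h(3) k by metis
  qed
qed

lemma val_mult:
  assumes "g \<noteq> 0" "h \<noteq> 0"
  shows "val (g * h) = val g + val h"
proof -
  obtain k u s where g: "u \<in> coord_ring - m" "s \<in> coord_ring - m" "g = t powi k * (u / s)"
    using representation[OF assms(1)] .
  obtain k' u' s' where h: "u' \<in> coord_ring - m" "s' \<in> coord_ring - m" "h = t powi k' * (u' / s')"
    using representation[OF assms(2)] .
  have "g * h = t powi (k + k') * ((u * u') / (s * s'))"
    using param_nonzero by (simp add: g h power_int_add mult_ac)
  then show ?thesis
    using val_eqI[OF unit_mult[OF g(1) h(1)] unit_mult[OF g(2) h(2)]] val_eqI[OF g] val_eqI[OF h] by simp
qed

lemma val_unit: "u \<in> coord_ring - m \<Longrightarrow> val u = 0"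
  using one by (intro val_eqI[of u 1]) auto

lemma val_param: "val t = 1"
  using one by (intro val_eqI[of 1 1]) auto

lemma val_param_powi: "val (t powi k) = k"
  using one by (intro val_eqI[of 1 1]) auto

lemma val_add_nonneg:
  assumes "g \<noteq> 0" "h \<noteq> 0" "g + h \<noteq> 0" "0 \<le> val g" "0 \<le> val h"
  shows "0 \<le> val (g + h)"
proof -
  obtain r s where g: "r \<in> coord_ring" "s \<in> coord_ring - m" "g = r / s"
    using assms val_nonneg_iff by blast
  obtain r' s' where h: "r' \<in> coord_ring" "s' \<in> coord_ring - m" "h = r' / s'"
    using assms val_nonneg_iff by blast
  have "g + h = (r * s' + r' * s) / (s * s')"
    using unit_nonzero[OF g(2)] unit_nonzero[OF h(2)] by (simp add: g h field_simps)
  moreover have "r * s' + r' * s \<in> coord_ring"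
    using g h by simp
  ultimately show ?thesis
    using val_nonneg_iff[OF assms(3)] unit_mult[OF g(2) h(2)] by blast
qed

lemma discrete_valuation_val: "discrete_valuation val"
  unfolding discrete_valuation_def
proof (intro conjI allI impI)
  show "val 0 = 0"
    by (simp add: val_def)
  show "\<exists>t. val t = 1"
    using val_param by blast
  show "val (of_poly [:c:]) = 0" if "c \<noteq> 0" for c
    using const_notin[OF that] by (intro val_unit) simp
  fix g h :: funfield assume nz: "g \<noteq> 0" "h \<noteq> 0"
  then show "val (g * h) = val g + val h"
    by (rule val_mult)
  assume nz': "g + h \<noteq> 0"
  let ?n = "min (val g) (val h)"
  let ?T = "t powi (- ?n)"
  have T: "?T \<noteq> 0"
    using param_nonzero by simp
  have shift: "val (?T * f) = val f - ?n" if "f \<noteq> 0" for f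
    using that val_mult[OF T] val_param_powi by simp
  have "0 \<le> val (?T * g + ?T * h)"
    using nz nz' T shift by (intro val_add_nonneg) (auto simp flip: distrib_left)
  then show "?n \<le> val (g + h)"
    using shift[OF nz'] by (simp flip: distrib_left)
qed

text \<open>Every function is a power of \<open>t\<close> times a quotient of elements on which \<open>v\<close> vanishes, so
\<open>v\<close> is a multiple of \<open>val\<close>, and normalisation makes the factor \<open>1\<close>.\<close>

lemma valuation_unique:
  assumes "valuation v" and nonneg: "coord_ring \<subseteq> val_ge v 0" and units: "\<And>r. r \<in> coord_ring - m \<Longrightarrow> v r = 0"
  shows "v = val"
proof -
  interpret valuation v by fact
  have *: "v h = val h * v t" if h0: "h \<noteq> 0" for h
  proof -
    obtain k u s where h: "u \<in> coord_ring - m" "s \<in> coord_ring - m" "h = t powi k * (u / s)"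
      using representation[OF h0] .
    then have "v h = k * v t"
      using unit_nonzero param_nonzero by (simp add: v_mult v_divide v_powi units)
    then show ?thesis
      using val_eqI[OF h] by simp
  qed
  obtain f where f: "v f = 1"
    using v_uniformizer by blast
  then have "f \<noteq> 0"
    by auto
  then have "v t dvd 1"
    using * f by (metis dvd_triv_right)
  moreover have "0 \<le> v t"
    using nonneg param sub by (metis param_nonzero subsetD val_ge_iff)
  ultimately have t: "v t = 1"
    by (simp add: zdvd1_eq)
  have "v h = val h" for h
    using *[of h] t by (cases "h = 0") (simp_all add: val_def)
  then show ?thesis ..
qed

lemma exists_place:
  obtains P where "ord_at P = val" "coord_ring \<subseteq> val_ge (ord_at P) 0"
    "\<And>r. r \<in> coord_ring \<Longrightarrow> r \<in> val_ge (ord_at P) 1 \<longleftrightarrow> r \<in> m"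
proof -
  have P: "ord_at (Place val) = val"
    by (simp add: Place_inverse discrete_valuation_val)
  interpret valuation val
    by unfold_locales (rule discrete_valuation_val)
  have R: "coord_ring \<subseteq> val_ge val 0"
    using val_nonneg_iff one by (force simp: val_ge_def intro: bexI[of _ 1])
  have "r \<in> val_ge val 1 \<longleftrightarrow> r \<in> m" if "r \<in> coord_ring" for r
  proof
    assume r: "r \<in> val_ge val 1"
    show "r \<in> m"
    proof (rule ccontr)
      assume "r \<notin> m"
      then have "val r = 0" "r \<noteq> 0"
        using val_unit[of r] that zero by auto
      then show False
        using r by (simp add: val_ge_def)
    qed
  next
    assume "r \<in> m"
    then obtain s r' where "s \<in> coord_ring - m" "r' \<in> coord_ring" "r * s = t * r'"
      using param_divides by blast
    note this(1) unit_nonzero[OF this(1)] this(2,3)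
    then have "r = t * (r' / s)" "r' / s \<in> val_ge val 0"
      using val_nonneg_iff[of "r' / s"] by (auto simp: nonzero_eq_divide_eq val_ge_def)
    then show "r \<in> val_ge val 1"
      using val_ge_mult0(2)[of t 1 "r' / s"] val_param by (simp add: val_ge_def)
  qed
  then show ?thesis
    using that[of "Place val"] P R by simp
qed

end

context prime_over
begin

text \<open>If the conjugate of \<open>r\<close> is outside the prime, the norm of \<open>r\<close> supplies the factor \<open>p\<close>.
If it is inside, then the trace and the difference lie in the prime too, and since neither \<open>2\<close> nor
\<open>y\<close> does, \<open>p\<close> divides both coefficients of \<open>r\<close>.\<close>

lemma unramified:
  assumes "of_poly sextic \<notin> m"
  shows "local_parameter m (of_poly p)"
proof unfold_locales
  show "of_poly p \<in> m" "of_poly p \<noteq> 0"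
    using over irred by auto
  have y: "fun_y \<notin> m"
    using assms fun_y_mem_iff by blast
  have two: "of_poly [:2:] \<notin> m"
    by (rule const_notin) (rule F7_two_nonzero)
  fix r
  show "\<exists>s\<in>coord_ring - m. \<exists>r'\<in>coord_ring. r * s = of_poly p * r'" if r: "r \<in> m"
  proof -
    obtain a b where rab: "r = curve_fun a b"
      using r sub by (auto simp: coord_ring_def)
    define r1 where "r1 = curve_fun a (- b)"
    show ?thesis
    proof (cases "r1 \<in> m")
      case False
      have N: "r * r1 = of_poly (norm_form a b)"
        by (simp add: rab r1_def curve_fun_norm)
      then have "of_poly (norm_form a b) \<in> m"
        using absorb[OF _ r, of r1] by (simp add: r1_def mult.commute)
      then obtain n where "norm_form a b = p * n"
        using of_poly_mem_iff by (metis dvdE)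
      then show ?thesis
        using N False by (intro bexI[of _ r1] bexI[of _ "of_poly n"]) (auto simp: r1_def)
    next
      case True
      have "of_poly [:2:] * of_poly a \<in> m" "(of_poly [:2:] * of_poly b) * fun_y \<in> m"
        using add[OF r True] diff[OF r True] curve_fun_conj_add[of a b] curve_fun_conj_diff[of a b]
        by (simp_all add: rab r1_def)
      then have "of_poly a \<in> m" "of_poly b \<in> m"
        using prime two y by (metis coord_ring_mult fun_y_in_coord_ring of_poly_in_coord_ring)+
      then obtain a' b' where "a = p * a'" "b = p * b'"
        using of_poly_mem_iff by (metis dvdE)
      then have "r * 1 = of_poly p * curve_fun a' b'"
        by (simp add: rab curve_fun_def algebra_simps)
      then show ?thesis
        using one by (intro bexI[of _ 1] bexI[of _ "curve_fun a' b'"]) auto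
    qed
  qed
  show "\<exists>r'\<in>coord_ring. \<exists>k. \<exists>n\<in>coord_ring - m. r * r' = of_poly p ^ k * n"
    if r: "r \<in> coord_ring" "r \<noteq> 0"
  proof -
    obtain a b where rab: "r = curve_fun a b"
      using r by (auto simp: coord_ring_def)
    then have "norm_form a b \<noteq> 0"
      using r norm_form_degree[of a b] by auto
    then obtain k n where kn: "norm_form a b = p ^ k * n" "\<not> p dvd n"
      using irreducible_decompose irred by blast
    then have "r * curve_fun a (- b) = of_poly p ^ k * of_poly n"
      by (simp add: rab curve_fun_norm)
    moreover have "of_poly n \<in> coord_ring - m"
      using kn of_poly_mem_iff by simp
    ultimately show ?thesis
      using curve_fun_in_coord_ring by blast
  qed
qed

text \<open>Separability of the sextic gives \<open>y^2 = p q\<close> with \<open>q\<close> outside the prime, so \<open>p\<close> is a unit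
times \<open>y^2\<close>, and in \<open>a + b y\<close> with \<open>p dvd a\<close> both terms are divisible by \<open>y\<close>.\<close>

lemma ramified:
  assumes "of_poly sextic \<in> m"
  shows "local_parameter m fun_y"
proof unfold_locales
  show y: "fun_y \<in> m" "fun_y \<noteq> 0"
    using assms fun_y_mem_iff by auto
  obtain q where q: "sextic = p * q"
    using assms of_poly_mem_iff by (metis dvdE)
  have nq: "\<not> p dvd q"
  proof
    assume "p dvd q"
    then have "p dvd pderiv sextic"
      unfolding q pderiv_mult by (intro dvd_add) auto
    then have "p dvd [:2:]"
      unfolding sextic_separable[symmetric] by (intro dvd_add dvd_mult) (auto simp: q)
    then have "of_poly [:2:] \<in> m"
      unfolding of_poly_mem_iff .
    then show False
      using const_notin[OF F7_two_nonzero] by blast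
  qed
  have qm: "of_poly q \<in> coord_ring - m"
    using nq of_poly_mem_iff by simp
  have yy: "fun_y * fun_y = of_poly p * of_poly q"
    using fun_y_square unfolding q of_poly_mult power2_eq_square .
  fix r
  show "\<exists>s\<in>coord_ring - m. \<exists>r'\<in>coord_ring. r * s = fun_y * r'" if r: "r \<in> m"
  proof -
    obtain a b where rab: "r = curve_fun a b"
      using r sub by (auto simp: coord_ring_def)
    have "of_poly a = r - of_poly b * fun_y"
      by (simp add: rab curve_fun_def)
    then have "of_poly a \<in> m"
      using diff[OF r absorb[OF of_poly_in_coord_ring y(1)]] by metis
    then obtain a' where a: "a = p * a'"
      using of_poly_mem_iff by (metis dvdE)
    have "fun_y * curve_fun (b * q) a' = of_poly b * of_poly q * fun_y + of_poly a' * (fun_y * fun_y)"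
      by (simp add: curve_fun_def algebra_simps)
    also have "\<dots> = r * of_poly q"
      unfolding yy by (simp add: rab curve_fun_def a algebra_simps)
    finally have "r * of_poly q = fun_y * curve_fun (b * q) a'" ..
    then show ?thesis
      using qm curve_fun_in_coord_ring by blast
  qed
  show "\<exists>r'\<in>coord_ring. \<exists>k. \<exists>n\<in>coord_ring - m. r * r' = fun_y ^ k * n"
    if r: "r \<in> coord_ring" "r \<noteq> 0"
  proof -
    obtain a b where rab: "r = curve_fun a b"
      using r by (auto simp: coord_ring_def)
    then have "norm_form a b \<noteq> 0"
      using r norm_form_degree[of a b] by auto
    then obtain k n where kn: "norm_form a b = p ^ k * n" "\<not> p dvd n"
      using irreducible_decompose irred by blast
    have "r * (curve_fun a (- b) * of_poly q ^ k) = of_poly (norm_form a b) * of_poly q ^ k"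
      by (simp only: rab curve_fun_norm flip: mult.assoc)
    also have "\<dots> = (of_poly p * of_poly q) ^ k * of_poly n"
      by (simp add: kn power_mult_distrib)
    also have "\<dots> = fun_y ^ (2 * k) * of_poly n"
      by (simp add: power_mult power2_eq_square yy)
    finally have "r * (curve_fun a (- b) * of_poly q ^ k) = fun_y ^ (2 * k) * of_poly n" .
    moreover have "of_poly n \<in> coord_ring - m"
      using kn of_poly_mem_iff by simp
    moreover have "curve_fun a (- b) * of_poly q ^ k \<in> coord_ring"
      by simp
    ultimately show ?thesis
      by blast
  qed
qed

lemma local_parameter_exists: obtains t where "local_parameter m t"
  using unramified ramified by blast

end

section \<open>Places with finite \<open>x\<close>\<close>

locale finite_place = valuation +
  assumes integral: "fun_x \<in> val_ge v 0"
begin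

lemma of_poly_integral: "of_poly p \<in> val_ge v 0"
proof (induction p)
  case (pCons a p)
  then show ?case
    by (subst of_poly_pCons) (intro val_ge_add val_ge_mult0 integral val_ge_const; simp)
qed simp

lemma fun_y_integral: "fun_y \<in> val_ge v 0"
proof -
  have "2 * v fun_y = v (of_poly sextic)"
    using v_power[of fun_y 2] by (simp add: fun_y_square)
  then show ?thesis
    using of_poly_integral[of sextic] sextic_nonzero by (simp add: val_ge_iff)
qed

lemma coord_ring_integral: "coord_ring \<subseteq> val_ge v 0"
  unfolding coord_ring_def curve_fun_def
  by (auto intro!: val_ge_add val_ge_mult0 of_poly_integral fun_y_integral)

definition center :: "funfield set" where
  "center = coord_ring \<inter> val_ge v 1"

sublocale center: prime_ideal center
proof
  show "center \<subseteq> coord_ring" "0 \<in> center" "1 \<notin> center"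
    using of_poly_in_coord_ring[of 0] by (auto simp: center_def val_ge_iff)
  fix r s
  show "r + s \<in> center" if "r \<in> center" "s \<in> center"
    using that val_ge_add by (simp add: center_def)
  show "r * s \<in> center" if "r \<in> coord_ring" "s \<in> center"
    using that val_ge_mult0(1) coord_ring_integral by (auto simp: center_def)
  show "r \<in> center \<or> s \<in> center" if "r \<in> coord_ring" "s \<in> coord_ring" "r * s \<in> center"
    using that val_ge_prod[of r s] coord_ring_integral by (auto simp: center_def)
qed

lemma v_unit: "r \<in> coord_ring - center \<Longrightarrow> r \<noteq> 0 \<and> v r = 0"
  using coord_ring_integral v_eq_0_iff[of r] by (auto simp: center_def)

text \<open>Otherwise every polynomial in \<open>x\<close> would have valuation \<open>0\<close>, hence so would every norm, and
with two nonnegative summands every element of the coordinate ring.\<close>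

lemma center_contains_poly: obtains q where "q \<noteq> 0" "of_poly q \<in> center"
proof (rule ccontr)
  assume "\<not> thesis"
  then have "of_poly q \<in> coord_ring - center" if "q \<noteq> 0" for q
    using that \<open>\<And>q. q \<noteq> 0 \<Longrightarrow> of_poly q \<in> center \<Longrightarrow> thesis\<close> by auto
  then have poly0: "v (of_poly q) = 0" if "q \<noteq> 0" for q
    using v_unit that by blast
  have ring0: "v (curve_fun a b) = 0" if "curve_fun a b \<noteq> 0" for a b
  proof -
    have nz: "curve_fun a b \<noteq> 0" "curve_fun a (- b) \<noteq> 0"
      using that by auto
    have "v (curve_fun a b) + v (curve_fun a (- b)) = 0"
      using v_mult[OF nz] norm_form_degree[of a b] that poly0 by (auto simp: curve_fun_norm)
    moreover have "0 \<le> v (curve_fun a b)" "0 \<le> v (curve_fun a (- b))"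
      using nz coord_ring_integral by (simp_all add: val_ge_iff[symmetric] subset_iff)
    ultimately show ?thesis
      by simp
  qed
  have "v h = 0" for h
  proof -
    obtain a b r where "r \<noteq> 0" "h = curve_fun a b / of_poly r"
      by (rule funfield_fraction)
    then show ?thesis
      using poly0[of r] ring0[of a b] v_divide[of "curve_fun a b" "of_poly r"]
      by (cases "curve_fun a b = 0") auto
  qed
  then show False
    using v_uniformizer by auto
qed

text \<open>A polynomial of least degree in the centre is irreducible because the centre is prime.\<close>

lemma center_over: obtains p where "prime_over center p"
proof -
  define Q where "Q q \<longleftrightarrow> q \<noteq> 0 \<and> of_poly q \<in> center" for q
  obtain q0 where "Q q0"
    using center_contains_poly unfolding Q_def by blast
  then obtain p where p: "Q p" and min: "\<And>q. Q q \<Longrightarrow> degree p \<le> degree q"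
    using ex_has_least_nat[of Q q0 degree] by blast
  have nonunit: "\<not> is_unit q" if "Q q" for q
  proof
    assume "is_unit q"
    then obtain s where "1 = s * q"
      by (metis dvdE mult.commute)
    then have "1 = of_poly s * of_poly q"
      by (metis of_poly_1 of_poly_mult)
    then show False
      using center.absorb[OF of_poly_in_coord_ring, of "of_poly q" s] that center.one by (simp add: Q_def)
  qed
  have "irreducible p"
  proof (rule irreducibleI)
    show "p \<noteq> 0" "\<not> is_unit p"
      using p nonunit by (auto simp: Q_def)
    fix a b assume ab: "p = a * b"
    then have nz: "a \<noteq> 0" "b \<noteq> 0"
      using p by (auto simp: Q_def)
    have "Q a \<or> Q b"
      using center.prime[of "of_poly a" "of_poly b"] p nz by (auto simp: Q_def ab)
    moreover have "degree p = degree a + degree b"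
      using nz by (simp add: ab degree_mult_eq)
    ultimately have "degree a = 0 \<or> degree b = 0"
      using min by fastforce
    then show "is_unit a \<or> is_unit b"
      using nz is_unit_iff_degree by blast
  qed
  then have "prime_over center p"
    using p by unfold_locales (auto simp: Q_def)
  then show ?thesis
    by (rule that)
qed

lemma v_eq_val:
  assumes "local_parameter center t"
  shows "v = local_parameter.val center t"
  using local_parameter.valuation_unique[OF assms valuation_axioms coord_ring_integral] v_unit by blast

lemma v_parameter: "local_parameter center t \<Longrightarrow> v t = 1"
  using v_eq_val local_parameter.val_param by metis

lemma integral_fraction:
  assumes "h \<in> val_ge v 0"
  obtains r s where "r \<in> coord_ring" "s \<in> coord_ring - center" "h = r / s"
proof (cases "h = 0")
  case True
  then show ?thesis
    using that[of 0 1] center.one of_poly_in_coord_ring[of 0] by simp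
next
  case False
  obtain p where "prime_over center p"
    by (rule center_over)
  then obtain t where t: "local_parameter center t"
    using prime_over.local_parameter_exists by blast
  then show ?thesis
    using local_parameter.val_nonneg_iff[OF t False] assms False v_eq_val[OF t] that
    by (auto simp: val_ge_iff)
qed

lemma residue_in_coord_ring:
  assumes "h \<in> val_ge v 0"
  obtains r where "r \<in> coord_ring" "h - r \<in> val_ge v 1"
proof -
  obtain r s where h: "r \<in> coord_ring" "s \<in> coord_ring - center" "h = r / s"
    using integral_fraction[OF assms] .
  obtain p where "prime_over center p"
    by (rule center_over)
  then obtain s' where s': "s' \<in> coord_ring" "s * s' - 1 \<in> center"
    using prime_over.inverse_mod[OF _ h(2)] by blast
  \<comment> \<open>The factor \<open>s'\<close> inverts the denominator modulo the prime.\<close>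
  have "h - r * s' = - (h * (s * s' - 1))"
    using v_unit[OF h(2)] by (simp add: h field_simps)
  moreover have "- (h * (s * s' - 1)) \<in> val_ge v 1"
    using s' assms by (intro val_ge_minus val_ge_mult0) (auto simp: center_def)
  ultimately show ?thesis
    using that[of "r * s'"] h s' by simp
qed

end

lemma finite_place_ord_at: "fun_x \<in> val_ge (ord_at P) 0 \<Longrightarrow> finite_place (ord_at P)"
  using valuation_ord_at by (simp add: finite_place_def finite_place_axioms_def)

lemma finite_place_iff: "fun_x \<in> val_ge (ord_at P) 0 \<longleftrightarrow> P \<noteq> P_inf"
  using ord_at_fun_x_neg_iff[of P] by (auto simp: val_ge_def)

section \<open>Places over an irreducible polynomial\<close>

lemma curve_fun_eq_iff [simp]: "curve_fun a b = curve_fun a' b' \<longleftrightarrow> a = a' \<and> b = b'"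
  by (simp add: curve_fun_FF)

text \<open>The kernel of the map to \<open>F7[x] / (p)\<close> that sends \<open>y\<close> to the square root \<open>g\<close> of the
sextic; it covers both the rational points (\<open>p\<close> linear) and the ramification places (\<open>g = 0\<close>).\<close>

lemma root_ideal:
  assumes p: "irreducible p" and g: "p dvd sextic - g * g"
  shows "prime_over {curve_fun a b | a b. p dvd a + b * g} p" (is "prime_over ?m p")
proof -
  have mem: "curve_fun a b \<in> ?m \<longleftrightarrow> p dvd a + b * g" for a b
    by auto
  have mult: "p dvd (a * a' + sextic * (b * b')) + (a * b' + b * a') * g \<longleftrightarrow>
      p dvd (a + b * g) * (a' + b' * g)" for a b a' b'
  proof -
    have "(a * a' + sextic * (b * b')) + (a * b' + b * a') * g =
        (a + b * g) * (a' + b' * g) + (sextic - g * g) * (b * b')"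
      by (simp add: algebra_simps)
    then show ?thesis
      using g by (simp add: dvd_add_left_iff)
  qed
  show ?thesis
  proof
    show "?m \<subseteq> coord_ring"
      by auto
    show "0 \<in> ?m"
      using mem[of 0 0] by simp
    show "1 \<notin> ?m"
      using mem[of 1 0] p by (auto simp: irreducible_def)
    fix r s
    show "r + s \<in> ?m" if rs: "r \<in> ?m" "s \<in> ?m"
    proof -
      obtain a b a' b' where e: "r = curve_fun a b" "s = curve_fun a' b'"
        using rs by blast
      then have "p dvd a + b * g" "p dvd a' + b' * g"
        using rs mem by blast+
      then have "p dvd (a + b * g) + (a' + b' * g)"
        by (rule dvd_add)
      then have "p dvd (a + a') + (b + b') * g"
        by (simp add: algebra_simps)
      then show ?thesis
        by (simp only: e curve_fun_add mem)
    qed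
    show "r * s \<in> ?m" if rs: "r \<in> coord_ring" "s \<in> ?m"
    proof -
      obtain a b a' b' where e: "r = curve_fun a b" "s = curve_fun a' b'"
        using rs by (auto simp: coord_ring_def)
      then have "p dvd a' + b' * g"
        using rs mem by blast
      then show ?thesis
        by (simp only: e curve_fun_mult mem mult dvd_mult)
    qed
    show "r \<in> ?m \<or> s \<in> ?m" if rs: "r \<in> coord_ring" "s \<in> coord_ring" "r * s \<in> ?m"
    proof -
      obtain a b a' b' where e: "r = curve_fun a b" "s = curve_fun a' b'"
        using rs by (auto simp: coord_ring_def)
      show ?thesis
        using rs(3) by (simp only: e curve_fun_mult mem mult irreducible_dvd_mult_iff[OF p])
    qed
    show "irreducible p"
      by (rule p)
    show "of_poly p \<in> ?m"
      using mem[of p 0] by simp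
  qed
qed

text \<open>The ideal generated by \<open>p\<close> is prime when the sextic is not a square modulo \<open>p\<close>, because then
the norm form is anisotropic modulo \<open>p\<close>.\<close>

lemma inert_ideal:
  assumes p: "irreducible p" and nosq: "\<And>g. \<not> p dvd sextic - g * g"
  shows "prime_over {curve_fun a b | a b. p dvd a \<and> p dvd b} p" (is "prime_over ?m p")
proof -
  have mem: "curve_fun a b \<in> ?m \<longleftrightarrow> p dvd a \<and> p dvd b" for a b
    by auto
  have norm: "p dvd a \<and> p dvd b" if N: "p dvd norm_form a b" for a b
  proof -
    have "p dvd b"
    proof (rule ccontr)
      assume "\<not> p dvd b"
      then obtain u w where "u * p + w * b = 1"
        using irreducible_bezout[OF p] by blast
      then have w: "w * b = 1 - u * p"
        by (simp add: algebra_simps)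
      \<comment> \<open>If \<open>b\<close> has the inverse \<open>w\<close> modulo \<open>p\<close>, then \<open>(w a)^2\<close> is congruent to the sextic.\<close>
      have "sextic - (w * a) * (w * a) = sextic * (1 - (w * b) * (w * b)) - w * w * norm_form a b"
        by (simp add: norm_form_def algebra_simps)
      also have "1 - (w * b) * (w * b) = p * (u + u - u * p * u)"
        unfolding w by (simp add: algebra_simps)
      finally have "p dvd sextic - (w * a) * (w * a)"
        using N by simp
      then show False
        using nosq by blast
    qed
    then have "p dvd norm_form a b + sextic * (b * b)"
      using N by simp
    then have "p dvd a * a"
      by (simp add: norm_form_def)
    then show ?thesis
      using \<open>p dvd b\<close> irreducible_dvd_mult_iff[OF p] by blast
  qed
  show ?thesis
  proof
    show "?m \<subseteq> coord_ring"
      by auto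
    show "0 \<in> ?m"
      using mem[of 0 0] by simp
    show "1 \<notin> ?m"
      using mem[of 1 0] p by (auto simp: irreducible_def)
    fix r s
    show "r + s \<in> ?m" if rs: "r \<in> ?m" "s \<in> ?m"
    proof -
      obtain a b a' b' where e: "r = curve_fun a b" "s = curve_fun a' b'"
        using rs by blast
      then have "p dvd a" "p dvd b" "p dvd a'" "p dvd b'"
        using rs mem by blast+
      then show ?thesis
        by (simp only: e curve_fun_add mem dvd_add)
    qed
    show "r * s \<in> ?m" if rs: "r \<in> coord_ring" "s \<in> ?m"
    proof -
      obtain a b a' b' where e: "r = curve_fun a b" "s = curve_fun a' b'"
        using rs by (auto simp: coord_ring_def)
      then have "p dvd a'" "p dvd b'"
        using rs mem by blast+
      then show ?thesis
        by (simp only: e curve_fun_mult mem dvd_add dvd_mult)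
    qed
    show "r \<in> ?m \<or> s \<in> ?m" if rs: "r \<in> coord_ring" "s \<in> coord_ring" "r * s \<in> ?m"
    proof -
      obtain a b a' b' where e: "r = curve_fun a b" "s = curve_fun a' b'"
        using rs by (auto simp: coord_ring_def)
      define c where "c = a * a' + sextic * (b * b')"
      define d where "d = a * b' + b * a'"
      have "curve_fun c d \<in> ?m"
        using rs(3) by (simp only: e curve_fun_mult c_def d_def)
      then have "p dvd c" "p dvd d"
        by (simp_all only: mem)
      then have "p dvd norm_form c d"
        by (simp add: norm_form_def)
      also have "norm_form c d = norm_form a b * norm_form a' b'"
        by (simp add: c_def d_def norm_form_def algebra_simps)
      finally have "p dvd norm_form a b \<or> p dvd norm_form a' b'"
        using irreducible_dvd_mult_iff[OF p] by blast
      then have "(p dvd a \<and> p dvd b) \<or> (p dvd a' \<and> p dvd b')"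
        using norm by blast
      then show ?thesis
        by (simp only: e mem)
    qed
    show "irreducible p"
      by (rule p)
    show "of_poly p \<in> ?m"
      using mem[of p 0] by simp
  qed
qed

lemma fun_x_in_coord_ring: "fun_x \<in> coord_ring"
  by (simp add: fun_x_def)

lemma place_with_center:
  assumes "prime_over m p"
  obtains P where "fun_x \<in> val_ge (ord_at P) 0" "\<forall>r\<in>coord_ring. r \<in> val_ge (ord_at P) 1 \<longleftrightarrow> r \<in> m"
proof -
  obtain t where "local_parameter m t"
    using prime_over.local_parameter_exists[OF assms] .
  then show ?thesis
    using local_parameter.exists_place that fun_x_in_coord_ring by (metis subsetD)
qed

lemma place_over_irreducible:
  assumes "irreducible p"
  obtains P where "fun_x \<in> val_ge (ord_at P) 0" "of_poly p \<in> val_ge (ord_at P) 1"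
proof -
  obtain m where "prime_over m p"
    using root_ideal[OF assms] inert_ideal[OF assms] by blast
  then show ?thesis
    using place_with_center prime_over.over that of_poly_in_coord_ring by metis
qed

text \<open>The place over \<open>p\<close> at which \<open>y\<close> reduces to \<open>g\<close>; meaningful if \<open>g\<close> is a square root
of the sextic modulo \<open>p\<close>.\<close>

definition at_root :: "F7 poly \<Rightarrow> F7 poly \<Rightarrow> place \<Rightarrow> bool" where
  "at_root p g P \<longleftrightarrow> fun_x \<in> val_ge (ord_at P) 0 \<and> of_poly p \<in> val_ge (ord_at P) 1 \<and>
     fun_y - of_poly g \<in> val_ge (ord_at P) 1"

lemma curve_fun_at_root:
  assumes "irreducible p" "at_root p g P"
  shows "curve_fun a b - of_poly (a + b * g) \<in> val_ge (ord_at P) 1"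
    and "curve_fun a b \<in> val_ge (ord_at P) 1 \<longleftrightarrow> p dvd a + b * g"
proof -
  interpret finite_place "ord_at P"
    using assms(2) finite_place_ord_at by (simp add: at_root_def)
  have "curve_fun a b - of_poly (a + b * g) = of_poly b * (fun_y - of_poly g)"
    by (simp add: curve_fun_def algebra_simps)
  then show *: "curve_fun a b - of_poly (a + b * g) \<in> val_ge (ord_at P) 1"
    using assms(2) of_poly_integral by (simp add: at_root_def val_ge_mult0(1) del: of_poly_add of_poly_mult)
  interpret prime_over center p
    using assms by unfold_locales (auto simp: at_root_def center_def)
  have "curve_fun a b \<in> val_ge (ord_at P) 1 \<longleftrightarrow> of_poly (a + b * g) \<in> val_ge (ord_at P) 1"
    using val_ge_add[OF *, of "of_poly (a + b * g)"] val_ge_diff[OF _ *, of "curve_fun a b"]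
    by (auto simp del: of_poly_add of_poly_mult)
  also have "\<dots> \<longleftrightarrow> of_poly (a + b * g) \<in> center"
    by (simp add: center_def)
  finally show "curve_fun a b \<in> val_ge (ord_at P) 1 \<longleftrightarrow> p dvd a + b * g"
    by (simp only: of_poly_mem_iff)
qed

lemma at_root_ex1:
  assumes p: "irreducible p" and g: "p dvd sextic - g * g"
  shows "\<exists>!P. at_root p g P"
proof -
  let ?m = "{curve_fun a b | a b. p dvd a + b * g}"
  have m: "prime_over ?m p"
    by (rule root_ideal[OF assms])
  obtain P where P: "fun_x \<in> val_ge (ord_at P) 0"
    "\<forall>r\<in>coord_ring. r \<in> val_ge (ord_at P) 1 \<longleftrightarrow> r \<in> ?m"
    by (rule place_with_center[OF m])
  have "curve_fun p 0 \<in> ?m"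
    by (rule CollectI, rule exI[of _ p], rule exI[of _ 0]) simp
  moreover have "curve_fun (- g) 1 \<in> ?m"
    by (rule CollectI, rule exI[of _ "- g"], rule exI[of _ 1]) simp
  ultimately have "curve_fun p 0 \<in> val_ge (ord_at P) 1" "curve_fun (- g) 1 \<in> val_ge (ord_at P) 1"
    using P(2) curve_fun_in_coord_ring by blast+
  then have "at_root p g P"
    using P(1) by (simp add: at_root_def curve_fun_def)
  moreover have "Q = Q'" if "at_root p g Q" "at_root p g Q'" for Q Q'
  proof -
    obtain t where t: "local_parameter ?m t"
      using prime_over.local_parameter_exists[OF m] .
    have eq: "ord_at R = local_parameter.val ?m t" if R: "at_root p g R" for R
    proof -
      interpret finite_place "ord_at R"
        using R finite_place_ord_at by (simp add: at_root_def)
      have "center = ?m"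
        using curve_fun_at_root(2)[OF p R] by (auto simp: center_def coord_ring_def)
      then show ?thesis
        using v_eq_val t by simp
    qed
    show ?thesis
      using trans[OF eq[OF that(1)] eq[OF that(2), symmetric]] by (simp only: ord_at_inject)
  qed
  ultimately show ?thesis
    by blast
qed

lemma polys_below_degree:
  "finite {q :: F7 poly. q = 0 \<or> degree q < n} \<and> card {q :: F7 poly. q = 0 \<or> degree q < n} = 7 ^ n"
proof (induction n)
  case (Suc n)
  have "bij_betw (\<lambda>(a, q). pCons a q) (UNIV \<times> {q :: F7 poly. q = 0 \<or> degree q < n})
      {q. q = 0 \<or> degree q < Suc n}"
  proof (rule bij_betwI')
    fix q :: "F7 poly" assume q: "q \<in> {q. q = 0 \<or> degree q < Suc n}"
    obtain a q' where "q = pCons a q'"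
      by (rule pCons_cases)
    then show "\<exists>x\<in>UNIV \<times> {q. q = 0 \<or> degree q < n}. q = (\<lambda>(a, q). pCons a q) x"
      using q by (auto intro!: bexI[of _ "(a, q')"] split: if_splits)
  qed (auto split: if_splits)
  then show ?case
    using Suc bij_betw_finite bij_betw_same_card by (fastforce simp: card_cartesian_product CARD_seven)
qed simp

text \<open>The residue field is \<open>F7[x] / (p)\<close>, represented by the polynomials of degree below that of
\<open>p\<close>.\<close>

lemma place_degree_at_root:
  assumes p: "irreducible p" and P: "at_root p g P"
  shows "place_degree P = degree p"
proof -
  interpret finite_place "ord_at P"
    using P finite_place_ord_at by (simp add: at_root_def)
  have pn: "p \<noteq> 0"
    using p by auto
  let ?S = "{q. q = 0 \<or> degree q < degree p}"
  have mem: "of_poly q \<in> val_ge (ord_at P) 1 \<longleftrightarrow> p dvd q" for q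
    using curve_fun_at_root(2)[OF p P, of q 0] by simp
  have "transversal (val_ge (ord_at P) 0) (val_ge (ord_at P) 1) (of_poly ` ?S)"
    unfolding transversal_def
  proof (intro conjI ballI)
    show "finite (of_poly ` ?S)"
      using polys_below_degree by blast
    show "of_poly ` ?S \<subseteq> val_ge (ord_at P) 0"
      using of_poly_integral by blast
    fix h assume "h \<in> val_ge (ord_at P) 0"
    then obtain r where r: "r \<in> coord_ring" "h - r \<in> val_ge (ord_at P) 1"
      by (rule residue_in_coord_ring)
    then obtain a b where rab: "r = curve_fun a b"
      by (auto simp: coord_ring_def)
    define q where "q = (a + b * g) mod p"
    have "h - of_poly q = (h - r) + (r - of_poly (a + b * g)) + of_poly (a + b * g - q)"
      by simp
    also have "\<dots> \<in> val_ge (ord_at P) 1"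
    proof (intro val_ge_add)
      show "of_poly (a + b * g - q) \<in> val_ge (ord_at P) 1"
        unfolding mem q_def by (rule dvd_minus_mod)
    qed (use r curve_fun_at_root(1)[OF p P] rab in blast)+
    finally have q: "h - of_poly q \<in> val_ge (ord_at P) 1" .
    have qS: "q \<in> ?S"
      using degree_mod_less[OF pn] by (simp add: q_def)
    have "q1 = q2" if q12: "q1 \<in> ?S" "q2 \<in> ?S" "h - of_poly q1 \<in> val_ge (ord_at P) 1"
      "h - of_poly q2 \<in> val_ge (ord_at P) 1" for q1 q2
    proof -
      have "of_poly (q1 - q2) \<in> val_ge (ord_at P) 1"
        using val_ge_diff[OF q12(4,3)] by simp
      then have "p dvd q1 - q2"
        by (simp only: mem)
      moreover have "q1 - q2 = 0 \<or> degree (q1 - q2) < degree p"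
        using q12(1,2) degree_diff_less[of q1 "degree p" q2] by auto
      ultimately show ?thesis
        by (metis dvd_imp_degree_le eq_iff_diff_eq_0 not_le)
    qed
    then show "\<exists>!s. s \<in> of_poly ` ?S \<and> h - s \<in> val_ge (ord_at P) 1"
      using q qS by (intro ex1I[of _ "of_poly q"]) blast+
  qed
  moreover have "card (of_poly ` ?S) = 7 ^ degree p"
    using polys_below_degree[of "degree p"] by (subst card_image) (auto intro: inj_onI)
  ultimately show ?thesis
    using quotient_dim_transversal[OF val_ge_subspace val_ge_subspace] by (simp add: place_degree_alt)
qed

context finite_place
begin

text \<open>The degree of a place is given by a definite description, so a statement such as
\<open>place_degree P = 1\<close> carries information only once a basis of the residue field is known to exist.\<close>

lemma residue_basis_exists: obtains B where "basis_modulo (val_ge v 0) (val_ge v 1) B"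
proof -
  obtain p where "prime_over center p"
    by (rule center_over)
  then interpret prime_over center p .
  let ?S = "{q. q = 0 \<or> degree q < degree p}"
  let ?T = "(\<lambda>(a, b). curve_fun a b) ` (?S \<times> ?S)"
  have pn: "p \<noteq> 0"
    using irred by auto
  show ?thesis
  proof (rule basis_modulo_exists[OF val_ge_subspace val_ge_subspace])
    show "finite ?T"
      using polys_below_degree by (intro finite_imageI finite_cartesian_product) blast+
    show "?T \<subseteq> val_ge v 0"
      using coord_ring_integral by auto
    fix h assume "h \<in> val_ge v 0"
    then obtain r where r: "r \<in> coord_ring" "h - r \<in> val_ge v 1"
      by (rule residue_in_coord_ring)
    then obtain a b where rab: "r = curve_fun a b"
      by (auto simp: coord_ring_def)
    let ?s = "curve_fun (a mod p) (b mod p)"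
    have "h - ?s = (h - r) + of_poly (a - a mod p) + of_poly (b - b mod p) * fun_y"
      by (simp add: rab curve_fun_def algebra_simps)
    also have "of_poly (a - a mod p) \<in> val_ge v 1" "of_poly (b - b mod p) \<in> val_ge v 1"
      using of_poly_mem_iff[of "a - a mod p"] of_poly_mem_iff[of "b - b mod p"]
      by (simp_all add: center_def dvd_minus_mod del: of_poly_diff)
    then have "(h - r) + of_poly (a - a mod p) + of_poly (b - b mod p) * fun_y \<in> val_ge v 1"
      using r(2) fun_y_integral by (intro val_ge_add val_ge_mult0(2))
    finally have "h - ?s \<in> val_ge v 1" .
    moreover have "a mod p \<in> ?S" "b mod p \<in> ?S"
      using degree_mod_less[OF pn] by simp_all
    then have "?s \<in> ?T"
      by (intro image_eqI[of _ _ "(a mod p, b mod p)"]) simp_all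
    ultimately show "\<exists>s\<in>?T. h - s \<in> val_ge v 1"
      by blast
  qed (rule that)
qed

lemma degree_one_imp_constant_residue:
  assumes "quotient_dim (val_ge v 0) (val_ge v 1) = 1" and h: "h \<in> val_ge v 0"
  obtains c where "h - of_poly [:c:] \<in> val_ge v 1"
proof -
  obtain B where B: "basis_modulo (val_ge v 0) (val_ge v 1) B"
    by (rule residue_basis_exists)
  then have "card B = 1"
    using quotient_dim_basis[OF val_ge_subspace val_ge_subspace B] assms by simp
  then obtain b where b: "B = {b}"
    by (rule card_1_singletonE)
  have ex: "\<exists>c. f - of_poly [:c:] * b \<in> val_ge v 1" if "f \<in> val_ge v 0" for f
    using B that unfolding basis_modulo_alt comb_def b by auto
  obtain c1 where c1: "1 - of_poly [:c1:] * b \<in> val_ge v 1"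
    using ex[of 1] val_ge_const[of 0 1] by auto
  obtain c where c: "h - of_poly [:c:] * b \<in> val_ge v 1"
    using ex[OF h] by blast
  have "c1 \<noteq> 0"
    using c1 by (auto simp: val_ge_iff)
  then have "[:c:] = [:c / c1:] * [:c1:]"
    by simp
  then have "of_poly [:c:] = of_poly [:c / c1:] * of_poly [:c1:]"
    by (simp only: of_poly_mult)
  then have "h - of_poly [:c / c1:] =
      (h - of_poly [:c:] * b) - of_poly [:c / c1:] * (1 - of_poly [:c1:] * b)"
    by (simp add: algebra_simps)
  also have "\<dots> \<in> val_ge v 1"
    by (rule val_ge_diff[OF c val_ge_mult0(1)[OF val_ge_const c1]]) simp
  finally show ?thesis
    by (rule that)
qed

end

section \<open>Differentiation with respect to \<open>x\<close>\<close>

text \<open>The quotient rule, applied to some representation of the fraction; \<open>fract_deriv_Fract\<close> shows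
that the result does not depend on the choice.\<close>

definition fract_deriv :: "F7 poly fract \<Rightarrow> F7 poly fract" where
  "fract_deriv z = (SOME w. \<exists>p q. q \<noteq> 0 \<and> z = Fract p q \<and>
     w = Fract (pderiv p * q - p * pderiv q) (q * q))"

lemma fract_deriv_Fract:
  assumes "q \<noteq> 0"
  shows "fract_deriv (Fract p q) = Fract (pderiv p * q - p * pderiv q) (q * q)"
  unfolding fract_deriv_def
proof (rule some_equality)
  show "\<exists>p' q'. q' \<noteq> 0 \<and> Fract p q = Fract p' q' \<and>
      Fract (pderiv p * q - p * pderiv q) (q * q) = Fract (pderiv p' * q' - p' * pderiv q') (q' * q')"
    using assms by blast
  fix w assume "\<exists>p' q'. q' \<noteq> 0 \<and> Fract p q = Fract p' q' \<and>
      w = Fract (pderiv p' * q' - p' * pderiv q') (q' * q')"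
  then obtain p' q' where q': "q' \<noteq> 0" "Fract p q = Fract p' q'"
    and w: "w = Fract (pderiv p' * q' - p' * pderiv q') (q' * q')"
    by blast
  have e: "p * q' = p' * q"
    using q' assms by (simp add: eq_fract)
  have "pderiv (p * q') = pderiv (p' * q)"
    by (simp only: e)
  then have e': "p * pderiv q' + q' * pderiv p = p' * pderiv q + q * pderiv p'"
    by (simp only: pderiv_mult)
  have "(pderiv p' * q' - p' * pderiv q') * (q * q) = (pderiv p * q - p * pderiv q) * (q' * q')"
  proof -
    have "q * q' * (p * pderiv q' + q' * pderiv p) = q * q' * (p' * pderiv q + q * pderiv p')"
      by (simp only: e')
    then have "(p * q') * (q * pderiv q') + q * q' * q' * pderiv p =
        (p' * q) * (q' * pderiv q) + q * q * q' * pderiv p'"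
      by (simp add: algebra_simps)
    then have "(p' * q) * (q * pderiv q') + q * q' * q' * pderiv p =
        (p * q') * (q' * pderiv q) + q * q * q' * pderiv p'"
      unfolding e .
    then show ?thesis
      by (simp add: algebra_simps)
  qed
  then show "w = Fract (pderiv p * q - p * pderiv q) (q * q)"
    using assms q' by (simp add: w eq_fract)
qed

lemma fract_deriv_add: "fract_deriv (a + b) = fract_deriv a + fract_deriv b"
proof -
  obtain p q r where "a = Fract p r" "b = Fract q r" "r \<noteq> 0"
    by (rule common_denominator)
  then show ?thesis
    by (simp add: fract_deriv_Fract pderiv_add pderiv_mult eq_fract algebra_simps)
qed

lemma fract_deriv_mult: "fract_deriv (a * b) = a * fract_deriv b + b * fract_deriv a"
proof -
  obtain p q r where "a = Fract p r" "b = Fract q r" "r \<noteq> 0"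
    by (rule common_denominator)
  then show ?thesis
    by (simp add: fract_deriv_Fract pderiv_mult eq_fract algebra_simps)
qed

lemma fract_deriv_to_fract: "fract_deriv (to_fract p) = to_fract (pderiv p)"
  using fract_deriv_Fract[of 1 p] by (simp add: to_fract_def)

text \<open>Differentiating \<open>y^2 = sextic\<close> forces \<open>y' = sextic' / (2 * sextic) * y\<close>, which explains the extra
term in the coefficient of \<open>y\<close>.\<close>

definition ff_deriv :: "funfield \<Rightarrow> funfield" where
  "ff_deriv h = FF (fract_deriv (part_1 h))
     (fract_deriv (part_y h) + part_y h * (to_fract (pderiv sextic) / to_fract ([:2:] * sextic)))"

lemma derivation_ff_deriv: "derivation ff_deriv"
  unfolding derivation_def
proof (intro conjI allI)
  fix g h :: funfield and c :: F7
  show "ff_deriv (g + h) = ff_deriv g + ff_deriv h"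
    by (simp add: ff_deriv_def plus_funfield_def fract_deriv_add algebra_simps add_divide_distrib)
  show "ff_deriv (of_poly [:c:]) = 0"
    using fract_deriv_to_fract[of 0]
    by (simp add: ff_deriv_def of_poly_def zero_funfield_def fract_deriv_to_fract pderiv_pCons)
  define F where "F = to_fract sextic"
  define L where "L = to_fract (pderiv sextic) / to_fract ([:2:] * sextic)"
  have nz: "to_fract [:2:] \<noteq> (0 :: F7 poly fract)" "F \<noteq> 0"
    using F7_two_nonzero sextic_nonzero by (simp_all add: F_def)
  have two: "to_fract [:2 :: F7:] = 1 + 1"
  proof -
    have "[:2 :: F7:] = 1 + 1"
      by (simp add: one_pCons)
    then show ?thesis
      by (simp only: to_fract_add to_fract_1)
  qed
  have "to_fract ([:2:] * sextic) = to_fract [:2:] * F"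
    by (simp only: to_fract_mult F_def)
  then have "L = to_fract (pderiv sextic) / (to_fract [:2:] * F)"
    by (simp only: L_def)
  then have "to_fract (pderiv sextic) = to_fract [:2:] * F * L"
    using nz by simp
  then have F': "fract_deriv F = F * L + F * L"
    unfolding two by (simp add: F_def fract_deriv_to_fract algebra_simps)
  have ff: "ff_deriv h = FF (fract_deriv (part_1 h)) (fract_deriv (part_y h) + part_y h * L)" for h
    by (simp only: ff_deriv_def L_def)
  show "ff_deriv (g * h) = g * ff_deriv h + h * ff_deriv g"
    unfolding ff times_funfield_def plus_funfield_def F_def[symmetric]
    by (simp add: fract_deriv_add fract_deriv_mult F' algebra_simps)
qed

lemma ff_deriv_fun_x: "ff_deriv fun_x = 1"
  using fract_deriv_to_fract[of 0]
  by (simp add: ff_deriv_def fun_x_def of_poly_def one_funfield_def fract_deriv_to_fract pderiv_pCons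
      flip: one_pCons)

locale x_derivation =
  fixes d :: "funfield \<Rightarrow> funfield"
  assumes derivation: "derivation d" and d_fun_x: "d fun_x = 1"
begin

lemma d_add: "d (g + h) = d g + d h"
  and d_mult: "d (g * h) = g * d h + h * d g"
  and d_const: "d (of_poly [:c:]) = 0"
  using derivation by (auto simp: derivation_def)

lemma d_0: "d 0 = 0" and d_1: "d 1 = 0"
  using d_const[of 0] d_const[of 1] by simp_all

lemma d_minus: "d (- h) = - d h"
  using d_add[of h "- h"] d_0 by (simp add: eq_neg_iff_add_eq_0 add.commute)

lemma d_diff: "d (g - h) = d g - d h"
  using d_add[of g "- h"] by (simp add: d_minus)

lemma d_of_poly: "d (of_poly p) = of_poly (pderiv p)"
proof (induction p)
  case (pCons a p)
  have "d (of_poly (pCons a p)) = fun_x * d (of_poly p) + of_poly p"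
    by (simp add: of_poly_pCons[of a p] d_add d_mult d_const d_fun_x)
  also have "\<dots> = of_poly (pderiv (pCons a p))"
    by (simp add: pCons.IH pderiv_pCons of_poly_pCons[of 0 "pderiv p"])
  finally show ?case .
qed (simp add: d_0)

lemma two_nonzero: "(2 :: funfield) \<noteq> 0"
  using F7_two_nonzero of_poly_2 by (metis of_poly_eq_0_iff pCons_eq_0_iff)

lemma d_fun_y: "d fun_y = of_poly (pderiv sextic) / (2 * fun_y)"
proof -
  have "fun_y * d fun_y + fun_y * d fun_y = of_poly (pderiv sextic)"
    using d_mult[of fun_y fun_y] fun_y_square d_of_poly[of sextic] by (simp add: power2_eq_square)
  then have "d fun_y * (2 * fun_y) = of_poly (pderiv sextic)"
    by (simp add: algebra_simps)
  then show ?thesis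
    using two_nonzero by (simp add: nonzero_eq_divide_eq)
qed

lemma d_divide:
  assumes "g \<noteq> 0"
  shows "d (h / g) = (d h * g - h * d g) / (g * g)"
proof -
  have "d h = d (h / g * g)"
    using assms by simp
  also have "\<dots> = h / g * d g + g * d (h / g)"
    by (rule d_mult)
  finally show ?thesis
    using assms by (simp add: field_simps)
qed

lemma d_curve_fun:
  "d (curve_fun p q) = of_poly (pderiv p) + of_poly (pderiv q) * fun_y + of_poly q * d fun_y"
  by (simp add: curve_fun_def d_add d_mult d_of_poly algebra_simps)

end

lemma x_derivation_unique:
  assumes "x_derivation d" "x_derivation d'"
  shows "d = d'"
proof
  fix h
  interpret d: x_derivation d by fact
  interpret d': x_derivation d' by fact
  obtain p q r where "r \<noteq> 0" "h = curve_fun p q / of_poly r"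
    by (rule funfield_fraction)
  then show "d h = d' h"
    by (simp add: d.d_divide d'.d_divide d.d_of_poly d'.d_of_poly d.d_curve_fun d'.d_curve_fun
        d.d_fun_y d'.d_fun_y)
qed

interpretation d_dx: x_derivation d_dx
proof -
  have "\<exists>!d. derivation d \<and> d fun_x = 1"
    using derivation_ff_deriv ff_deriv_fun_x x_derivation_unique unfolding x_derivation_def by blast
  then have "derivation d_dx \<and> d_dx fun_x = 1"
    unfolding d_dx_def by (rule theI')
  then show "x_derivation d_dx"
    by (simp add: x_derivation_def)
qed

section \<open>The divisor of a differential\<close>

context valuation
begin

lemma val_ge_inverse: "v h \<le> - n \<Longrightarrow> inverse h \<in> val_ge v n"
  unfolding val_ge_def by auto

lemma v_2: "v 2 = 0"
  using v_const[OF F7_two_nonzero] by simp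

text \<open>If \<open>f d/dx\<close> maps the valuation ring into itself and one uniformiser \<open>t\<close> to a unit, then it
maps every uniformiser \<open>s = t u\<close> to \<open>u\<close> times that unit plus a multiple of \<open>t\<close>, again a
unit.  So the choice of uniformiser in the divisor of a differential does not matter.\<close>

lemma v_d_dx_uniformizer:
  assumes f: "f \<noteq> 0" and preserved: "\<And>h. h \<in> val_ge v 0 \<Longrightarrow> f * d_dx h \<in> val_ge v 0"
    and t: "v t = 1" "f * d_dx t \<notin> val_ge v 1" and s: "v s = 1"
  shows "d_dx s \<noteq> 0 \<and> v (d_dx s) = - v f"
proof -
  have nz: "t \<noteq> 0" "s \<noteq> 0"
    using t s by auto
  define u where "u = s / t"
  have u: "u \<noteq> 0" "v u = 0" "s = t * u"
    using nz t s by (simp_all add: u_def v_divide)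
  have "v (u * (f * d_dx t)) = 0" "u * (f * d_dx t) \<noteq> 0"
    using preserved[of t] t nz u v_mult[of u "f * d_dx t"] by (auto simp: val_ge_def)
  moreover have "f * d_dx u \<in> val_ge v 0" "t \<in> val_ge v 1"
    using preserved[of u] u t by (simp_all add: val_ge_def)
  then have "t * (f * d_dx u) \<in> val_ge v 1"
    using val_ge_mult0(2) by blast
  ultimately have "v (u * (f * d_dx t) + t * (f * d_dx u)) = 0 \<and> u * (f * d_dx t) + t * (f * d_dx u) \<noteq> 0"
    using v_add_strict[of "u * (f * d_dx t)" "t * (f * d_dx u)"] by (cases "t * (f * d_dx u) = 0") (auto simp: val_ge_def)
  moreover have "u * (f * d_dx t) + t * (f * d_dx u) = f * d_dx s"
    by (simp add: u(3) d_dx.d_mult algebra_simps)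
  ultimately have "v (f * d_dx s) = 0" "d_dx s \<noteq> 0"
    by auto
  then show ?thesis
    using v_mult[OF f] by simp
qed

end

context finite_place
begin

text \<open>It suffices to control the derivative of \<open>y\<close>: the coordinate ring is generated by \<open>x\<close> and
\<open>y\<close>, and the quotient rule extends the bound to fractions with unit denominator.\<close>

lemma preserves_integral:
  assumes f: "f \<in> val_ge v 0" and fy: "f * d_dx fun_y \<in> val_ge v 0" and h: "h \<in> val_ge v 0"
  shows "f * d_dx h \<in> val_ge v 0"
proof -
  obtain r s where r: "r \<in> coord_ring" and s: "s \<in> coord_ring - center" and h: "h = r / s"
    using integral_fraction[OF h] .
  have ring: "f * d_dx r \<in> val_ge v 0" if rR: "r \<in> coord_ring" for r
  proof -
    obtain p q where "r = curve_fun p q"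
      using rR by (auto simp: coord_ring_def)
    then have "f * d_dx r = f * (of_poly (pderiv p) + of_poly (pderiv q) * fun_y) + of_poly q * (f * d_dx fun_y)"
      by (simp add: d_dx.d_curve_fun algebra_simps)
    also have "\<dots> \<in> val_ge v 0"
      by (intro val_ge_add val_ge_mult0(1) f fy of_poly_integral fun_y_integral)
    finally show ?thesis .
  qed
  have snz: "s \<noteq> 0" "v s = 0"
    using v_unit[OF s] by auto
  have "f * d_dx h = (f * d_dx r * s - r * (f * d_dx s)) * inverse (s * s)"
    using snz by (simp add: h d_dx.d_divide field_simps)
  also have "\<dots> \<in> val_ge v 0"
  proof (intro val_ge_mult0(1)[of _ "inverse (s * s)"] val_ge_diff)
    show "inverse (s * s) \<in> val_ge v 0"
      using snz by (intro val_ge_inverse) (simp add: v_mult)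
    have sR: "s \<in> coord_ring"
      using s by simp
    then have "r \<in> val_ge v 0" "s \<in> val_ge v 0"
      using r coord_ring_integral by auto
    then show "f * d_dx r * s \<in> val_ge v 0" "r * (f * d_dx s) \<in> val_ge v 0"
      using ring[OF r] ring[OF sR] val_ge_mult0(1) by blast+
  qed
  finally show ?thesis .
qed

lemma v_fun_y_unramified:
  assumes "of_poly sextic \<notin> center"
  shows "v fun_y = 0"
  using v_unit[of fun_y] assms center.fun_y_mem_iff by simp

lemma v_fun_y_ramified:
  assumes "of_poly sextic \<in> center"
  shows "v fun_y = 1"
proof -
  obtain p where "prime_over center p"
    by (rule center_over)
  then show ?thesis
    using prime_over.ramified[OF _ assms] v_parameter by blast
qed

text \<open>Away from the ramification the factor is \<open>1\<close> and the uniformiser is the irreducible polynomial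
\<open>p\<close> below the place, whose derivative is a unit by separability.  At a ramification place the
factor is \<open>y\<close> and the uniformiser is \<open>y\<close>, with \<open>y y' = sextic' / 2\<close> a unit.\<close>

lemma v_d_dx_finite:
  assumes "v s = 1"
  shows "d_dx s \<noteq> 0 \<and> v (d_dx s) = - v fun_y"
proof (cases "of_poly sextic \<in> center")
  case False
  then have y: "v fun_y = 0"
    by (rule v_fun_y_unramified)
  obtain p where "prime_over center p"
    by (rule center_over)
  then interpret prime_over center p .
  have "v (of_poly p) = 1"
    using unramified[OF False] v_parameter by blast
  moreover have "of_poly (pderiv p) \<notin> center"
    using of_poly_mem_iff irreducible_not_dvd_pderiv irred by blast
  then have "1 * d_dx (of_poly p) \<notin> val_ge v 1"
    by (simp add: d_dx.d_of_poly center_def)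
  moreover have "1 * d_dx h \<in> val_ge v 0" if "h \<in> val_ge v 0" for h
  proof (rule preserves_integral[OF _ _ that])
    have "1 * d_dx fun_y = of_poly (pderiv sextic) * inverse (2 * fun_y)"
      by (simp only: mult_1 d_dx.d_fun_y field_class.field_divide_inverse)
    also have "\<dots> \<in> val_ge v 0"
      using y d_dx.two_nonzero by (intro val_ge_mult0(1) of_poly_integral val_ge_inverse) (simp add: v_mult v_2)
    finally show "1 * d_dx fun_y \<in> val_ge v 0" .
  qed (simp add: val_ge_def)
  ultimately have "d_dx s \<noteq> 0 \<and> v (d_dx s) = - v 1"
    using assms by (intro v_d_dx_uniformizer) auto
  then show ?thesis
    by (simp add: y)
next
  case True
  then have y: "v fun_y = 1"
    by (rule v_fun_y_ramified)
  have yd: "fun_y * d_dx fun_y = of_poly (pderiv sextic) * inverse 2"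
    by (simp add: d_dx.d_fun_y field_simps)
  have "of_poly (pderiv sextic) \<notin> val_ge v 1"
  proof
    assume "of_poly (pderiv sextic) \<in> val_ge v 1"
    then have "of_poly (sextic + [:1, 1:] * pderiv sextic) \<in> val_ge v 1"
      unfolding of_poly_add of_poly_mult using True
      by (intro val_ge_add val_ge_mult0(1) of_poly_integral) (simp_all add: center_def)
    then have "2 \<in> val_ge v 1"
      by (simp only: sextic_separable of_poly_2)
    then show False
      using d_dx.two_nonzero v_2 by (simp add: val_ge_def)
  qed
  moreover have "of_poly (pderiv sextic) = 2 * (of_poly (pderiv sextic) * inverse 2)"
    using d_dx.two_nonzero by simp
  moreover have "2 \<in> val_ge v 0"
    by (simp add: val_ge_def v_2)
  ultimately have "of_poly (pderiv sextic) * inverse 2 \<notin> val_ge v 1"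
    using val_ge_mult0(1) by metis
  moreover have "of_poly (pderiv sextic) * inverse 2 \<in> val_ge v 0"
    by (intro val_ge_mult0(1) of_poly_integral val_ge_inverse) (simp add: v_2)
  ultimately show ?thesis
    using preserves_integral[OF fun_y_integral] y assms
    by (intro v_d_dx_uniformizer[where t = fun_y]) (auto simp: yd)
qed

end

text \<open>Differentiation lowers degrees of polynomials, and the product and quotient rules propagate this.\<close>

lemma d_dx_at_infinity:
  assumes "h \<in> val_ge val_inf n"
  shows "d_dx h \<in> val_ge val_inf (n + 1)"
proof (cases "h = 0")
  case True
  then show ?thesis
    by (simp add: d_dx.d_0)
next
  case False
  have poly: "d_dx (of_poly p) \<in> val_ge val_inf (k + 1)" if "of_poly p \<in> val_ge val_inf k" for p k
  proof (cases "pderiv p = 0")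
    case False
    have "degree p \<noteq> 0"
      using False by (metis degree_eq_zeroE pderiv_singleton)
    then have "p \<noteq> 0" "degree (pderiv p) < degree p"
      using degree_pderiv_le[of p] by auto
    then show ?thesis
      using that False by (simp add: d_dx.d_of_poly val_inf.val_ge_iff val_inf_of_poly)
  qed (simp add: d_dx.d_of_poly)
  have mult: "d_dx (f * g) \<in> val_ge val_inf (k + l + 1)"
    if "f \<in> val_ge val_inf k" "d_dx f \<in> val_ge val_inf (k + 1)" "g \<in> val_ge val_inf l" "d_dx g \<in> val_ge val_inf (l + 1)"
    for f g k l
    using val_inf.val_ge_add[OF val_inf.val_ge_mono[OF val_inf.val_ge_mult[OF that(1,4)], of "k + l + 1"]
        val_inf.val_ge_mono[OF val_inf.val_ge_mult[OF that(3,2)], of "k + l + 1"]]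
    by (simp add: d_dx.d_mult)
  have y: "fun_y \<in> val_ge val_inf (- 3)" "d_dx fun_y \<in> val_ge val_inf (- 3 + 1)"
  proof -
    show "fun_y \<in> val_ge val_inf (- 3)"
      by (simp add: val_ge_def val_inf_fun_y)
    have "of_poly (pderiv sextic) \<in> val_ge val_inf (- 6 + 1)"
      using poly[of sextic "- 6"] sextic_nonzero
      by (simp add: d_dx.d_of_poly val_inf.val_ge_iff val_inf_of_poly degree_sextic)
    moreover have "inverse (2 * fun_y) \<in> val_ge val_inf 3"
      using d_dx.two_nonzero by (intro val_inf.val_ge_inverse) (simp add: val_inf.v_mult val_inf.v_2 val_inf_fun_y)
    ultimately have "of_poly (pderiv sextic) * inverse (2 * fun_y) \<in> val_ge val_inf (- 6 + 1 + 3)"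
      by (rule val_inf.val_ge_mult)
    then have "d_dx fun_y \<in> val_ge val_inf (- 6 + 1 + 3)"
      by (simp only: d_dx.d_fun_y field_class.field_divide_inverse)
    then show "d_dx fun_y \<in> val_ge val_inf (- 3 + 1)"
      by simp
  qed
  obtain p q r where r: "r \<noteq> 0" and hpq: "h = curve_fun p q / of_poly r"
    by (rule funfield_fraction)
  define k where "k = int (pole_deg p q)"
  have pq: "p \<noteq> 0 \<or> q \<noteq> 0"
    using False by (auto simp: hpq)
  have n: "n \<le> int (degree r) - k"
    using assms False r pq by (simp add: val_inf.val_ge_iff)
      (simp add: hpq val_inf.v_divide val_inf_curve_fun val_inf_of_poly k_def)
  have c: "curve_fun p q \<in> val_ge val_inf (- k)"
    using pq by (simp add: val_ge_def val_inf_curve_fun k_def)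
  have dp: "d_dx (of_poly p) \<in> val_ge val_inf (- k + 1)"
    using poly[of p "- k"] by (cases "p = 0") (simp_all add: val_inf.val_ge_iff val_inf_of_poly k_def pole_deg_def d_dx.d_0)
  have "of_poly q \<in> val_ge val_inf (- k + 3)"
    by (cases "q = 0") (simp_all add: val_inf.val_ge_iff val_inf_of_poly k_def pole_deg_def)
  then have "d_dx (of_poly q * fun_y) \<in> val_ge val_inf (- k + 1)"
    using mult[OF _ poly y] by fastforce
  with dp have dc: "d_dx (curve_fun p q) \<in> val_ge val_inf (- k + 1)"
    unfolding curve_fun_def d_dx.d_add by (rule val_inf.val_ge_add)
  have rr: "of_poly r \<in> val_ge val_inf (- int (degree r))"
    using r by (simp add: val_ge_def val_inf_of_poly)
  have "d_dx (curve_fun p q) * of_poly r \<in> val_ge val_inf (- k + 1 - int (degree r))"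
    "curve_fun p q * d_dx (of_poly r) \<in> val_ge val_inf (- k + 1 - int (degree r))"
    using val_inf.val_ge_mult[OF dc rr] val_inf.val_ge_mult[OF c poly[OF rr]] by (simp_all add: algebra_simps)
  then have "d_dx (curve_fun p q) * of_poly r - curve_fun p q * d_dx (of_poly r)
      \<in> val_ge val_inf (- k + 1 - int (degree r))"
    by (rule val_inf.val_ge_diff)
  moreover have "inverse (of_poly r * of_poly r) \<in> val_ge val_inf (2 * int (degree r))"
    using r by (intro val_inf.val_ge_inverse) (simp add: val_inf.v_mult val_inf_of_poly)
  ultimately have "(d_dx (curve_fun p q) * of_poly r - curve_fun p q * d_dx (of_poly r)) *
      inverse (of_poly r * of_poly r) \<in> val_ge val_inf (- k + 1 - int (degree r) + 2 * int (degree r))"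
    by (rule val_inf.val_ge_mult)
  moreover have "d_dx h = (d_dx (curve_fun p q) * of_poly r - curve_fun p q * d_dx (of_poly r)) *
      inverse (of_poly r * of_poly r)"
    using r unfolding hpq by (subst d_dx.d_divide) (auto simp only: of_poly_eq_0_iff field_class.field_divide_inverse)
  ultimately have "d_dx h \<in> val_ge val_inf (- k + 1 - int (degree r) + 2 * int (degree r))"
    by (simp only:)
  then show ?thesis
    by (rule val_inf.val_ge_mono) (use n in simp)
qed

text \<open>The bound from degrees alone would be \<open>1\<close>; the leading terms in the numerator cancel because
\<open>w_inf\<close> has a finite value at infinity.\<close>

lemma d_dx_w_inf: "d_dx w_inf \<in> val_ge val_inf 2"
proof -
  \<comment> \<open>Here \<open>g\<close> is the numerator \<open>x f' - 6 f\<close> of the derivative of \<open>f / x^6\<close>, where \<open>f\<close> is the sextic;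
    its coefficients at \<open>x^6\<close> cancel.\<close>
  define g where "g = pderiv sextic * [:0, 1:] - [:6:] * sextic"
  have g: "g = [:1, 2, 4, 4, 2, 6:]"
    unfolding g_def sextic_def by (simp add: pderiv_pCons) (simp add: F7_numeral_reduce)
  have gnz: "g \<noteq> 0" "degree g \<le> 5"
    by (simp_all add: g)
  have x3: "d_dx (fun_x ^ 3) = 3 * fun_x ^ 2"
    by (simp add: eval_nat_numeral d_dx.d_mult d_dx.d_fun_x algebra_simps)
  have dy: "d_dx fun_y * (2 * fun_y) = of_poly (pderiv sextic)"
    using d_dx.two_nonzero by (simp add: d_dx.d_fun_y)
  have "d_dx w_inf = (d_dx fun_y * fun_x ^ 3 - fun_y * (3 * fun_x ^ 2)) / (fun_x ^ 3 * fun_x ^ 3)"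
    by (simp add: w_inf_def d_dx.d_divide x3)
  moreover have "(A * fun_x ^ 3 - fun_y * (3 * fun_x ^ 2)) / (fun_x ^ 3 * fun_x ^ 3) * (2 * fun_y * fun_x ^ 4) =
      (A * (2 * fun_y)) * fun_x - 6 * (fun_y * fun_y)" for A
    by (simp add: field_simps eval_nat_numeral)
  ultimately have "d_dx w_inf * (2 * fun_y * fun_x ^ 4) =
      (d_dx fun_y * (2 * fun_y)) * fun_x - 6 * (fun_y * fun_y)"
    by (simp only:)
  also have "\<dots> = of_poly g"
  proof -
    have "of_poly [:6:] = 6"
      by (metis numeral_poly of_poly_numeral)
    then show ?thesis
      using fun_y_square unfolding dy g_def of_poly_diff of_poly_mult by (simp add: power2_eq_square fun_x_def)
  qed
  finally have "d_dx w_inf = of_poly g * inverse (2 * fun_y * fun_x ^ 4)"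
    using d_dx.two_nonzero by (simp add: field_simps)
  also have "\<dots> \<in> val_ge val_inf (- 5 + 7)"
  proof (rule val_inf.val_ge_mult)
    show "of_poly g \<in> val_ge val_inf (- 5)"
      using gnz by (simp add: val_ge_def val_inf_of_poly)
    show "inverse (2 * fun_y * fun_x ^ 4) \<in> val_ge val_inf 7"
      using d_dx.two_nonzero by (intro val_inf.val_ge_inverse) (simp add: val_inf.v_mult val_inf.v_2 val_inf.v_power val_inf_fun_x val_inf_fun_y)
  qed
  finally show ?thesis
    by simp
qed

text \<open>With \<open>f = x^2\<close> and \<open>t = 1 / x\<close>.  Subtracting from an integral function its residue
\<open>a + b w_inf\<close> leaves a function that vanishes at infinity, so both parts have derivatives that
vanish to order \<open>2\<close>.\<close>

lemma v_d_dx_infinity: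
  assumes "val_inf s = 1"
  shows "d_dx s \<noteq> 0 \<and> val_inf (d_dx s) = 2"
proof -
  have "fun_x ^ 2 * d_dx h \<in> val_ge val_inf 0" if h: "h \<in> val_ge val_inf 0" for h
  proof -
    obtain a b where ab: "h - (of_poly [:a:] + of_poly [:b:] * w_inf) \<in> val_ge val_inf 1"
      using residue_at_infinity[OF h] .
    have "d_dx h = d_dx (h - (of_poly [:a:] + of_poly [:b:] * w_inf)) + of_poly [:b:] * d_dx w_inf"
      by (simp add: d_dx.d_add d_dx.d_diff d_dx.d_mult d_dx.d_const)
    also have "\<dots> \<in> val_ge val_inf 2"
      using d_dx_at_infinity[OF ab] d_dx_w_inf by (intro val_inf.val_ge_add val_inf.val_ge_mult0(1)) auto
    finally have "fun_x ^ 2 * d_dx h \<in> val_ge val_inf (- 2 + 2)"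
      by (intro val_inf.val_ge_mult) (simp_all add: val_ge_def val_inf.v_power val_inf_fun_x)
    then show ?thesis
      by simp
  qed
  moreover have "fun_x ^ 2 * d_dx (1 / fun_x) = - 1"
    by (simp add: d_dx.d_divide d_dx.d_1 d_dx.d_fun_x power2_eq_square)
  moreover have "val_inf (1 / fun_x) = 1"
    by (simp add: val_inf.v_divide val_inf_fun_x)
  ultimately have "d_dx s \<noteq> 0 \<and> val_inf (d_dx s) = - val_inf (fun_x ^ 2)"
    using assms by (intro val_inf.v_d_dx_uniformizer[where t = "1 / fun_x"]) (auto simp: val_inf.val_ge_iff)
  then show ?thesis
    by (simp add: val_inf.v_power val_inf_fun_x)
qed

lemma ord_at_d_dx:
  assumes "ord_at P s = 1"
  shows "d_dx s \<noteq> 0 \<and> ord_at P (d_dx s) = - D_inf P - ord_at P fun_y"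
proof (cases "P = P_inf")
  case True
  then show ?thesis
    using v_d_dx_infinity assms by (simp add: D_inf_eq ord_at_P_inf val_inf_fun_y)
next
  case False
  then show ?thesis
    using finite_place.v_d_dx_finite[OF finite_place_ord_at assms] by (simp add: D_inf_eq finite_place_iff)
qed

section \<open>The divisors of \<open>y\<close> and \<open>x^7 - x\<close>\<close>

definition cubic :: "F7 \<Rightarrow> F7 poly" where
  "cubic c = [:1, 1:] ^ 3 - [:c:]"

lemma three_square: "(3 :: F7) ^ 2 = 2" "(- 3 :: F7) ^ 2 = 2"
  by (simp_all add: F7_numeral_reduce)

lemma cubic_irreducible_pm3: "c \<in> {3, - 3} \<Longrightarrow> irreducible (cubic c)"
  using three_square shifted_cube_irreducible unfolding cubic_def by blast

lemma sextic_cubics: "sextic = - (cubic 3 * cubic (- 3))"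
  by (simp only: sextic_factors cubic_def)

lemma cubic_dvd_sextic: "c \<in> {3, - 3} \<Longrightarrow> cubic c dvd sextic - 0 * 0"
  by (auto simp: sextic_cubics)

lemma sextic_mem_iff_at_cubic:
  "P \<noteq> P_inf \<and> of_poly sextic \<in> val_ge (ord_at P) 1 \<longleftrightarrow> (\<exists>c\<in>{3, - 3}. at_root (cubic c) 0 P)"
proof
  assume P: "P \<noteq> P_inf \<and> of_poly sextic \<in> val_ge (ord_at P) 1"
  interpret finite_place "ord_at P"
    using P finite_place_ord_at finite_place_iff by blast
  have s: "of_poly sextic \<in> center"
    using P by (simp add: center_def)
  then have "fun_y - of_poly 0 \<in> val_ge (ord_at P) 1"
    using center.fun_y_mem_iff by (simp add: center_def)
  moreover have "of_poly (cubic 3) * of_poly (cubic (- 3)) \<in> val_ge (ord_at P) 1"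
    using P val_ge_minus[of "of_poly sextic" 1] by (simp add: sextic_cubics)
  then have "of_poly (cubic 3) \<in> val_ge (ord_at P) 1 \<or> of_poly (cubic (- 3)) \<in> val_ge (ord_at P) 1"
    by (intro val_ge_prod of_poly_integral)
  ultimately show "\<exists>c\<in>{3, - 3}. at_root (cubic c) 0 P"
    using integral by (auto simp: at_root_def)
next
  assume "\<exists>c\<in>{3, - 3}. at_root (cubic c) 0 P"
  then obtain c where c: "c \<in> {3, - 3}" "at_root (cubic c) 0 P"
    by blast
  have "cubic c dvd sextic + 0 * 0"
    using cubic_dvd_sextic[OF c(1)] by simp
  then have "curve_fun sextic 0 \<in> val_ge (ord_at P) 1"
    using curve_fun_at_root(2)[OF cubic_irreducible_pm3[OF c(1)] c(2), of sextic 0] by blast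
  then show "P \<noteq> P_inf \<and> of_poly sextic \<in> val_ge (ord_at P) 1"
    using c(2) finite_place_iff by (simp add: at_root_def)
qed

lemma Ram_eq: "Ram P = (if \<exists>c\<in>{3, - 3}. at_root (cubic c) 0 P then 1 else 0)"
proof -
  have "val_inf (of_poly sextic) = - 6"
    by (simp add: val_inf_of_poly sextic_nonzero degree_sextic)
  then have "0 < ord_at P (of_poly sextic) \<longleftrightarrow> P \<noteq> P_inf \<and> of_poly sextic \<in> val_ge (ord_at P) 1"
    using sextic_nonzero by (auto simp: val_ge_def ord_at_P_inf)
  then show ?thesis
    by (simp only: Ram_def sextic_mem_iff_at_cubic)
qed

lemma Ram_P_inf: "Ram P_inf = 0"
  using finite_place_iff by (auto simp: Ram_eq at_root_def)

lemma ord_at_fun_y: "ord_at P fun_y = Ram P - 3 * D_inf P"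
proof (cases "P = P_inf")
  case True
  then show ?thesis
    by (simp add: ord_at_P_inf val_inf_fun_y Ram_P_inf D_inf_eq)
next
  case False
  interpret finite_place "ord_at P"
    using False finite_place_ord_at finite_place_iff by blast
  show ?thesis
    using v_fun_y_ramified v_fun_y_unramified False sextic_mem_iff_at_cubic[of P]
    by (auto simp: Ram_eq D_inf_eq center_def)
qed

definition x7_minus_x :: "F7 poly" where
  "x7_minus_x = [:0, 1:] ^ 7 - [:0, 1:]"

lemma of_poly_x7: "of_poly x7_minus_x = fun_x ^ 7 - fun_x"
  by (simp add: x7_minus_x_def fun_x_def)

lemma x7_factors: "x7_minus_x =
  [:- 0, 1:] * [:- 1, 1:] * [:- 2, 1:] * [:- 3, 1:] * [:- 4, 1:] * [:- 5, 1:] * [:- 6, 1:]"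
  unfolding x7_minus_x_def
  by (simp add: eval_nat_numeral) (simp add: F7_numeral_reduce eq_neg_iff_add_eq_0 neg_eq_iff_add_eq_0)

lemma x7_nonzero: "x7_minus_x \<noteq> 0"
  by (simp add: x7_factors)

lemma degree_x7: "degree x7_minus_x = 7"
  by (simp add: x7_factors degree_mult_eq del: mult_pCons_left mult_pCons_right)

lemma pderiv_x7: "pderiv x7_minus_x = - 1"
proof -
  have "pderiv ([:0, 1:] ^ 7 :: F7 poly) = 0"
    using pderiv_power[of "[:0, 1:] :: F7 poly" 7] by (simp add: F7_seven)
  moreover have "pderiv [:0, 1 :: F7:] = 1"
    by (simp add: pderiv_pCons one_pCons)
  ultimately show ?thesis
    by (simp only: x7_minus_x_def pderiv_diff diff_0)
qed

lemma poly_x7: "poly x7_minus_x a = 0"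
  by (simp add: x7_minus_x_def F7_power7)

lemma irreducible_linear: "irreducible [:- a, 1 :: F7:]"
  by (rule irreducible_linear_field_poly) simp

lemma point_on_curve_dvd: "b ^ 2 = poly sextic a \<Longrightarrow> [:- a, 1:] dvd sextic - [:b:] * [:b:]"
  by (subst poly_eq_0_iff_dvd[symmetric]) (simp add: power2_eq_square)

text \<open>A zero of \<open>x^7 - x\<close> at a place makes \<open>x\<close> reduce to some \<open>a\<close> in \<open>F7\<close>, and then
\<open>y^2\<close> reduces to a square in \<open>F7\<close>, so \<open>y\<close> reduces to a constant too.\<close>

lemma x7_mem_iff_rational:
  "P \<noteq> P_inf \<and> of_poly x7_minus_x \<in> val_ge (ord_at P) 1 \<longleftrightarrow>
   (\<exists>a b. b ^ 2 = poly sextic a \<and> at_root [:- a, 1:] [:b:] P)"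
proof
  assume P: "P \<noteq> P_inf \<and> of_poly x7_minus_x \<in> val_ge (ord_at P) 1"
  interpret finite_place "ord_at P"
    using P finite_place_ord_at finite_place_iff by blast
  have "\<exists>a. of_poly [:- a, 1:] \<in> val_ge (ord_at P) 1"
    using P unfolding x7_factors of_poly_mult
    by (blast dest: val_ge_prod[rotated 2] intro: of_poly_integral val_ge_mult0)
  then obtain a where a: "of_poly [:- a, 1:] \<in> val_ge (ord_at P) 1"
    by blast
  interpret prime_over center "[:- a, 1:]"
    using a irreducible_linear by unfold_locales (auto simp: center_def)
  obtain b where b: "poly sextic a = b ^ 2"
    by (rule poly_sextic_square)
  then have "[:- a, 1:] dvd sextic - [:b:] * [:b:]"
    using point_on_curve_dvd by simp
  then have "of_poly (sextic - [:b:] * [:b:]) \<in> val_ge (ord_at P) 1"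
    unfolding of_poly_mem_iff[symmetric] by (simp only: center_def Int_iff)
  moreover have "of_poly (sextic - [:b:] * [:b:]) = (fun_y - of_poly [:b:]) * (fun_y - of_poly [:- b:])"
  proof -
    have "of_poly [:- b:] = - of_poly [:b:]"
      using of_poly_minus[of "[:b:]"] by simp
    then show ?thesis
      using fun_y_square by (simp add: algebra_simps power2_eq_square del: mult_pCons_left mult_pCons_right)
  qed
  ultimately have "fun_y - of_poly [:b:] \<in> val_ge (ord_at P) 1 \<or> fun_y - of_poly [:- b:] \<in> val_ge (ord_at P) 1"
    by (intro val_ge_prod val_ge_diff fun_y_integral of_poly_integral) simp
  then have "\<exists>b'. b' ^ 2 = poly sextic a \<and> fun_y - of_poly [:b':] \<in> val_ge (ord_at P) 1"
    using b by (metis power2_minus)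
  then show "\<exists>a b. b ^ 2 = poly sextic a \<and> at_root [:- a, 1:] [:b:] P"
    using a integral by (auto simp: at_root_def)
next
  assume "\<exists>a b. b ^ 2 = poly sextic a \<and> at_root [:- a, 1:] [:b:] P"
  then obtain a b where ab: "at_root [:- a, 1:] [:b:] P"
    by blast
  have "[:- a, 1:] dvd x7_minus_x + 0 * [:b:]"
    using poly_x7 by (simp add: poly_eq_0_iff_dvd[symmetric])
  then have "curve_fun x7_minus_x 0 \<in> val_ge (ord_at P) 1"
    using curve_fun_at_root(2)[OF irreducible_linear ab] by blast
  then show "P \<noteq> P_inf \<and> of_poly x7_minus_x \<in> val_ge (ord_at P) 1"
    using ab finite_place_iff by (simp add: at_root_def)
qed

lemma place_degree_rational: "at_root [:- a, 1:] [:b:] P \<Longrightarrow> place_degree P = 1"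
  using place_degree_at_root[OF irreducible_linear] by simp

lemma D_div_eq: "D_div P = (if \<exists>a b. b ^ 2 = poly sextic a \<and> at_root [:- a, 1:] [:b:] P then 1 else 0)"
proof -
  have fin: "0 \<le> ord_at P fun_x \<longleftrightarrow> P \<noteq> P_inf"
    using finite_place_iff[of P] by (simp add: val_ge_def)
  have "of_poly x7_minus_x \<in> val_ge (ord_at P) 1" if P: "P \<noteq> P_inf" "place_degree P = 1"
  proof -
    interpret finite_place "ord_at P"
      using P finite_place_ord_at finite_place_iff by blast
    obtain a where a: "fun_x - of_poly [:a:] \<in> val_ge (ord_at P) 1"
      using degree_one_imp_constant_residue[OF _ integral] P(2) by (auto simp: place_degree_alt)
    obtain q where "x7_minus_x = [:- a, 1:] * q"
      using poly_x7 poly_eq_0_iff_dvd by (metis dvdE)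
    then have "of_poly x7_minus_x = of_poly [:- a, 1:] * of_poly q"
      by (metis of_poly_mult)
    moreover have "of_poly [:- a, 1:] = fun_x - of_poly [:a:]"
      using of_poly_diff[of "[:0, 1:]" "[:a:]"] by (simp add: fun_x_def)
    ultimately have "of_poly x7_minus_x = (fun_x - of_poly [:a:]) * of_poly q"
      by (simp only:)
    then show ?thesis
      using val_ge_mult0(2)[OF a of_poly_integral] by (simp only:)
  qed
  then have "0 \<le> ord_at P fun_x \<and> place_degree P = 1 \<longleftrightarrow>
      (\<exists>a b. b ^ 2 = poly sextic a \<and> at_root [:- a, 1:] [:b:] P)"
    using x7_mem_iff_rational[of P] place_degree_rational[of _ _ P] by (auto simp: fin)
  then show ?thesis
    by (simp only: D_div_def)
qed

lemma D_div_P_inf: "D_div P_inf = 0"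
  using finite_place_iff by (auto simp: D_div_eq at_root_def)

lemma sextic_at_rational:
  assumes "at_root [:- a, 1:] [:b:] P"
  shows "of_poly sextic \<notin> val_ge (ord_at P) 1"
proof
  assume "of_poly sextic \<in> val_ge (ord_at P) 1"
  then have "[:- a, 1:] dvd sextic"
    using curve_fun_at_root(2)[OF irreducible_linear assms, of sextic 0] by simp
  then have "poly sextic a = 0"
    by (simp add: poly_eq_0_iff_dvd)
  then show False
    using poly_sextic_square by (metis power_not_zero)
qed

text \<open>The zeros are simple because \<open>x^7 - x\<close> has derivative \<open>-1\<close> and the rational points are
unramified.\<close>

lemma ord_at_x7: "ord_at P (fun_x ^ 7 - fun_x) = D_div P - 7 * D_inf P"
proof (cases "P = P_inf")
  case True
  then show ?thesis
    by (simp add: ord_at_P_inf val_inf_of_poly x7_nonzero degree_x7 D_div_P_inf D_inf_eq flip: of_poly_x7)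
next
  case False
  interpret finite_place "ord_at P"
    using False finite_place_ord_at finite_place_iff by blast
  show ?thesis
  proof (cases "\<exists>a b. b ^ 2 = poly sextic a \<and> at_root [:- a, 1:] [:b:] P")
    case True
    then obtain a b where ab: "at_root [:- a, 1:] [:b:] P"
      by blast
    interpret prime_over center "[:- a, 1:]"
      using ab irreducible_linear by unfold_locales (auto simp: center_def at_root_def)
    have "of_poly sextic \<notin> center"
      using sextic_at_rational[OF ab] by (simp add: center_def)
    then have p: "ord_at P (of_poly [:- a, 1:]) = 1"
      using unramified v_parameter by blast
    obtain q where q: "x7_minus_x = [:- a, 1:] * q"
      using poly_x7 poly_eq_0_iff_dvd by (metis dvdE)
    have "\<not> [:- a, 1:] dvd q"
    proof
      assume "[:- a, 1:] dvd q"
      then have "[:- a, 1:] dvd pderiv x7_minus_x"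
        unfolding q pderiv_mult by (intro dvd_add dvd_mult2 dvd_refl)
      then have "is_unit [:- a, 1:]"
        by (simp only: pderiv_x7 dvd_minus_iff)
      then show False
        using irred irreducible_not_unit by blast
    qed
    then have "of_poly q \<noteq> 0 \<and> ord_at P (of_poly q) = 0"
      using v_unit[of "of_poly q"] of_poly_mem_iff by simp
    then have "ord_at P (of_poly x7_minus_x) = 1"
      using p by (simp only: q of_poly_mult) (subst v_mult; simp)
    then show ?thesis
      using True False by (simp add: D_div_eq D_inf_eq of_poly_x7)
  next
    case no: False
    then have "of_poly x7_minus_x \<notin> val_ge (ord_at P) 1"
      using x7_mem_iff_rational False by blast
    then have "ord_at P (of_poly x7_minus_x) = 0"
      using v_eq_0_iff[OF of_poly_integral] by blast
    then show ?thesis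
      using no False by (simp add: D_div_eq D_inf_eq of_poly_x7)
  qed
qed

section \<open>The canonical divisor and the divisors of the codes\<close>

text \<open>The order of the differential at \<open>P\<close> is minus that of \<open>x^7 - x\<close> minus that of \<open>dt / dx\<close>,
and \<open>ord_at_d_dx\<close> expresses the latter through \<open>y\<close>; it amounts to \<open>dx / y\<close> having divisor
\<open>D_inf\<close>.\<close>

lemma K_div_eq: "K_div P = Ram P - D_div P + 5 * D_inf P"
proof -
  interpret valuation "ord_at P"
    by (rule valuation_ord_at)
  define t where "t = (SOME t. ord_at P t = 1)"
  have "ord_at P t = 1"
    unfolding t_def using v_uniformizer by (rule someI_ex)
  then have dt: "d_dx t \<noteq> 0" "ord_at P (d_dx t) = - D_inf P - ord_at P fun_y"
    using ord_at_d_dx by blast+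
  let ?g = "fun_x ^ 7 - fun_x"
  have "?g \<noteq> 0"
    using x7_nonzero by (metis of_poly_x7 of_poly_eq_0_iff)

  have "K_div P = ord_at P (- (inverse ?g * inverse (d_dx t)))"
    unfolding K_div_def div_differential_def t_def[symmetric]
    by (simp add: field_class.field_divide_inverse)
  also have "\<dots> = - ord_at P ?g - ord_at P (d_dx t)"
    using \<open>?g \<noteq> 0\<close> dt(1) by (simp only: v_minus v_inverse) (subst v_mult; simp)
  finally show ?thesis
    by (simp add: dt ord_at_x7 ord_at_fun_y)
qed

lemma A_div_eq: "A_div s P = Ram P + (5 - int s) * D_inf P"
  by (simp add: A_div_def G_div_def K_div_eq algebra_simps)

lemma meet_join:
  "inf (G_div 1) (A_div 1) = D_inf" "inf (G_div 4) (A_div 4) = D_inf"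
  "sup (G_div 1) (A_div 1) = (\<lambda>P. Ram P + 4 * D_inf P)"
  "sup (G_div 4) (A_div 4) = (\<lambda>P. Ram P + 4 * D_inf P)"
proof -
  have "inf (G_div 1) (A_div 1) P = D_inf P \<and> inf (G_div 4) (A_div 4) P = D_inf P \<and>
      sup (G_div 1) (A_div 1) P = Ram P + 4 * D_inf P \<and> sup (G_div 4) (A_div 4) P = Ram P + 4 * D_inf P" for P
    using Ram_P_inf by (cases "P = P_inf") (simp_all add: G_div_def A_div_eq D_inf_eq inf_min sup_max Ram_eq)
  then show "inf (G_div 1) (A_div 1) = D_inf" "inf (G_div 4) (A_div 4) = D_inf"
    "sup (G_div 1) (A_div 1) = (\<lambda>P. Ram P + 4 * D_inf P)"
    "sup (G_div 4) (A_div 4) = (\<lambda>P. Ram P + 4 * D_inf P)"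
    by (simp_all only: fun_eq_iff) simp_all
qed

section \<open>The divisor \<open>Ram + 4 D_inf - D\<close>\<close>

text \<open>For both degrees this is the join of \<open>G\<close> and \<open>A\<close> minus \<open>D\<close>, and also \<open>K\<close> minus their
meet.\<close>

definition residual_div :: divisor where
  "residual_div P = Ram P + 4 * D_inf P - D_div P"

definition place_at :: "F7 poly \<Rightarrow> F7 poly \<Rightarrow> place" where
  "place_at p g = (THE P. at_root p g P)"

lemma at_root_iff_place_at:
  assumes "irreducible p" "p dvd sextic - g * g"
  shows "at_root p g P \<longleftrightarrow> P = place_at p g"
  using at_root_ex1[OF assms] unfolding place_at_def by (metis theI')

lemma at_cubic_iff: "c \<in> {3, - 3} \<Longrightarrow> at_root (cubic c) 0 P \<longleftrightarrow> P = place_at (cubic c) 0"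
  by (rule at_root_iff_place_at[OF cubic_irreducible_pm3 cubic_dvd_sextic])

lemma at_point_iff:
  "b ^ 2 = poly sextic a \<Longrightarrow> at_root [:- a, 1:] [:b:] P \<longleftrightarrow> P = place_at [:- a, 1:] [:b:]"
  by (rule at_root_iff_place_at[OF irreducible_linear point_on_curve_dvd])

definition ram_places :: "place set" where
  "ram_places = (\<lambda>c. place_at (cubic c) 0) ` {3, - 3}"

definition affine_points :: "(F7 \<times> F7) set" where
  "affine_points = (SIGMA a:UNIV. {b. b ^ 2 = poly sextic a})"

definition rational_places :: "place set" where
  "rational_places = (\<lambda>(a, b). place_at [:- a, 1:] [:b:]) ` affine_points"

lemma Ram_indicator: "Ram P = (if P \<in> ram_places then 1 else 0)"
  using at_cubic_iff by (auto simp: Ram_eq ram_places_def)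

lemma rational_places_iff:
  "P \<in> rational_places \<longleftrightarrow> (\<exists>a b. b ^ 2 = poly sextic a \<and> at_root [:- a, 1:] [:b:] P)"
proof -
  have "P \<in> rational_places \<longleftrightarrow> (\<exists>a b. b ^ 2 = poly sextic a \<and> P = place_at [:- a, 1:] [:b:])"
    unfolding rational_places_def affine_points_def by (simp add: image_iff)
  then show ?thesis
    by (simp add: at_point_iff cong: conj_cong)
qed

lemma D_div_indicator: "D_div P = (if P \<in> rational_places then 1 else 0)"
  by (simp only: D_div_eq rational_places_iff)

lemma card_ram_places: "card ram_places = 2"
proof -
  have "place_at (cubic 3) 0 \<noteq> place_at (cubic (- 3)) 0"
  proof
    assume eq: "place_at (cubic 3) 0 = place_at (cubic (- 3)) 0"
    define P where "P = place_at (cubic 3) 0"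
    have P: "at_root (cubic 3) 0 P" "at_root (cubic (- 3)) 0 P"
      using at_cubic_iff eq by (auto simp: P_def)
    have "curve_fun (cubic (- 3)) 0 \<in> val_ge (ord_at P) 1"
      using P(2) by (simp add: at_root_def)
    then have "cubic 3 dvd cubic (- 3) + 0 * 0"
      using curve_fun_at_root(2)[OF cubic_irreducible_pm3 P(1)] by blast
    then have "cubic 3 dvd cubic (- 3) - cubic 3"
      by simp
    moreover have "cubic (- 3) - cubic 3 = [:6:]"
      by (simp add: cubic_def)
    ultimately show False
      using F7_six_nonzero degree_shifted_cube[of 3] dvd_imp_degree_le[of "cubic 3" "[:6:]"]
      by (simp add: cubic_def)
  qed
  then show ?thesis
    by (simp add: ram_places_def)
qed

lemma card_rational_places: "card rational_places = 14"
proof -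
  have "inj_on (\<lambda>(a, b). place_at [:- a, 1:] [:b:]) affine_points"
  proof (rule inj_onI, clarify)
    fix a b a' b'
    assume p: "(a, b) \<in> affine_points" "(a', b') \<in> affine_points"
      and eq: "place_at [:- a, 1:] [:b:] = place_at [:- a', 1:] [:b':]"
    define P where "P = place_at [:- a, 1:] [:b:]"
    have P: "at_root [:- a, 1:] [:b:] P" "at_root [:- a', 1:] [:b':] P"
      using p eq at_point_iff by (simp_all add: affine_points_def P_def)
    have "curve_fun (- [:b':]) 1 = fun_y - of_poly [:b':]"
      unfolding curve_fun_def of_poly_minus by simp
    then have "curve_fun [:- a', 1:] 0 \<in> val_ge (ord_at P) 1" "curve_fun (- [:b':]) 1 \<in> val_ge (ord_at P) 1"
      using P(2) by (simp_all only: at_root_def curve_fun_0_right)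
    then have "[:- a, 1:] dvd [:- a', 1:] + 0 * [:b:]" "[:- a, 1:] dvd - [:b':] + 1 * [:b:]"
      using curve_fun_at_root(2)[OF irreducible_linear P(1)] by blast+
    then show "a = a' \<and> b = b'"
      by (simp add: poly_eq_0_iff_dvd[symmetric])
  qed
  then have "card rational_places = card affine_points"
    unfolding rational_places_def by (rule card_image)
  also have "\<dots> = (\<Sum>a\<in>(UNIV :: F7 set). 2)"
    unfolding affine_points_def by (subst card_SigmaI) (simp_all add: card_square_roots_sextic)
  also have "\<dots> = 14"
    by (simp add: CARD_seven)
  finally show ?thesis .
qed

lemma residual_support: "{P. residual_div P \<noteq> 0} \<subseteq> insert P_inf (ram_places \<union> rational_places)"
  by (auto simp: residual_div_def Ram_indicator D_div_indicator D_inf_eq split: if_splits)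

lemma finite_places: "finite ram_places" "finite rational_places"
  by (simp_all add: ram_places_def rational_places_def)

lemma residual_in_divisors: "residual_div \<in> divisors"
  unfolding divisors_def using finite_subset[OF residual_support] finite_places by simp

text \<open>Two cubic places, the place at infinity of degree two with multiplicity four, and fourteen rational
points: \<open>2 * 3 + 4 * 2 - 14 = 0\<close>.\<close>

lemma div_degree_residual: "div_degree residual_div = 0"
proof -
  define S where "S = insert P_inf (ram_places \<union> rational_places)"
  have fin: "finite S"
    using finite_places by (simp add: S_def)
  have "div_degree residual_div = (\<Sum>P\<in>S. residual_div P * int (place_degree P))"
    unfolding div_degree_def by (rule sum.mono_neutral_left) (use fin residual_support S_def in auto)
  also have "\<dots> = (\<Sum>P\<in>S. Ram P * int (place_degree P)) + 4 * (\<Sum>P\<in>S. D_inf P * int (place_degree P))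
      - (\<Sum>P\<in>S. D_div P * int (place_degree P))"
    by (simp add: residual_div_def sum.distrib sum_subtractf sum_distrib_left algebra_simps)
  also have "(\<Sum>P\<in>S. Ram P * int (place_degree P)) = (\<Sum>P\<in>ram_places. 3)"
  proof (rule sum.mono_neutral_cong_right[OF fin])
    fix P assume P: "P \<in> ram_places"
    then obtain c where c: "c \<in> {3, - 3}" "at_root (cubic c) 0 P"
      using at_cubic_iff unfolding ram_places_def by blast
    then have "place_degree P = 3"
      using place_degree_at_root[OF cubic_irreducible_pm3] degree_shifted_cube by (simp only: cubic_def)
    then show "Ram P * int (place_degree P) = 3"
      using P by (simp add: Ram_indicator)
  qed (auto simp: S_def Ram_indicator)
  also have "(\<Sum>P\<in>S. D_inf P * int (place_degree P)) = (\<Sum>P\<in>{P_inf}. 2)"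
    by (rule sum.mono_neutral_cong_right[OF fin]) (auto simp: S_def D_inf_eq place_degree_P_inf)
  also have "(\<Sum>P\<in>S. D_div P * int (place_degree P)) = (\<Sum>P\<in>rational_places. 1)"
  proof (rule sum.mono_neutral_cong_right[OF fin])
    fix P assume P: "P \<in> rational_places"
    then obtain a b where "at_root [:- a, 1:] [:b:] P"
      unfolding rational_places_iff by blast
    then show "D_div P * int (place_degree P) = 1"
      using P place_degree_rational by (simp add: D_div_indicator)
  qed (auto simp: S_def D_div_indicator)
  finally show ?thesis
    by (simp add: card_ram_places card_rational_places)
qed

section \<open>Functions without poles\<close>

text \<open>The hyperelliptic involution \<open>y \<mapsto> - y\<close>.\<close>

definition conj_fun :: "funfield \<Rightarrow> funfield" where
  "conj_fun h = FF (part_1 h) (- part_y h)"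

lemma conj_fun_simps:
  "conj_fun 0 = 0" "conj_fun (conj_fun h) = h" "conj_fun (of_poly p) = of_poly p"
  "conj_fun (g + h) = conj_fun g + conj_fun h" "conj_fun (g * h) = conj_fun g * conj_fun h"
  "conj_fun (g - h) = conj_fun g - conj_fun h"
  by (simp_all add: conj_fun_def zero_funfield_def of_poly_def plus_funfield_def times_funfield_def
      minus_funfield_def)

lemma conj_fun_eq_0_iff: "conj_fun h = 0 \<longleftrightarrow> h = 0"
  by (metis conj_fun_simps(1,2))

lemma conj_fun_fraction:
  "r \<noteq> 0 \<Longrightarrow> conj_fun (curve_fun p q / of_poly r) = curve_fun p (- q) / of_poly r"
  by (simp add: curve_fun_divide_FF conj_fun_def)

lemma discrete_valuation_conj: "discrete_valuation (\<lambda>h. ord_at P (conj_fun h))"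
proof -
  interpret valuation "ord_at P"
    by (rule valuation_ord_at)
  obtain t where "ord_at P t = 1"
    using v_uniformizer by blast
  then have "ord_at P (conj_fun (conj_fun t)) = 1"
    by (simp add: conj_fun_simps)
  then show ?thesis
    unfolding discrete_valuation_def
    using v_add[of "conj_fun g" "conj_fun h" for g h] v_mult v_const
    by (auto simp: conj_fun_simps(1,3,5) conj_fun_eq_0_iff simp flip: conj_fun_simps(4) intro: exI[of _ "conj_fun t"])
qed

definition no_poles :: "funfield \<Rightarrow> bool" where
  "no_poles h \<longleftrightarrow> (\<forall>P. h \<in> val_ge (ord_at P) 0)"

lemma no_poles_mult: "no_poles g \<Longrightarrow> no_poles h \<Longrightarrow> no_poles (g * h)"
  using valuation.val_ge_mult0(1)[OF valuation_ord_at] by (simp add: no_poles_def)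

lemma no_poles_diff_const: "no_poles h \<Longrightarrow> no_poles (h - of_poly [:c:])"
  using valuation.val_ge_diff[OF valuation_ord_at] valuation.val_ge_const[OF valuation_ord_at]
  by (simp add: no_poles_def)

lemma no_poles_conj:
  assumes "no_poles h"
  shows "no_poles (conj_fun h)"
  unfolding no_poles_def
proof
  fix P
  have "ord_at (Place (\<lambda>h. ord_at P (conj_fun h))) = (\<lambda>h. ord_at P (conj_fun h))"
    by (simp add: Place_inverse discrete_valuation_conj)
  then show "conj_fun h \<in> val_ge (ord_at P) 0"
    using assms unfolding no_poles_def val_ge_def by (metis (mono_tags, lifting) conj_fun_eq_0_iff mem_Collect_eq)
qed

text \<open>A reduced denominator with an irreducible factor has a zero at a place over that factor, which exists by
\<open>place_over_irreducible\<close>; so the fraction is a polynomial, and the place at infinity bounds its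
degree.\<close>

lemma no_poles_rational:
  assumes "no_poles (of_poly p / of_poly r)" "r \<noteq> 0"
  obtains c where "of_poly p / of_poly r = of_poly [:c:]"
proof (cases "p = 0")
  case True
  then show ?thesis
    using that[of 0] by simp
next
  case p0: False
  define g where "g = gcd p r"
  obtain p' r' where pr: "p = g * p'" "r = g * r'"
    unfolding g_def by (metis dvdE gcd_dvd1 gcd_dvd2)
  have nz: "g \<noteq> 0" "p' \<noteq> 0" "r' \<noteq> 0"
    using p0 assms(2) by (auto simp: pr)
  have "coprime p' r'"
    using gcd_coprime[of p r p' r'] assms(2) pr by (metis g_def gcd_eq_0_iff mult.commute)
  have eq: "of_poly p / of_poly r = of_poly p' / of_poly r'"
    using nz by (simp add: pr)
  have unit: "is_unit r'"
  proof (rule ccontr)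
    assume "\<not> is_unit r'"
    then obtain q where q: "prime_elem q" "q dvd r'"
      using prime_divisor_exists[of r'] nz by (metis prime_imp_prime_elem)
    then have irr: "irreducible q"
      using prime_elem_imp_irreducible by blast
    then have "\<not> q dvd p'"
      using q(2) \<open>coprime p' r'\<close> coprime_common_divisor irreducible_not_unit by blast
    obtain P where P: "fun_x \<in> val_ge (ord_at P) 0" "of_poly q \<in> val_ge (ord_at P) 1"
      using place_over_irreducible[OF irr] .
    interpret finite_place "ord_at P"
      using P finite_place_ord_at by blast
    interpret prime_over center q
      using P irr by unfold_locales (auto simp: center_def)
    have "of_poly p' \<noteq> 0 \<and> ord_at P (of_poly p') = 0"
      using v_unit[of "of_poly p'"] of_poly_mem_iff \<open>\<not> q dvd p'\<close> by simp
    moreover have "of_poly r' \<in> val_ge (ord_at P) 1"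
      using of_poly_mem_iff q(2) by (auto simp: center_def)
    then have "1 \<le> ord_at P (of_poly r')"
      using nz by (simp add: val_ge_iff)
    ultimately have "ord_at P (of_poly p' / of_poly r') < 0"
      using nz by (simp add: v_divide)
    then show False
      using assms(1) nz unfolding no_poles_def eq by (metis divide_eq_0_iff not_le of_poly_eq_0_iff val_ge_iff)
  qed
  have "0 \<le> val_inf (of_poly p' / of_poly r')"
    using assms(1) nz unfolding no_poles_def eq by (metis divide_eq_0_iff of_poly_eq_0_iff val_inf.val_ge_iff ord_at_P_inf)
  then have "degree p' \<le> degree r'"
    using nz by (simp add: val_inf.v_divide val_inf_of_poly)
  moreover have "degree r' = 0"
    using unit nz is_unit_iff_degree by blast
  ultimately have "degree p' = 0"
    by simp
  then obtain a b where ab: "p' = [:a:]" "r' = [:b:]"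
    using \<open>degree r' = 0\<close> by (metis degree_eq_zeroE)
  then have "p' = [:a / b:] * r'"
    using nz by simp
  then have "of_poly p' = of_poly [:a / b:] * of_poly r'"
    by (metis of_poly_mult)
  then have "of_poly p' / of_poly r' = of_poly [:a / b:]"
    using nz by (simp add: nonzero_eq_divide_eq)
  then show ?thesis
    using that[of "a / b"] eq by simp
qed

lemma rational_place_exists: obtains a b P where "at_root [:- a, 1:] [:b:] P"
proof -
  obtain b where "poly sextic 0 = b ^ 2"
    by (rule poly_sextic_square)
  then show ?thesis
    using that at_point_iff by metis
qed

text \<open>Subtract the value \<open>c\<close> at a rational point.  The norm of the difference is a rational function of
\<open>x\<close> without poles, hence a constant, and it vanishes at that point, hence is zero.\<close>

lemma no_poles_imp_constant:
  assumes h: "no_poles h"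
  obtains c where "h = of_poly [:c:]"
proof -
  obtain a b P where P: "at_root [:- a, 1:] [:b:] P"
    by (rule rational_place_exists)
  interpret finite_place "ord_at P"
    using P finite_place_ord_at by (simp add: at_root_def)
  obtain c where c: "h - of_poly [:c:] \<in> val_ge (ord_at P) 1"
    using degree_one_imp_constant_residue place_degree_rational[OF P] h
    by (auto simp: place_degree_alt no_poles_def)
  define f where "f = h - of_poly [:c:]"
  have f: "no_poles f"
    using h by (simp add: f_def no_poles_diff_const)
  obtain p q r where r: "r \<noteq> 0" and fpq: "f = curve_fun p q / of_poly r"
    by (rule funfield_fraction)
  have "f * conj_fun f = of_poly (norm_form p q) / of_poly (r * r)"
    using r by (simp add: fpq conj_fun_fraction curve_fun_norm)
  moreover have "no_poles (f * conj_fun f)"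
    using f by (intro no_poles_mult no_poles_conj)
  ultimately obtain e where e: "f * conj_fun f = of_poly [:e:]"
    using no_poles_rational[of "norm_form p q" "r * r"] r by auto
  have "f * conj_fun f \<in> val_ge (ord_at P) 1"
    using c no_poles_conj[OF f] by (intro val_ge_mult0(2)) (auto simp: f_def no_poles_def)
  then have "e = 0"
    using v_const[of e] unfolding e by (cases "e = 0") (simp_all add: val_ge_def)
  then have "f = 0"
    using e conj_fun_eq_0_iff by auto
  then show ?thesis
    using that[of c] by (simp add: f_def)
qed

section \<open>The Riemann--Roch spaces\<close>

lemma RR_space_iff: "h \<in> RR_space E \<longleftrightarrow> (\<forall>P. h \<in> val_ge (ord_at P) (- E P))"
proof -
  have "0 \<le> ord_at P h + E P \<longleftrightarrow> - E P \<le> ord_at P h" for P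
    by linarith
  then show ?thesis
    by (auto simp: RR_space_def principal_def val_ge_def)
qed

lemma RR_space_subspace: "F7_subspace (RR_space E)"
proof -
  note S = F7_subspaceD[OF valuation.val_ge_subspace[OF valuation_ord_at]]
  show ?thesis
    unfolding F7_subspace_def by (auto simp: RR_space_iff intro!: S(1,2,3))
qed

lemma RR_space_mono: "(\<And>P. E P \<le> E' P) \<Longrightarrow> RR_space E \<subseteq> RR_space E'"
proof
  fix h assume le: "\<And>P. E P \<le> E' P" and "h \<in> RR_space E"
  then show "h \<in> RR_space E'"
    using valuation.val_ge_mono[OF valuation_ord_at _ le_imp_neg_le[OF le]] by (simp add: RR_space_iff)
qed

lemma subspace_sum:
  assumes "F7_subspace V" "F7_subspace W"
  shows "F7_subspace {g + a | g a. g \<in> V \<and> a \<in> W}"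
  unfolding F7_subspace_def
proof (intro conjI ballI allI)
  note V = F7_subspaceD[OF assms(1)] and W = F7_subspaceD[OF assms(2)]
  show "0 \<in> {g + a | g a. g \<in> V \<and> a \<in> W}"
    using V(1) W(1) by (metis (mono_tags, lifting) add_0 mem_Collect_eq)
  show "f + h \<in> {g + a | g a. g \<in> V \<and> a \<in> W}"
    if fh: "f \<in> {g + a | g a. g \<in> V \<and> a \<in> W}" "h \<in> {g + a | g a. g \<in> V \<and> a \<in> W}" for f h
  proof -
    obtain g a g' a' where "f = g + a" "h = g' + a'" "g \<in> V" "a \<in> W" "g' \<in> V" "a' \<in> W"
      using fh by blast
    then have "f + h = (g + g') + (a + a')" "g + g' \<in> V" "a + a' \<in> W"
      using V(2) W(2) by simp_all
    then show ?thesis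
      by blast
  qed
  show "of_poly [:c:] * h \<in> {g + a | g a. g \<in> V \<and> a \<in> W}"
    if "h \<in> {g + a | g a. g \<in> V \<and> a \<in> W}" for c h
  proof -
    obtain g a where "h = g + a" "g \<in> V" "a \<in> W"
      using \<open>h \<in> _\<close> by blast
    then have "of_poly [:c:] * h = of_poly [:c:] * g + of_poly [:c:] * a"
      "of_poly [:c:] * g \<in> V" "of_poly [:c:] * a \<in> W"
      using V(3) W(3) by (simp_all add: distrib_left)
    then show ?thesis
      by blast
  qed
qed

lemma subspace_Int: "F7_subspace V \<Longrightarrow> F7_subspace W \<Longrightarrow> F7_subspace (V \<inter> W)"
  by (simp add: F7_subspace_def)

lemma excess_numerator_subspace:
  "F7_subspace ({g + a | g a. g \<in> RR_space G \<and> a \<in> RR_space A} \<inter> RR_space E)"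
  by (intro subspace_Int subspace_sum RR_space_subspace)

lemma quotient_dim_0:
  assumes "F7_subspace V" "F7_subspace W" "V \<subseteq> W"
  shows "quotient_dim V W = 0"
proof -
  have "basis_modulo V W {}"
    using assms(3) by (auto simp: basis_modulo_def)
  then show ?thesis
    using quotient_dim_basis[OF assms(1,2)] by simp
qed

text \<open>If \<open>G \<le> A\<close>, the numerator is contained in \<open>L(A - D)\<close>, which is a summand of the denominator.\<close>

lemma excess_le_eq_0:
  assumes "\<And>P. G P \<le> A P"
  shows "excess G A = 0"
  unfolding excess_def
proof (rule quotient_dim_0)
  have "sup G A = A"
    using assms by (auto simp: fun_eq_iff sup_absorb2)
  moreover have "h \<in> {g + a | g a. g \<in> RR_space (\<lambda>P. G P - D_div P) \<and> a \<in> RR_space (\<lambda>P. A P - D_div P)}"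
    if "h \<in> RR_space (\<lambda>P. A P - D_div P)" for h
    using that F7_subspaceD(1)[OF RR_space_subspace] by (metis (mono_tags, lifting) add_0 mem_Collect_eq)
  ultimately show "{g + a | g a. g \<in> RR_space G \<and> a \<in> RR_space A} \<inter> RR_space (\<lambda>P. sup G A P - D_div P)
      \<subseteq> {g + a | g a. g \<in> RR_space (\<lambda>P. G P - D_div P) \<and> a \<in> RR_space (\<lambda>P. A P - D_div P)}"
    by auto
qed (intro excess_numerator_subspace subspace_sum RR_space_subspace)+

section \<open>The function \<open>(x^7 - x) / y\<close> and the excess\<close>

definition x7_over_y :: funfield where
  "x7_over_y = (fun_x ^ 7 - fun_x) / fun_y"

lemma x7_fun_nonzero: "fun_x ^ 7 - fun_x \<noteq> 0"
  using x7_nonzero by (metis of_poly_x7 of_poly_eq_0_iff)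

lemma x7_over_y_nonzero: "x7_over_y \<noteq> 0"
  using x7_fun_nonzero by (simp add: x7_over_y_def)

lemma ord_at_x7_over_y: "ord_at P x7_over_y = - residual_div P"
proof -
  have "ord_at P x7_over_y = ord_at P (fun_x ^ 7 - fun_x) - ord_at P fun_y"
    unfolding x7_over_y_def using x7_fun_nonzero by (intro valuation.v_divide[OF valuation_ord_at]) auto
  then show ?thesis
    by (simp add: ord_at_x7 ord_at_fun_y residual_div_def)
qed

text \<open>Dividing by \<open>(x^7 - x) / y\<close>, whose divisor is minus \<open>residual_div\<close>, turns the space into that
of the functions without poles.\<close>

lemma RR_space_residual: "RR_space residual_div = {of_poly [:c:] * x7_over_y | c. True}"
proof (intro equalityI subsetI)
  fix h assume h: "h \<in> RR_space residual_div"
  have "no_poles (h * inverse x7_over_y)"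
    unfolding no_poles_def
  proof
    fix P
    interpret valuation "ord_at P"
      by (rule valuation_ord_at)
    have "inverse x7_over_y \<in> val_ge (ord_at P) (residual_div P)"
      by (rule val_ge_inverse) (simp add: ord_at_x7_over_y)
    moreover have "h \<in> val_ge (ord_at P) (- residual_div P)"
      using h by (simp add: RR_space_iff)
    ultimately show "h * inverse x7_over_y \<in> val_ge (ord_at P) 0"
      using val_ge_mult by fastforce
  qed
  then obtain c where "h * inverse x7_over_y = of_poly [:c:]"
    by (rule no_poles_imp_constant)
  then have "h = of_poly [:c:] * x7_over_y"
    using x7_over_y_nonzero by (simp add: field_simps)
  then show "h \<in> {of_poly [:c:] * x7_over_y | c. True}"
    by blast
next
  fix h assume "h \<in> {of_poly [:c:] * x7_over_y | c. True}"
  moreover have "x7_over_y \<in> RR_space residual_div"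
    by (simp add: RR_space_iff val_ge_def ord_at_x7_over_y)
  ultimately show "h \<in> RR_space residual_div"
    using F7_subspaceD(3)[OF RR_space_subspace] by auto
qed

text \<open>This is \<open>x^7 - x = (x + 1) (1 - y^2)\<close> divided by \<open>y\<close>.  The first term has poles only at the
ramification places, the second only at infinity.\<close>

lemma x7_over_y_split: "x7_over_y = (fun_x + 1) * inverse fun_y - (fun_x + 1) * fun_y"
proof -
  have "fun_x ^ 7 - fun_x = of_poly ([:1, 1:] * (1 - sextic))"
    unfolding artin_schreier_sextic[symmetric] by (simp add: fun_x_def)
  also have "\<dots> = (fun_x + 1) * (1 - fun_y * fun_y)"
  proof -
    have "of_poly [:1, 1:] = fun_x + 1"
      by (subst of_poly_pCons) simp
    then show ?thesis
      using fun_y_square by (simp add: power2_eq_square del: mult_pCons_left mult_pCons_right)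
  qed
  finally show ?thesis
    by (simp add: x7_over_y_def field_simps)
qed

lemma x7_over_y_in_sum:
  "- ((fun_x + 1) * fun_y) \<in> RR_space (\<lambda>P. 4 * D_inf P)"
  "(fun_x + 1) * inverse fun_y \<in> RR_space (\<lambda>P. Ram P + D_inf P)"
proof -
  have x1: "fun_x + 1 \<in> val_ge (ord_at P) (- D_inf P)" for P
  proof -
    interpret valuation "ord_at P"
      by (rule valuation_ord_at)
    have "fun_x \<in> val_ge (ord_at P) (- D_inf P)"
    proof (cases "P = P_inf")
      case True
      then show ?thesis
        by (simp add: val_ge_def D_inf_eq ord_at_P_inf val_inf_fun_x)
    next
      case False
      then show ?thesis
        using finite_place_iff[of P] by (simp add: D_inf_eq)
    qed
    then show ?thesis
      by (intro val_ge_add) (simp_all add: val_ge_iff D_inf_eq)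
  qed
  show "- ((fun_x + 1) * fun_y) \<in> RR_space (\<lambda>P. 4 * D_inf P)"
    unfolding RR_space_iff
  proof
    fix P
    interpret valuation "ord_at P"
      by (rule valuation_ord_at)
    have "fun_y \<in> val_ge (ord_at P) (- 3 * D_inf P)"
      by (simp add: val_ge_iff ord_at_fun_y Ram_eq)
    then show "- ((fun_x + 1) * fun_y) \<in> val_ge (ord_at P) (- (4 * D_inf P))"
      using val_ge_mult[OF x1[of P]] by (intro val_ge_minus) fastforce
  qed
  show "(fun_x + 1) * inverse fun_y \<in> RR_space (\<lambda>P. Ram P + D_inf P)"
    unfolding RR_space_iff
  proof
    fix P
    interpret valuation "ord_at P"
      by (rule valuation_ord_at)
    have "inverse fun_y \<in> val_ge (ord_at P) (- Ram P)"
      by (rule val_ge_inverse) (simp add: ord_at_fun_y D_inf_eq)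
    then show "(fun_x + 1) * inverse fun_y \<in> val_ge (ord_at P) (- (Ram P + D_inf P))"
      using val_ge_mult[OF x1[of P]] by fastforce
  qed
qed

text \<open>Such a space lies in the line spanned by \<open>(x^7 - x) / y\<close>, and the nonzero elements of this line
have too large a pole, or too small a zero, at \<open>Q\<close>.\<close>

lemma small_RR_space_trivial:
  assumes le: "\<And>P. E P \<le> residual_div P" and less: "E Q < residual_div Q"
  shows "RR_space E = {0}"
proof -
  have "h = 0" if h: "h \<in> RR_space E" for h
  proof (rule ccontr)
    assume nz: "h \<noteq> 0"
    have "h \<in> RR_space residual_div"
      using RR_space_mono[of E residual_div] le h by blast
    then obtain c where c: "h = of_poly [:c:] * x7_over_y"
      unfolding RR_space_residual by blast
    then have "c \<noteq> 0"
      using nz by auto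
    interpret valuation "ord_at Q"
      by (rule valuation_ord_at)
    have "ord_at Q h = - residual_div Q"
      using \<open>c \<noteq> 0\<close> x7_over_y_nonzero by (simp add: c v_mult v_const ord_at_x7_over_y)
    moreover have "- E Q \<le> ord_at Q h"
      using h val_ge_iff[OF nz] unfolding RR_space_iff by blast
    ultimately show False
      using less by simp
  qed
  then show ?thesis
    using F7_subspaceD(1)[OF RR_space_subspace] by blast
qed

lemma G4_eq: "G_div 4 = (\<lambda>P. 4 * D_inf P)"
  by (simp add: G_div_def fun_eq_iff)

lemma A4_eq: "A_div 4 = (\<lambda>P. Ram P + D_inf P)"
  by (simp add: A_div_eq fun_eq_iff)

text \<open>The denominator vanishes: \<open>L(4 D_inf - D)\<close> excludes the poles of \<open>(x^7 - x) / y\<close> at the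
ramification places, and \<open>L(Ram + D_inf - D)\<close> excludes its pole of order four at infinity.  So the
excess is the dimension of the numerator, the line spanned by this function.\<close>

lemma excess_4: "excess (G_div 4) (A_div 4) = 1"
proof -
  have sup4: "(\<lambda>P. sup (G_div 4) (A_div 4) P - D_div P) = residual_div"
    unfolding meet_join(4) by (simp add: fun_eq_iff residual_div_def)
  have W: "RR_space (\<lambda>P. G_div 4 P - D_div P) = {0}"
  proof (rule small_RR_space_trivial)
    show "G_div 4 P - D_div P \<le> residual_div P" for P
      by (simp add: G4_eq residual_div_def Ram_eq)
    have "Ram (place_at (cubic 3) 0) = 1"
      by (simp add: Ram_indicator ram_places_def)
    then show "G_div 4 (place_at (cubic 3) 0) - D_div (place_at (cubic 3) 0) < residual_div (place_at (cubic 3) 0)"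
      by (simp add: G4_eq residual_div_def)
  qed
  have W': "RR_space (\<lambda>P. A_div 4 P - D_div P) = {0}"
  proof (rule small_RR_space_trivial)
    show "A_div 4 P - D_div P \<le> residual_div P" for P
      by (simp add: A4_eq residual_div_def D_inf_eq)
    show "A_div 4 P_inf - D_div P_inf < residual_div P_inf"
      by (simp add: A4_eq residual_div_def D_inf_eq)
  qed
  define V where "V = {g + a | g a. g \<in> RR_space (G_div 4) \<and> a \<in> RR_space (A_div 4)} \<inter> RR_space residual_div"
  have V: "F7_subspace V"
    unfolding V_def by (rule excess_numerator_subspace)
  have x7_over_yV: "x7_over_y \<in> V"
  proof -
    have "x7_over_y = - ((fun_x + 1) * fun_y) + (fun_x + 1) * inverse fun_y"
      by (simp add: x7_over_y_split)
    then have "x7_over_y \<in> {g + a | g a. g \<in> RR_space (G_div 4) \<and> a \<in> RR_space (A_div 4)}"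
      using x7_over_y_in_sum unfolding G4_eq A4_eq by blast
    moreover have "x7_over_y \<in> RR_space residual_div"
      unfolding RR_space_residual by (rule CollectI, rule exI[of _ 1]) simp
    ultimately show ?thesis
      by (simp add: V_def)
  qed
  have "basis_modulo V {0} {x7_over_y}"
    unfolding basis_modulo_alt
  proof (intro conjI ballI)
    fix h assume "h \<in> V"
    then obtain c where c: "h = of_poly [:c:] * x7_over_y"
      by (auto simp: V_def RR_space_residual)
    show "\<exists>!c. c \<in> coeff_funs {x7_over_y} \<and> h - comb {x7_over_y} c \<in> {0}"
    proof (rule ex1I[of _ "\<lambda>b. if b = x7_over_y then c else 0"])
      fix e assume e: "e \<in> coeff_funs {x7_over_y} \<and> h - comb {x7_over_y} e \<in> {0}"
      then have "of_poly [:c:] * x7_over_y = of_poly [:e x7_over_y:] * x7_over_y"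
        by (simp add: c comb_def)
      then have "e x7_over_y = c"
        using x7_over_y_nonzero by simp
      then show "e = (\<lambda>b. if b = x7_over_y then c else 0)"
        using e by (auto simp: coeff_funs_def)
    qed (simp add: c coeff_funs_def comb_def)
  qed (use x7_over_yV in auto)
  moreover have "F7_subspace {0}"
    by (simp add: F7_subspace_def)
  ultimately have "quotient_dim V {0} = card {x7_over_y}"
    using quotient_dim_basis[OF V] by blast
  then show ?thesis
    unfolding excess_def sup4 W W' V_def by simp
qed

theorem proposition6p7:
  shows "inf (G_div 1) (A_div 1) = D_inf \<and> inf (G_div 4) (A_div 4) = D_inf \<and>
    sup (G_div 1) (A_div 1) = (\<lambda>P. Ram P + 4 * D_inf P) \<and>
    sup (G_div 4) (A_div 4) = (\<lambda>P. Ram P + 4 * D_inf P) \<and>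
    t_deg 1 = 0 \<and> t_deg 4 = 0 \<and>
    excess (G_div 1) (A_div 1) = 0 \<and> excess (G_div 4) (A_div 4) = 1 \<and>
    meet_class 1 \<in> Pic0 \<and> meet_class 4 \<in> Pic0 \<and> meet_class 1 = meet_class 4 \<and>
    (\<nexists>\<Phi> :: divisor \<times> divisor \<Rightarrow> nat. \<forall>s\<in>{1, 4}.
       excess (G_div s) (A_div s) = \<Phi> (inf (G_div s) (A_div s), sup (G_div s) (A_div s))) \<and>
    (\<nexists>\<Phi> :: divisor set \<Rightarrow> nat. \<forall>s\<in>{1, 4}.
       excess (G_div s) (A_div s) = \<Phi> (meet_class s))"
proof -
  have excess_1: "excess (G_div 1) (A_div 1) = 0"
    by (rule excess_le_eq_0) (simp add: G_div_def A_div_eq Ram_eq D_inf_eq)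
  have sup_residual: "(\<lambda>P. sup (G_div s) (A_div s) P - D_div P) = residual_div" if "s \<in> {1, 4}" for s
    using that meet_join(3,4) by (auto simp: fun_eq_iff residual_div_def)
  have "(\<lambda>P. K_div P - D_inf P) = residual_div"
    by (simp add: fun_eq_iff K_div_eq residual_div_def)
  then have class_s: "meet_class s = divisor_class residual_div" if "s \<in> {1, 4}" for s
  proof -
    have "inf (G_div s) (A_div s) = D_inf"
      using that meet_join(1,2) by blast
    then show ?thesis
      using \<open>(\<lambda>P. K_div P - D_inf P) = residual_div\<close> by (simp only: meet_class_def)
  qed
  have "divisor_class residual_div \<in> Pic0"
    unfolding divisor_class_def Pic0_def
    by (rule quotientI) (simp add: residual_in_divisors div_degree_residual)
  then have cls: "meet_class 1 \<in> Pic0" "meet_class 4 \<in> Pic0" "meet_class 1 = meet_class 4"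
    using class_s by simp_all
  have deg: "t_deg 1 = 0" "t_deg 4 = 0"
    using sup_residual div_degree_residual by (simp_all add: t_deg_def)
  have "\<nexists>\<Phi> :: divisor \<times> divisor \<Rightarrow> nat. \<forall>s\<in>{1, 4}.
       excess (G_div s) (A_div s) = \<Phi> (inf (G_div s) (A_div s), sup (G_div s) (A_div s))"
    using excess_1 excess_4 meet_join by (auto; metis zero_neq_one)
  moreover have "\<nexists>\<Phi> :: divisor set \<Rightarrow> nat. \<forall>s\<in>{1, 4}. excess (G_div s) (A_div s) = \<Phi> (meet_class s)"
    using excess_1 excess_4 cls(3) by auto
  ultimately show ?thesis
    using meet_join deg excess_1 excess_4 cls by blast
qed

end
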